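(* Let $K$ be a field with $\mathrm{char}(K)\neq2$, let $\mathcal{G}=\mathrm{GA}_2(K)$ and let $f\in\mathcal{G}$ be a CR element. If $f$ has a symmetry in $\mathcal{G}$ which is an involution, then this symmetry is conjugate in $\mathcal{G}$ to $I=\mathrm{diag}(-1,-1)$. Also, $f$ is then conjugate in $\mathcal{G}$ to a cyclically reduced element with normal form $$f'=b\circ a_m\circ e_m\circ\cdots\circ a_1\circ e_1,$$ where $m\ge1$, each $a_i\in\mathcal{I}$ ($a_m$ being present), each $e_i\in\mathcal{J}$ ($e_1$ being present) is of the form $x'=x+y^2P_i(y),\ y'=y$ with $P_i\neq0$ odd (i.e. $P_i(-y)=-P_i(y)$), and $b$ is a linear map given by a matrix $\begin{pmatrix}\alpha&\gamma\\0&\beta\end{pmatrix}$ with $\alpha\beta\ne0$. It follows that, when $f$ has such an involutory symmetry, it is conjugate to a cyclically reduced element $f'$ which fixes the origin and has $\mathrm{pol\,deg}(f')=(n_m,\ldots,n_1)$ with all $n_i$ odd integers $\ge3$. If $K$ is a field of characteristic $0$ whose group of roots of unity is isomorphic to $C_2$ (this includes $K=\mathbb{Q}$ and $K=\mathbb{R}$), this gives, up to conjugacy, the description of all nontrivial finite order symmetries of CR elements $f$ and the corresponding normal form of $f$: if a CR element $f$ has a nontrivial symmetry of finite order, this symmetry is conjugate to $I$ and $f$ is conjugate to an element $f'$ of the form just described.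
   Context: $\mathcal{G}=\mathrm{GA}_2(K)$ is the group, under composition, of polynomial automorphisms of the affine plane over $K$: maps $x'=P(x,y),\ y'=Q(x,y)$ with $P,Q\in K[x,y]$ that have a polynomial inverse; elements are formal polynomial maps, i.e. distinguished by their polynomials. A matrix in $\mathrm{GL}(2,K)$ is identified with the corresponding linear map. A symmetry of $f$ is an element of $\mathcal{G}$ commuting with $f$. An involution is an element $s$ with $s^2=1\neq s$. Let $\mathcal{A}\subset\mathcal{G}$ be the subgroup of affine maps $\boldsymbol{x}\mapsto M\boldsymbol{x}+\boldsymbol{a}$ ($M\in\mathrm{GL}(2,K)$, $\boldsymbol{a}\in K^2$), $\mathcal{E}\subset\mathcal{G}$ the subgroup of elementary maps $x'=\alpha x+P(y),\ y'=\beta y+v$ ($P\in K[y]$, $\alpha,\beta,v\in K$, $\alpha\beta\neq0$), and $\mathcal{B}=\mathcal{A}\cap\mathcal{E}$. Put $\mathcal{I}=\left\{\begin{pmatrix}0&1\\1&\beta\end{pmatrix}\mid\beta\in K\right\}\subset\mathcal{A}\setminus\mathcal{B}$ and $\mathcal{J}=\{x'=x+y^2P(y),\ y'=y\mid 0\neq P\in K[y]\}\subset\mathcal{E}\setminus\mathcal{B}$. Every $g\in\mathcal{G}$ has a unique representation (its normal form) $g=b\circ a_m\circ e_m\circ\cdots\circ a_1\circ e_1$ with $m\ge1$, $b\in\mathcal{B}$, $a_i\in\mathcal{I}$, $e_i\in\mathcal{J}$, where $a_m$ and/or $e_1$ are allowed to be missing. The length of $g$ is the number of factors from $\mathcal{I}$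 and $\mathcal{J}$ in it. An element is cyclically reduced if its length is even and $>0$. A CR element is an element of $\mathcal{G}$ that is conjugate in $\mathcal{G}$ to a cyclically reduced element. For $g\in\mathcal{G}\setminus\mathcal{A}$ in normal form, the poly-degree is $\mathrm{pol\,deg}(g)=(\deg e_m,\ldots,\deg e_2,\deg e_1)$, where the last entry is dropped if $e_1$ is missing, and the degree of the map $x'=x+y^2P(y),\ y'=y$ is $2+\deg P$. *)

theory Defs
  imports Complex_Main "HOL-Algebra.Elementary_Groups" "HOL-Computational_Algebra.Polynomial"
begin

text \<open>
  \<open>K[x,y]\<close> is represented as \<open>K[y][x]\<close>: in \<^typ>\<open>'k poly poly\<close> the outer variable is \<open>x\<close> and the
  inner one is \<open>y\<close>. A polynomial map is the pair \<open>(P, Q)\<close> of its two components, so maps are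
  compared as formal polynomials, not as functions on \<open>K\<^sup>2\<close>.
\<close>

type_synonym 'k polymap = "'k poly poly \<times> 'k poly poly"

definition cst :: "'k::field \<Rightarrow> 'k poly poly"
  where "cst c = [:[:c:]:]"

definition X :: "'k::field poly poly"
  where "X = [:0, 1:]"

definition Y :: "'k::field poly poly"
  where "Y = [:[:0, 1:]:]"

text \<open>\<open>in_y P\<close> is the one-variable polynomial \<open>P\<close> read as \<open>P(y)\<close>.\<close>

definition in_y :: "'k::field poly \<Rightarrow> 'k poly poly"
  where "in_y P = [:P:]"

text \<open>\<open>subst2 P R S = P(R, S)\<close>\<close>

definition subst2 :: "'k::field poly poly \<Rightarrow> 'k poly poly \<Rightarrow> 'k poly poly \<Rightarrow> 'k poly poly"
  where "subst2 P R S = poly (map_poly (\<lambda>p. poly (map_poly cst p) S) P) R"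

definition pm_comp :: "'k::field polymap \<Rightarrow> 'k polymap \<Rightarrow> 'k polymap"
  where "pm_comp f g = (subst2 (fst f) (fst g) (snd g), subst2 (snd f) (fst g) (snd g))"

definition pm_id :: "'k::field polymap"
  where "pm_id = (X, Y)"

definition polymap_monoid :: "'k::field polymap monoid"
  where "polymap_monoid = \<lparr>carrier = UNIV, monoid.mult = pm_comp, one = pm_id\<rparr>"

definition GA2 :: "'k::field polymap monoid"
  where "GA2 = units_of polymap_monoid"

definition pm_eval :: "'k::field polymap \<Rightarrow> 'k \<times> 'k \<Rightarrow> 'k \<times> 'k"
  where "pm_eval f = (\<lambda>(u, v). (poly (poly (fst f) [:u:]) v, poly (poly (snd f) [:u:]) v))"

text \<open>The map \<open>x' = a x + b y + u, y' = c x + d y + v\<close>.\<close>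

definition affine_pm :: "'k::field \<Rightarrow> 'k \<Rightarrow> 'k \<Rightarrow> 'k \<Rightarrow> 'k \<Rightarrow> 'k \<Rightarrow> 'k polymap"
  where "affine_pm a b c d u v =
    (cst a * X + cst b * Y + cst u, cst c * X + cst d * Y + cst v)"

text \<open>The linear map with matrix rows \<open>(a, b)\<close> and \<open>(c, d)\<close>.\<close>

definition linear_pm :: "'k::field \<Rightarrow> 'k \<Rightarrow> 'k \<Rightarrow> 'k \<Rightarrow> 'k polymap"
  where "linear_pm a b c d = affine_pm a b c d 0 0"

definition elementary_pm :: "'k::field \<Rightarrow> 'k poly \<Rightarrow> 'k \<Rightarrow> 'k \<Rightarrow> 'k polymap"
  where "elementary_pm \<alpha> P \<beta> v = (cst \<alpha> * X + in_y P, cst \<beta> * Y + cst v)"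

definition affine_maps :: "'k::field polymap set"  (\<open>\<A>\<close>)
  where "\<A> = {affine_pm a b c d u v | a b c d u v. a * d - b * c \<noteq> 0}"

definition elementary_maps :: "'k::field polymap set"  (\<open>\<E>\<close>)
  where "\<E> = {elementary_pm \<alpha> P \<beta> v | \<alpha> P \<beta> v. \<alpha> * \<beta> \<noteq> 0}"

definition triangular_affine_maps :: "'k::field polymap set"  (\<open>\<B>\<close>)
  where "\<B> = \<A> \<inter> \<E>"

definition I_map :: "'k::field \<Rightarrow> 'k polymap"
  where "I_map \<beta> = linear_pm 0 1 1 \<beta>"

text \<open>The map \<open>x' = x + y\<^sup>2 P(y), y' = y\<close>.\<close>

definition J_map :: "'k::field poly \<Rightarrow> 'k polymap"
  where "J_map P = (X + Y ^ 2 * in_y P, Y)"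

definition I_maps :: "'k::field polymap set"  (\<open>\<I>\<close>)
  where "\<I> = range I_map"

definition J_maps :: "'k::field polymap set"  (\<open>\<J>\<close>)
  where "\<J> = {J_map P | P. P \<noteq> 0}"

definition J_degree :: "'k::field polymap \<Rightarrow> nat"
  where "J_degree e = 2 + degree (THE P. e = J_map P)"

definition word_map :: "'k::field polymap list \<Rightarrow> 'k polymap"
  where "word_map w = foldr pm_comp w pm_id"

text \<open>
  A normal form \<open>b \<circ> a\<^sub>m \<circ> e\<^sub>m \<circ> \<dots> \<circ> a\<^sub>1 \<circ> e\<^sub>1\<close>, in which \<open>a\<^sub>m\<close> and \<open>e\<^sub>1\<close> may be missing,
  is encoded as \<open>(b, w)\<close> where \<open>w\<close> lists, from left to right, the factors from \<open>\<I>\<close> and \<open>\<J>\<close>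
  that are present; these are exactly the words alternating between \<open>\<I>\<close> and \<open>\<J>\<close>. The empty
  word is \<open>m = 1\<close> with both \<open>a\<^sub>1\<close> and \<open>e\<^sub>1\<close> missing.
\<close>

definition is_normal_form :: "'k::field polymap \<Rightarrow> 'k polymap \<times> 'k polymap list \<Rightarrow> bool"
  where "is_normal_form g = (\<lambda>(b, w).
    b \<in> \<B> \<and> set w \<subseteq> \<I> \<union> \<J> \<and>
    successively (\<lambda>u v. (u \<in> \<I> \<and> v \<in> \<J>) \<or> (u \<in> \<J> \<and> v \<in> \<I>)) w \<and>
    g = pm_comp b (word_map w))"

text \<open>Normal forms of elements of \<^const>\<open>GA2\<close> exist and are unique (Jung, van der Kulk).\<close>

definition normal_form :: "'k::field polymap \<Rightarrow> 'k polymap \<times> 'k polymap list"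
  where "normal_form g = (THE nf. is_normal_form g nf)"

definition nf_length :: "'k::field polymap \<Rightarrow> nat"
  where "nf_length g = length (snd (normal_form g))"

definition poly_degree :: "'k::field polymap \<Rightarrow> nat list"
  where "poly_degree g = map J_degree (filter (\<lambda>u. u \<in> \<J>) (snd (normal_form g)))"

definition conjugate_in :: "('a, 'c) monoid_scheme \<Rightarrow> 'a \<Rightarrow> 'a \<Rightarrow> bool"
  where "conjugate_in G x y \<longleftrightarrow> x \<in> carrier G \<and> y \<in> carrier G \<and>
    (\<exists>g\<in>carrier G. y = g \<otimes>\<^bsub>G\<^esub> x \<otimes>\<^bsub>G\<^esub> inv\<^bsub>G\<^esub> g)"

definition cyclically_reduced :: "'k::field polymap \<Rightarrow> bool"
  where "cyclically_reduced g \<longleftrightarrow> g \<in> carrier GA2 \<and> even (nf_length g) \<and> nf_length g > 0"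

definition CR :: "'k::field polymap \<Rightarrow> bool"
  where "CR f \<longleftrightarrow> f \<in> carrier GA2 \<and> (\<exists>g. cyclically_reduced g \<and> conjugate_in GA2 f g)"

definition symmetry :: "'k::field polymap \<Rightarrow> 'k polymap \<Rightarrow> bool"
  where "symmetry f s \<longleftrightarrow> s \<in> carrier GA2 \<and> s \<otimes>\<^bsub>GA2\<^esub> f = f \<otimes>\<^bsub>GA2\<^esub> s"

definition involution :: "('a, 'c) monoid_scheme \<Rightarrow> 'a \<Rightarrow> bool"
  where "involution G s \<longleftrightarrow> s \<in> carrier G \<and> s \<otimes>\<^bsub>G\<^esub> s = \<one>\<^bsub>G\<^esub> \<and> s \<noteq> \<one>\<^bsub>G\<^esub>"

definition finite_order :: "('a, 'c) monoid_scheme \<Rightarrow> 'a \<Rightarrow> bool"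
  where "finite_order G s \<longleftrightarrow> s \<in> carrier G \<and> (\<exists>n::nat. n > 0 \<and> s [^]\<^bsub>G\<^esub> n = \<one>\<^bsub>G\<^esub>)"

definition odd_poly :: "'k::field poly \<Rightarrow> bool"
  where "odd_poly P \<longleftrightarrow> pcompose P [:0, -1:] = - P"

text \<open>
  \<open>b \<circ> a\<^sub>m \<circ> e\<^sub>m \<circ> \<dots> \<circ> a\<^sub>1 \<circ> e\<^sub>1\<close> with all \<open>a\<^sub>i\<close> and \<open>e\<^sub>i\<close> present, \<open>b\<close> linear and all \<open>P\<^sub>i\<close> odd.
\<close>

definition has_odd_normal_form :: "nat \<Rightarrow> 'k::field polymap \<Rightarrow> bool"
  where "has_odd_normal_form m f \<longleftrightarrow> m \<ge> 1 \<and>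
    (\<exists>\<alpha> \<beta> \<gamma> c P. \<alpha> * \<beta> \<noteq> 0 \<and>
      (\<forall>i\<in>{1..m}. P i \<noteq> 0 \<and> odd_poly (P i)) \<and>
      is_normal_form f
        (linear_pm \<alpha> \<gamma> 0 \<beta>,
         concat (map (\<lambda>i. [I_map (c i), J_map (P i)]) (rev [1..<Suc m]))))"

definition roots_of_unity :: "'k::field monoid"
  where "roots_of_unity = \<lparr>carrier = {z. \<exists>n::nat. n > 0 \<and> z ^ n = 1}, monoid.mult = (*), one = 1\<rparr>"

end

theory Submission
  imports Defs "HOL-Computational_Algebra.Polynomial_Factorial"
begin

text \<open>
  Over any field, the automorphism group is generated by affine and elementary maps. For a coordinate
  \<open>q\<close> and positive weights let \<open>\<Omega>\<close> be the weighted degree, and let \<open>\<pi>\<close> be a prime factor of the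
  leading form of \<open>q\<close>. For \<open>K[x,y] = K[p,q]\<close> consider
  \<open>\<lambda>(F) = \<Omega>(F) ord\<^sub>\<pi>(lead q) - ord\<^sub>\<pi>(lead F) \<Omega>(q)\<close>, which vanishes on \<open>K[q]\<close>. Expanding elements of
  \<open>K[q][p]\<close> in powers of an element of least \<open>p\<close>-degree with \<open>\<lambda> \<noteq> 0\<close> admits no cancellation of
  leading forms, so all values of \<open>\<lambda>\<close> have the same sign; hence the leading form of \<open>q\<close> is a power of
  \<open>\<pi>\<close>, and then \<open>\<pi>\<close> must be of the form \<open>x - c y\<^sup>k\<close> or \<open>y - c x\<^sup>k\<close>. A substitution lowers the
  bidegree of \<open>q\<close>.

  The total degree shows that no alternating product of affine and elementary maps is in the
  intersection, so the group is an amalgamated product. A finite order symmetry of a cyclically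
  reduced element \<open>f\<close> then lies in the amalgamated subgroup \<open>\<B>\<close>, and so do its conjugates by all
  right segments of the word of \<open>f\<close>. Conjugation by a letter from \<open>\<I>\<close> swaps the diagonal entries of
  an element of \<open>\<B>\<close>, while an involution with diagonal \<open>(-1, 1)\<close> does not survive a letter from \<open>\<J>\<close>;
  so an involution has diagonal \<open>(-1, -1)\<close> and is a point reflection. Moving its centre to the
  origin forces every letter to be odd.
\<close>

section \<open>Substitution and composition of polynomial maps\<close>

text \<open>A symmetry is an arbitrary automorphism, so nothing can be said about it until it is
  written as an alternating word; this is why tameness is proved in full. Test elements take their
  place. The variable y has positive \<lambda>, hence the weighted homogenisation of \<pi> cannot
  have negative \<lambda>, and this squeezes \<Omega>(q) to exactly the multiplicity of \<pi> times
  the weighted degree E of \<pi>. If E exceeded both weights, x and y would lie below a threshold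
  under which every leading form is, up to powers of \<pi>, a power of one single further form; a
  power of x would then agree up to a scalar with a power of y. So E is at most one of the weights,
  which forces \<pi> to be linear in the degree-zero coordinate once one weight is 1.\<close>

lemma cst_0 [simp]: "cst 0 = 0" and cst_1 [simp]: "cst 1 = 1"
  by (simp_all add: cst_def flip: one_pCons)

lemma cst_add: "cst (a + b) = cst a + cst b"
  and cst_mult: "cst (a * b) = cst a * cst b"
  and cst_minus: "cst (- a) = - cst a"
  by (simp_all add: cst_def)

lemma cst_eq_iff [simp]: "cst a = cst b \<longleftrightarrow> a = b"
  by (simp add: cst_def)

lemma cst_eq_0_iff [simp]: "cst a = 0 \<longleftrightarrow> a = 0"
  by (simp add: cst_def)

lemma map_poly_add_hom:
  assumes "f 0 = 0" "\<And>a b. f (a + b) = f a + f b"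
  shows "map_poly f (p + q) = map_poly f p + map_poly f q"
  by (rule poly_eqI) (simp add: coeff_map_poly assms)

lemma map_poly_mult_hom:
  fixes f :: "'a::comm_ring_1 \<Rightarrow> 'b::comm_ring_1"
  assumes "f 0 = 0" "\<And>a b. f (a + b) = f a + f b" "\<And>a b. f (a * b) = f a * f b"
  shows "map_poly f (p * q) = map_poly f p * map_poly f q"
proof (induction p)
  case 0
  then show ?case by simp
next
  case (pCons a p)
  have "map_poly f (smult a q) = smult (f a) (map_poly f q)"
    by (rule map_poly_smult) (simp_all add: assms)
  then show ?case
    using pCons by (simp add: map_poly_pCons assms(1) map_poly_add_hom[of f, OF assms(1,2)])
qed

text \<open>The inner half of \<open>subst2\<close>. With it \<open>subst2\<close> becomes a
  composite of two ring homomorphisms, one on coefficients and one evaluation.\<close>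

definition subst_y :: "'k::field poly poly \<Rightarrow> 'k poly \<Rightarrow> 'k poly poly"
  where "subst_y S p = poly (map_poly cst p) S"

lemma subst_y_simps [simp]:
  "subst_y S 0 = 0" "subst_y S 1 = 1" "subst_y S [:c:] = cst c"
  "subst_y S (p + q) = subst_y S p + subst_y S q"
  "subst_y S (p * q) = subst_y S p * subst_y S q"
  "subst_y S (pCons c p) = cst c + S * subst_y S p"
  by (simp_all add: subst_y_def map_poly_add_hom map_poly_mult_hom cst_add cst_mult map_poly_pCons)

lemma subst2_altdef: "subst2 P R S = poly (map_poly (subst_y S) P) R"
  unfolding subst2_def subst_y_def ..

lemma subst2_0 [simp]: "subst2 0 R S = 0"
  and subst2_1 [simp]: "subst2 1 R S = 1"
  and subst2_cst [simp]: "subst2 (cst c) R S = cst c"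
  and subst2_X [simp]: "subst2 X R S = R"
  and subst2_Y [simp]: "subst2 Y R S = S"
  and subst2_add [simp]: "subst2 (P + Q) R S = subst2 P R S + subst2 Q R S"
  and subst2_mult [simp]: "subst2 (P * Q) R S = subst2 P R S * subst2 Q R S"
  and subst2_pCons: "subst2 (pCons p P) R S = subst_y S p + R * subst2 P R S"
proof -
  show "subst2 X R S = R" "subst2 Y R S = S"
    by (simp_all add: subst2_altdef X_def Y_def map_poly_pCons)
  have "cst c = [:[:c:]:]" by (simp add: cst_def)
  then show "subst2 (cst c) R S = cst c"
    by (simp only: subst2_altdef) (simp add: map_poly_pCons)
qed (simp_all add: subst2_altdef map_poly_add_hom map_poly_mult_hom map_poly_pCons)

lemma subst2_minus [simp]: "subst2 (- P) R S = - subst2 P R S"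
  using subst2_add[of P "- P" R S] by (simp add: eq_neg_iff_add_eq_0 add.commute)

lemma subst2_power [simp]: "subst2 (P ^ n) R S = subst2 P R S ^ n"
  by (induction n) simp_all

lemma subst2_sum: "subst2 (sum f I) R S = (\<Sum>i\<in>I. subst2 (f i) R S)"
  by (induction I rule: infinite_finite_induct) simp_all

text \<open>K[x,y] is generated as a ring by the constants and the two variables, so identities
  between substitutions need to be checked only there.\<close>

lemma poly2_induct [case_names cst X Y add mult]:
  fixes P :: "'k::field poly poly"
  assumes "\<And>c. Pr (cst c)" "Pr X" "Pr Y"
    and add: "\<And>P Q. Pr P \<Longrightarrow> Pr Q \<Longrightarrow> Pr (P + Q)"
    and mult: "\<And>P Q. Pr P \<Longrightarrow> Pr Q \<Longrightarrow> Pr (P * Q)"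
  shows "Pr P"
proof (induction P)
  case 0
  then show ?case using assms(1)[of 0] by simp
next
  case (pCons p P)
  have const: "Pr [:p:]"
  proof (induction p)
    case 0
    then show ?case using assms(1)[of 0] by simp
  next
    case (pCons c p)
    have "[:pCons c p:] = cst c + Y * [:p:]" by (simp add: cst_def Y_def)
    with pCons.IH show ?case using assms by metis
  qed
  have "pCons p P = [:p:] + X * P" by (simp add: X_def)
  with const pCons.IH show ?case using assms by metis
qed

lemma subst2_assoc:
  "subst2 (subst2 P R S) U V = subst2 P (subst2 R U V) (subst2 S U V)"
  by (induction P rule: poly2_induct) simp_all

lemma subst2_id [simp]: "subst2 P X Y = P"
  by (induction P rule: poly2_induct) simp_all

section \<open>The monoid of polynomial maps and its group of units\<close>

lemma pm_comp_assoc: "pm_comp (pm_comp f g) h = pm_comp f (pm_comp g h)"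
  by (simp add: pm_comp_def subst2_assoc)

lemma pm_comp_id [simp]: "pm_comp f pm_id = f" "pm_comp pm_id f = f"
  by (simp_all add: pm_comp_def pm_id_def)

lemma polymap_monoid_simps [simp]:
  "carrier polymap_monoid = UNIV" "monoid.mult polymap_monoid = pm_comp" "one polymap_monoid = pm_id"
  by (simp_all add: polymap_monoid_def)

lemma monoid_polymap: "monoid polymap_monoid"
  by unfold_locales (simp_all add: pm_comp_assoc)

lemma group_GA2: "group GA2"
  unfolding GA2_def by (rule monoid.units_group[OF monoid_polymap])

lemma GA2_simps [simp]: "monoid.mult GA2 = pm_comp" "one GA2 = pm_id"
  by (simp_all add: GA2_def units_of_def)

lemma carrier_GA2: "carrier GA2 = {f. \<exists>g. pm_comp g f = pm_id \<and> pm_comp f g = pm_id}"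
  by (simp add: GA2_def units_of_def Units_def)

lemma GA2_I: "pm_comp f g = pm_id \<Longrightarrow> pm_comp g f = pm_id \<Longrightarrow> f \<in> carrier GA2"
  unfolding carrier_GA2 by blast

lemma inv_GA2_eq: "pm_comp f g = pm_id \<Longrightarrow> pm_comp g f = pm_id \<Longrightarrow> inv\<^bsub>GA2\<^esub> f = g"
  using group.inv_equality[OF group_GA2, of g f] GA2_I[of f g] GA2_I[of g f] by simp

lemma in_y_simps [simp]: "in_y 0 = 0" "in_y [:c:] = cst c" "in_y (p + q) = in_y p + in_y q"
  "in_y (p * q) = in_y p * in_y q" "in_y (- p) = - in_y p" "in_y (p - q) = in_y p - in_y q"
  "in_y 1 = 1"
  by (simp_all add: in_y_def cst_def one_pCons)

lemma in_y_eq_iff [simp]: "in_y p = in_y q \<longleftrightarrow> p = q"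
  by (simp add: in_y_def)

lemma in_y_power: "in_y (p ^ n) = in_y p ^ n"
  by (induction n) simp_all

lemma Y_in_y: "Y = in_y [:0, 1:]"
  by (simp add: Y_def in_y_def)

lemma subst2_in_y: "subst2 (in_y p) R S = subst_y S p"
  by (simp add: subst2_altdef in_y_def map_poly_pCons)

lemma subst_y_in_y [simp]: "subst_y (in_y r) p = in_y (pcompose p r)"
proof (induction p)
  case (pCons a p)
  then show ?case by (simp add: pcompose_pCons)
qed simp

lemma subst2_in_y_in_y [simp]: "subst2 (in_y p) R (in_y r) = in_y (pcompose p r)"
  by (simp add: subst2_in_y)

lemma linear_Y: "cst b * Y + cst v = in_y [:v, b:]"
  by (simp add: cst_def Y_def in_y_def)

lemma elementary_comp:
  "pm_comp (elementary_pm a P b v) (elementary_pm a' P' b' v') =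
    elementary_pm (a * a') (smult a P' + pcompose P [:v', b':]) (b * b') (b * v' + v)"
proof -
  have *: "in_y (smult a P') = cst a * in_y P'" by (simp add: in_y_def cst_def)
  have "pcompose [:v, b:] [:v', b':] = [:b * v' + v, b * b':]"
    by (simp add: pcompose_pCons algebra_simps)
  then show ?thesis
    unfolding pm_comp_def elementary_pm_def linear_Y
    by (simp only: fst_conv snd_conv subst2_add subst2_mult subst2_cst subst2_X subst2_in_y_in_y
      in_y_simps * cst_mult prod.inject) (simp add: algebra_simps)
qed

lemma elementary_id: "pm_id = elementary_pm 1 0 1 0"
  by (simp add: pm_id_def elementary_pm_def)

lemma affine_comp:
  "pm_comp (affine_pm a b c d u v) (affine_pm a' b' c' d' u' v') =
    affine_pm (a*a' + b*c') (a*b' + b*d') (c*a' + d*c') (c*b' + d*d') (a*u' + b*v' + u) (c*u' + d*v' + v)"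
  by (simp add: pm_comp_def affine_pm_def cst_mult cst_add algebra_simps)

lemma affine_id: "pm_id = affine_pm 1 0 0 1 0 0"
  by (simp add: pm_id_def affine_pm_def)

lemma affine_eq_iff:
  "affine_pm a b c d u v = affine_pm a' b' c' d' u' v' \<longleftrightarrow>
    a = a' \<and> b = b' \<and> c = c' \<and> d = d' \<and> u = u' \<and> v = v'"
  by (auto simp: affine_pm_def cst_def X_def Y_def)

lemma elementary_eq_iff:
  "elementary_pm a P b v = elementary_pm a' P' b' v' \<longleftrightarrow> a = a' \<and> P = P' \<and> b = b' \<and> v = v'"
  by (auto simp: elementary_pm_def cst_def X_def Y_def in_y_def)

section \<open>Multiplicity of a prime factor\<close>

text \<open>A divisor of least positive degree is irreducible, and over a field irreducible
  polynomials are prime.\<close>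

lemma prime_factor_exists:
  fixes f :: "'k::field poly"
  assumes "degree f > 0"
  obtains p where "prime_elem p" "p dvd f" "degree p > 0"
proof -
  from assms have "degree f > 0 \<and> f dvd f" by simp
  then obtain p where p: "degree p > 0 \<and> p dvd f" "\<And>q. degree q > 0 \<and> q dvd f \<Longrightarrow> degree p \<le> degree q"
    using arg_min_natI[of "\<lambda>p. degree p > 0 \<and> p dvd f" f degree]
      arg_min_nat_le[of "\<lambda>p. degree p > 0 \<and> p dvd f" _ degree] by metis
  have "irreducible p"
  proof (rule irreducibleI)
    show "p \<noteq> 0" using p(1) by auto
    show "\<not> is_unit p" using p(1) by (auto simp: is_unit_poly_iff)
    fix a b assume ab: "p = a * b"
    then have nz: "a \<noteq> 0" "b \<noteq> 0" using p(1) by auto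
    then have deg: "degree p = degree a + degree b" using ab by (simp add: degree_mult_eq)
    have "a dvd f" "b dvd f" using p(1) ab by (auto intro: dvd_trans)
    then have "degree a = 0 \<or> degree b = 0"
      using p(2)[of a] p(2)[of b] deg by force
    then show "is_unit a \<or> is_unit b"
      using nz by (auto elim!: degree_eq_zeroE simp: is_unit_const_poly_iff dvd_field_iff)
  qed
  then show thesis using that field_poly_irreducible_imp_prime p(1) by blast
qed

definition mult_at :: "'k::field poly \<Rightarrow> 'k poly \<Rightarrow> nat"
  where "mult_at p f = (GREATEST n. p ^ n dvd f)"

context
  fixes p :: "'k::field poly"
  assumes prime: "prime_elem p"
begin

lemma prime_degree_pos: "degree p > 0"
proof (rule ccontr)
  assume "\<not> degree p > 0"
  then obtain c where "p = [:c:]" by (auto elim: degree_eq_zeroE)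
  with prime show False
    by (auto simp: prime_elem_def is_unit_const_poly_iff dvd_field_iff)
qed

lemma mult_at_decomp:
  assumes "f \<noteq> 0"
  obtains g where "f = p ^ mult_at p f * g" "\<not> p dvd g"
proof -
  have bound: "n \<le> degree f" if "p ^ n dvd f" for n
  proof -
    have "degree (p ^ n) \<le> degree f" using that assms by (rule dvd_imp_degree_le)
    moreover have "degree (p ^ n) = n * degree p" using prime by (simp add: degree_power_eq)
    ultimately show ?thesis using prime_degree_pos
      by (metis Suc_leI le_trans mult.right_neutral mult_le_mono2 One_nat_def)
  qed
  have "p ^ mult_at p f dvd f"
    unfolding mult_at_def by (rule GreatestI_nat[of _ 0 "degree f"]) (use bound in auto)
  then obtain g where g: "f = p ^ mult_at p f * g" by (auto elim: dvdE)
  have "\<not> p dvd g"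
  proof
    assume "p dvd g"
    then have "p ^ Suc (mult_at p f) dvd f"
      by (metis g mult_dvd_mono dvd_refl power_Suc2)
    then have "Suc (mult_at p f) \<le> mult_at p f"
      unfolding mult_at_def by (rule Greatest_le_nat) (use bound in auto)
    then show False by simp
  qed
  with g that show thesis by blast
qed

lemma mult_at_eqI:
  assumes "f = p ^ n * g" "\<not> p dvd g"
  shows "mult_at p f = n"
proof -
  have "p \<noteq> 0" using prime by auto
  have "m \<le> n" if "p ^ m dvd f" for m
  proof (rule ccontr)
    assume "\<not> m \<le> n"
    then have "m = n + Suc (m - Suc n)" by simp
    then have "p ^ n * (p * p ^ (m - Suc n)) dvd p ^ n * g"
      using that assms(1) by (metis power_Suc power_add)
    then have "p * p ^ (m - Suc n) dvd g" using \<open>p \<noteq> 0\<close> by simp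
    then show False using assms(2) dvd_mult_left by blast
  qed
  then show ?thesis
    unfolding mult_at_def by (rule Greatest_equality[rotated]) (use assms in auto)
qed

lemma mult_at_mult:
  assumes "f \<noteq> 0" "g \<noteq> 0"
  shows "mult_at p (f * g) = mult_at p f + mult_at p g"
proof -
  obtain f' where f': "f = p ^ mult_at p f * f'" "\<not> p dvd f'" using assms mult_at_decomp by blast
  obtain g' where g': "g = p ^ mult_at p g * g'" "\<not> p dvd g'" using assms mult_at_decomp by blast
  show ?thesis
  proof (rule mult_at_eqI)
    show "f * g = p ^ (mult_at p f + mult_at p g) * (f' * g')"
    proof -
      have "p ^ m * f' * (p ^ n * g') = p ^ (m + n) * (f' * g')" for m n
        by (simp add: power_add mult_ac)
      then show ?thesis using f'(1) g'(1) by metis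
    qed
    show "\<not> p dvd f' * g'" using f'(2) g'(2) prime prime_elem_dvd_mult_iff by blast
  qed
qed

lemma mult_at_not_dvd: "\<not> p dvd f \<Longrightarrow> mult_at p f = 0"
  by (rule mult_at_eqI[of _ _ f]) simp_all

lemma mult_at_one [simp]: "mult_at p 1 = 0"
  using prime by (intro mult_at_not_dvd) (auto simp: prime_elem_def)

lemma mult_at_power: "f \<noteq> 0 \<Longrightarrow> mult_at p (f ^ n) = n * mult_at p f"
  by (induction n) (simp_all add: mult_at_mult)

lemma mult_at_self [simp]: "mult_at p p = 1"
  using prime by (intro mult_at_eqI[of _ _ 1]) (auto simp: prime_elem_def)

lemma mult_at_const [simp]: "c \<noteq> 0 \<Longrightarrow> mult_at p [:c:] = 0"
  using dvd_imp_degree_le[of p "[:c:]"] prime_degree_pos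
  by (intro mult_at_not_dvd) auto

lemma mult_at_pos: "f \<noteq> 0 \<Longrightarrow> p dvd f \<Longrightarrow> mult_at p f > 0"
  by (metis mult_at_decomp gr0I mult_1 power_0)

lemma mult_at_dvd: "f \<noteq> 0 \<Longrightarrow> p ^ mult_at p f dvd f"
  by (metis mult_at_decomp dvd_triv_left)

text \<open>The strict case of the ultrametric inequality: different multiplicities exclude
  cancellation.\<close>

lemma mult_at_add:
  assumes "f \<noteq> 0" "g \<noteq> 0" "mult_at p f < mult_at p g"
  shows "f + g \<noteq> 0" "mult_at p (f + g) = mult_at p f"
proof -
  obtain f' where f': "f = p ^ mult_at p f * f'" "\<not> p dvd f'" using assms mult_at_decomp by blast
  have "p ^ Suc (mult_at p f) dvd g"
    using mult_at_dvd[OF assms(2)] assms(3) by (meson Suc_leI dvd_trans le_imp_power_dvd)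
  then obtain g' where g': "g = p ^ mult_at p f * (p * g')"
    by (metis dvdE mult.assoc power_Suc2)
  have *: "f + g = p ^ mult_at p f * (f' + p * g')" "\<not> p dvd f' + p * g'"
    using f' g' by (auto simp: distrib_left dvd_add_left_iff)
  then show "mult_at p (f + g) = mult_at p f" by (intro mult_at_eqI)
  show "f + g \<noteq> 0" using * prime by auto
qed

end

section \<open>Degree and multiplicity of leading coefficients\<close>

lemma subst_y_eq_pcompose: "subst_y S p = pcompose (map_poly (\<lambda>c. [:c:]) p) S"
  by (simp add: subst_y_def pcompose_altdef map_poly_map_poly o_def cst_def[abs_def])

lemma
  assumes "p \<noteq> 0" "degree S > 0"
  shows degree_subst_y: "degree (subst_y S p) = degree p * degree S"
    and lead_coeff_subst_y: "lead_coeff (subst_y S p) = [:lead_coeff p:] * lead_coeff S ^ degree p"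
proof -
  have deg: "degree (map_poly (\<lambda>c. [:c:]) p) = degree p" by (rule degree_map_poly) simp
  then show "degree (subst_y S p) = degree p * degree S"
    by (simp add: subst_y_eq_pcompose degree_pcompose)
  show "lead_coeff (subst_y S p) = [:lead_coeff p:] * lead_coeff S ^ degree p"
    unfolding subst_y_eq_pcompose lead_coeff_comp[OF assms(2)] deg
    by (simp add: coeff_map_poly)
qed

lemma lead_coeff_add_eq:
  assumes "degree U = degree V" "lead_coeff U + lead_coeff V \<noteq> 0"
  shows "degree (U + V) = degree U" "lead_coeff (U + V) = lead_coeff U + lead_coeff V"
proof -
  show "degree (U + V) = degree U"
    by (rule antisym) (use assms in \<open>auto intro: degree_add_le le_degree\<close>)
  then show "lead_coeff (U + V) = lead_coeff U + lead_coeff V" using assms by simp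
qed

text \<open>The polynomials F live in abstract coordinates: the outer variable stands for P0 and the
  inner one for Q0. Thus \<open>degree F\<close> is the degree in P0, while \<open>om F\<close> is
  the degree of the value of F, whose leading coefficient plays the role of a leading form.\<close>

locale degree_valuation =
  fixes P0 Q0 :: "'k::field poly poly" and p :: "'k poly"
  assumes prime: "prime_elem p"
    and inj: "F \<noteq> 0 \<Longrightarrow> subst2 F P0 Q0 \<noteq> 0"
    and pos: "degree Q0 > 0"
begin

definition om :: "'k poly poly \<Rightarrow> nat" where "om F = degree (subst2 F P0 Q0)"
definition lc :: "'k poly poly \<Rightarrow> 'k poly" where "lc F = lead_coeff (subst2 F P0 Q0)"
definition mu :: "'k poly poly \<Rightarrow> nat" where "mu F = mult_at p (lc F)"
text \<open>The determinant of the vector (\<open>om F\<close>, \<open>mu F\<close>) against the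
  corresponding vector of Q0; it measures how far the two are from being proportional.\<close>

definition lam :: "'k poly poly \<Rightarrow> int" where
  "lam F = int (om F) * int (mult_at p (lead_coeff Q0)) - int (mu F) * int (degree Q0)"

lemma lc_nonzero: "F \<noteq> 0 \<Longrightarrow> lc F \<noteq> 0"
  using inj by (simp add: lc_def)

lemma om_mult: "F \<noteq> 0 \<Longrightarrow> G \<noteq> 0 \<Longrightarrow> om (F * G) = om F + om G"
  by (simp add: om_def inj degree_mult_eq)

lemma lc_mult: "lc (F * G) = lc F * lc G"
  by (simp add: lc_def lead_coeff_mult)

lemma mu_mult: "F \<noteq> 0 \<Longrightarrow> G \<noteq> 0 \<Longrightarrow> mu (F * G) = mu F + mu G"
  by (simp add: mu_def lc_mult lc_nonzero mult_at_mult[OF prime])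

lemma lam_mult: "F \<noteq> 0 \<Longrightarrow> G \<noteq> 0 \<Longrightarrow> lam (F * G) = lam F + lam G"
  by (simp add: lam_def om_mult mu_mult algebra_simps)

text \<open>The value of \<open>[:b:]\<close> is b(Q0): its degree and the multiplicity of its
  leading coefficient are those of Q0, both scaled by \<open>degree b\<close>.\<close>

lemma lam_const: assumes "b \<noteq> 0" shows "lam [:b:] = 0"
proof -
  have eq: "subst2 [:b:] P0 Q0 = subst_y Q0 b"
    by (metis in_y_def subst2_in_y)
  have "lead_coeff Q0 \<noteq> 0" using pos by auto
  then have "mu [:b:] = degree b * mult_at p (lead_coeff Q0)"
    unfolding mu_def lc_def eq lead_coeff_subst_y[OF assms pos]
    using assms by (simp add: mult_at_mult[OF prime] mult_at_power[OF prime] mult_at_const[OF prime]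
        del: mult_pCons_left)
  then show ?thesis
    using degree_subst_y[OF assms pos] by (simp add: lam_def om_def eq)
qed

lemma add_om_less:
  assumes "om G < om F"
  shows "om (F + G) = om F" "lc (F + G) = lc F"
proof -
  have "degree (subst2 F P0 Q0 + subst2 G P0 Q0) = degree (subst2 F P0 Q0)"
    using assms by (simp add: om_def degree_add_eq_left)
  moreover have "coeff (subst2 G P0 Q0) (degree (subst2 F P0 Q0)) = 0"
    using assms by (simp add: om_def coeff_eq_0)
  ultimately show "om (F + G) = om F" "lc (F + G) = lc F"
    by (simp_all add: om_def lc_def)
qed

lemma add_om_eq:
  assumes "om F = om G" "F \<noteq> 0" "G \<noteq> 0" "mu F < mu G"
  shows "om (F + G) = om F" "mu (F + G) = mu F"
proof -
  note add = mult_at_add[OF prime lc_nonzero[OF assms(2)] lc_nonzero[OF assms(3)] assms(4)[unfolded mu_def]]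
  have *: "degree (subst2 F P0 Q0) = degree (subst2 G P0 Q0)"
      "lead_coeff (subst2 F P0 Q0) + lead_coeff (subst2 G P0 Q0) \<noteq> 0"
    using assms(1) add(1) by (simp_all add: om_def lc_def)
  show "om (F + G) = om F" using lead_coeff_add_eq(1)[OF *] by (simp add: om_def)
  have "lc (F + G) = lc F + lc G"
    unfolding lc_def subst2_add by (rule lead_coeff_add_eq(2)[OF *])
  then show "mu (F + G) = mu F" using add(2) by (simp add: mu_def)
qed

text \<open>If \<open>lam\<close> differs, then so does \<open>om\<close>, or else \<open>mu\<close>
  at equal \<open>om\<close>. In both cases the leading terms cannot cancel, and one summand
  determines both numbers for the sum.\<close>

lemma lam_add:
  assumes "F \<noteq> 0" "G \<noteq> 0" "lam F \<noteq> lam G"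
  shows "lam (F + G) = lam F \<or> lam (F + G) = lam G"
proof -
  consider "om F < om G" | "om G < om F" | "om F = om G" "mu F < mu G" | "om F = om G" "mu G < mu F"
    using assms(3) by (force simp: lam_def)
  then show ?thesis
  proof cases
    case 1
    then show ?thesis using add_om_less[of F G] by (simp add: lam_def mu_def add.commute)
  next
    case 2
    then show ?thesis using add_om_less[of G F] by (simp add: lam_def mu_def)
  next
    case 3
    then show ?thesis using add_om_eq[of F G] assms by (simp add: lam_def)
  next
    case 4
    then show ?thesis using add_om_eq[of G F] assms by (simp add: lam_def add.commute)
  qed
qed

section \<open>Expansion along an element of least degree with nonzero \<open>lam\<close>\<close>

definition minimal :: "'k poly poly \<Rightarrow> bool" where
  "minimal \<phi> \<longleftrightarrow> \<phi> \<noteq> 0 \<and> lam \<phi> \<noteq> 0 \<and> (\<forall>R. R \<noteq> 0 \<and> degree R < degree \<phi> \<longrightarrow> lam R = 0)"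

lemma minimal_exists:
  assumes "F \<noteq> 0" "lam F \<noteq> 0"
  obtains \<phi> where "minimal \<phi>"
proof -
  let ?P = "\<lambda>F. F \<noteq> 0 \<and> lam F \<noteq> 0"
  have "minimal (arg_min degree ?P)"
    unfolding minimal_def
    using arg_min_natI[of ?P F degree] arg_min_nat_le[of ?P _ degree] assms
    by (metis (no_types, lifting) linorder_not_less)
  then show thesis by (rule that)
qed

lemma minimal_degree_pos: "minimal \<phi> \<Longrightarrow> degree \<phi> > 0"
  using lam_const by (auto simp: minimal_def elim!: degree_eq_zeroE intro: gr0I)

text \<open>The coefficients in K[y] do not form a field, so only pseudo-division is possible. The
  multiplier b is harmless because \<open>lam\<close> vanishes on it, and the remainder has
  \<open>lam\<close> zero by minimality.\<close>

lemma minimal_division: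
  assumes "minimal \<phi>" "F \<noteq> 0" "degree F \<ge> degree \<phi>"
  obtains b Q R where "b \<noteq> 0" "[:b:] * F = \<phi> * Q + R" "Q \<noteq> 0" "degree Q < degree F"
    "R \<noteq> 0 \<Longrightarrow> lam R = 0"
proof -
  have nz: "\<phi> \<noteq> 0" and deg: "degree \<phi> > 0" using assms(1) minimal_degree_pos by (auto simp: minimal_def)
  define R where "R = pseudo_mod F \<phi>"
  obtain b Q where b: "b \<noteq> 0" "smult b F = \<phi> * Q + R"
    using pseudo_mod(1)[OF nz] unfolding R_def by blast
  have R: "R = 0 \<or> degree R < degree \<phi>"
    using pseudo_mod(2)[OF nz] unfolding R_def .
  have degF: "degree (smult b F) = degree F" using b(1) by simp
  have "smult b F \<noteq> 0" using b(1) assms(2) by simp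
  then have Q: "Q \<noteq> 0" using R b(2) degF assms(3) by force
  then have degPQ: "degree (\<phi> * Q) = degree \<phi> + degree Q" using nz by (simp add: degree_mult_eq)
  then have "degree (\<phi> * Q + R) = degree \<phi> + degree Q"
    using R deg by (auto simp: degree_add_eq_left)
  then have "degree Q < degree F" using deg degF b(2) by simp
  then show thesis
    using that[OF b(1) _ Q] b(2) R assms(1) by (auto simp: minimal_def)
qed

text \<open>In the division step \<open>lam\<close> of \<phi> Q is a positive multiple of
  \<open>lam \<phi>\<close> and \<open>lam\<close> of the remainder is 0. These values differ, so
  the sum takes one of them.\<close>

theorem lam_multiple:
  assumes "minimal \<phi>" "F \<noteq> 0"
  shows "\<exists>i::nat. lam F = int i * lam \<phi>"
  using assms(2)
proof (induction "degree F" arbitrary: F rule: less_induct)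
  case less
  show ?case
  proof (cases "degree F < degree \<phi>")
    case True
    then have "lam F = int 0 * lam \<phi>" using assms(1) less.prems by (simp add: minimal_def)
    then show ?thesis by blast
  next
    case False
    then obtain b Q R where b: "b \<noteq> 0" "[:b:] * F = \<phi> * Q + R" "Q \<noteq> 0" "degree Q < degree F"
        "R \<noteq> 0 \<Longrightarrow> lam R = 0"
      using minimal_division[OF assms(1) less.prems] by (metis linorder_not_less)
    obtain i where i: "lam Q = int i * lam \<phi>" using less.hyps b(3,4) by blast
    have nz: "\<phi> \<noteq> 0" "lam \<phi> \<noteq> 0" using assms(1) by (auto simp: minimal_def)
    have "lam F = lam ([:b:] * F)"
      using lam_mult[of "[:b:]" F] lam_const[OF b(1)] b(1) less.prems by simp
    then have lamF: "lam F = lam (\<phi> * Q + R)" using b(2) by simp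
    have lamPQ: "lam (\<phi> * Q) = int (Suc i) * lam \<phi>"
      using lam_mult[OF nz(1) b(3)] i by (simp add: algebra_simps)
    show ?thesis
    proof (cases "R = 0")
      case True
      then show ?thesis using lamF lamPQ by (intro exI[of _ "Suc i"]) simp
    next
      case False
      have "lam (\<phi> * Q) \<noteq> lam R" using lamPQ b(5)[OF False] nz(2) by simp
      then have "lam F = lam (\<phi> * Q) \<or> lam F = 0"
        using lam_add[of "\<phi> * Q" R] False nz(1) b(3) b(5)[OF False] lamF by simp
      then show ?thesis using lamPQ by (metis mult_zero_left of_nat_0)
    qed
  qed
qed

corollary lam_nonneg:
  assumes "G \<noteq> 0" "lam G > 0" "F \<noteq> 0"
  shows "lam F \<ge> 0"
proof -
  obtain \<phi> where \<phi>: "minimal \<phi>" using minimal_exists[of G] assms by auto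
  obtain i where "lam G = int i * lam \<phi>" using lam_multiple[OF \<phi> assms(1)] by blast
  then have "lam \<phi> > 0" using assms(2) by (metis of_nat_0_le_iff mult_nonneg_nonpos not_le)
  then show ?thesis using lam_multiple[OF \<phi> assms(3)] by auto
qed

text \<open>
  If leading coefficients with \<open>lam = 0\<close> are scalar multiples of powers of a single polynomial
  \<open>pb\<close>, then below the threshold \<open>E\<close> every leading coefficient is a monomial in \<open>pb\<close> and the
  leading coefficient of \<open>\<phi>\<close>: two monomials of the same degree \<open>om\<close> differ in \<open>mu\<close>, and the one
  that survives cannot lie below the threshold.
\<close>

theorem lead_monomial:
  fixes pb :: "'k poly" and E :: nat
  assumes min: "minimal \<phi>" and E: "E > 0"
    and "mult_at p (lead_coeff Q0) > 0" "degree Q0 = mult_at p (lead_coeff Q0) * E"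
    and ge: "\<And>F. F \<noteq> 0 \<Longrightarrow> mu F * E \<le> om F"
    and zero: "\<And>F. F \<noteq> 0 \<Longrightarrow> om F = mu F * E \<Longrightarrow> \<exists>c. c \<noteq> 0 \<and> lc F = smult c (pb ^ mu F)"
    and pb: "pb \<noteq> 0"
    and F: "F \<noteq> 0" "om F < mu F * E + E"
  shows "\<exists>a b i c. c \<noteq> 0 \<and> lc F * pb ^ a = smult c (pb ^ b * lc \<phi> ^ i) \<and>
    om F - mu F * E = i * (om \<phi> - mu \<phi> * E)"
  using F
proof (induction "degree F" arbitrary: F rule: less_induct)
  case less
  define m where "m = mult_at p (lead_coeff Q0)"
  have deg: "int (degree Q0) = int m * int E"
    using assms(4) unfolding m_def by (metis of_nat_mult)
  \<comment> \<open>As Q0 has degree m E, \<open>lam\<close> is m times the excess of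
    \<open>om\<close> over \<open>mu\<close> times E. The excess is nonnegative by assumption, and
    it is additive on products.\<close>
  have lam_eq: "lam G = int m * (int (om G) - int (mu G * E))" for G
    unfolding lam_def m_def[symmetric] deg by (simp add: algebra_simps)
  have m_pos: "m > 0" using assms(3) by (simp add: m_def)
  have lam0: "om G = mu G * E" if "G \<noteq> 0" "lam G = 0" for G
    using that(2) m_pos by (simp add: lam_eq del: of_nat_mult)
  have nz: "\<phi> \<noteq> 0" "lam \<phi> \<noteq> 0" using min by (auto simp: minimal_def)
  have phi: "mu \<phi> * E < om \<phi>"
  proof -
    have "om \<phi> \<noteq> mu \<phi> * E" using nz(2) by (auto simp: lam_eq)
    then show ?thesis using ge[OF nz(1)] by simp
  qed
  have done0: ?case if om: "om F = mu F * E"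
  proof -
    obtain c where "c \<noteq> 0" "lc F = smult c (pb ^ mu F)" using zero[OF less.prems(1) om] by blast
    then have "c \<noteq> 0 \<and> lc F * pb ^ 0 = smult c (pb ^ mu F * lc \<phi> ^ 0) \<and>
      om F - mu F * E = 0 * (om \<phi> - mu \<phi> * E)" using om by simp
    then show ?thesis by blast
  qed
  show ?case
  proof (cases "degree F < degree \<phi>")
    case True
    then have "om F = mu F * E" using min less.prems(1) by (intro lam0) (auto simp: minimal_def)
    then show ?thesis by (rule done0)
  next
    case False
    then obtain b Q R where b: "b \<noteq> 0" "[:b:] * F = \<phi> * Q + R" "Q \<noteq> 0" "degree Q < degree F"
        "R \<noteq> 0 \<Longrightarrow> lam R = 0"
      using minimal_division[OF min less.prems(1)] by (metis linorder_not_less)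
    have bnz: "[:b:] \<noteq> 0" using b(1) by simp
    have om_b: "om [:b:] = mu [:b:] * E" using lam0[OF bnz lam_const[OF b(1)]] .
    obtain d where d: "d \<noteq> 0" "lc [:b:] = smult d (pb ^ mu [:b:])" using zero[OF bnz om_b] by blast
    define F' where "F' = [:b:] * F"
    have F': "om F' = om [:b:] + om F" "mu F' = mu [:b:] + mu F" "lc F' = lc [:b:] * lc F"
      unfolding F'_def by (rule om_mult[OF bnz less.prems(1)] mu_mult[OF bnz less.prems(1)] lc_mult)+
    have F'_nz: "F' \<noteq> 0" unfolding F'_def by (rule no_zero_divisors[OF bnz less.prems(1)])
    have F'_lt: "om F' < mu F' * E + E" using F' om_b less.prems(2) by (simp add: algebra_simps)
    have F'_eq: "F' = \<phi> * Q + R" unfolding F'_def b(2) ..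
    have PQ: "\<phi> * Q \<noteq> 0" using nz(1) b(3) by simp
    have omPQ: "om (\<phi> * Q) = om \<phi> + om Q" "mu (\<phi> * Q) = mu \<phi> + mu Q" "lc (\<phi> * Q) = lc \<phi> * lc Q"
      using om_mult mu_mult lc_mult nz(1) b(3) by simp_all
    have PQ_pos: "mu (\<phi> * Q) * E < om (\<phi> * Q)"
      using phi ge[OF b(3)] unfolding omPQ by (simp add: algebra_simps)
    consider "om F' = om (\<phi> * Q)" "lc F' = lc (\<phi> * Q)" | "om F' = mu F' * E" |
      "om F' = om (\<phi> * Q)" "mu F' = mu (\<phi> * Q)" "R \<noteq> 0" "om R = om (\<phi> * Q)" "om R = mu R * E"
    proof -
      show thesis
      proof (cases "R = 0")
        case True
        then show thesis using that(1) F'_eq by simp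
      next
        case False
        then have R: "om R = mu R * E" using b(5) lam0 by blast
        show thesis
        proof (cases "om R" "om (\<phi> * Q)" rule: linorder_cases)
          case less
          then show thesis using that(1) add_om_less[OF less] F'_eq by simp
        next
          case greater
          then have "om F' = om R" "lc F' = lc R"
            using add_om_less[OF greater] F'_eq by (simp_all add: add.commute)
          then show thesis using that(2) R by (simp add: mu_def)
        next
          case equal
          have "mu (\<phi> * Q) * E < mu R * E" using PQ_pos equal R by simp
          then have "mu (\<phi> * Q) < mu R" by simp
          from add_om_eq[OF equal[symmetric] PQ False this] that(3) False equal R F'_eq
          show thesis by simp
        qed
      qed
    qed
    then show ?thesis
    proof cases
      case 1
      then have mu: "mu F' = mu \<phi> + mu Q" using omPQ(2) by (simp add: mu_def)
      have "om Q < mu Q * E + E"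
        using F'_lt phi unfolding mu 1(1) omPQ(1) by (simp add: algebra_simps)
      then obtain a k i c where IH: "c \<noteq> 0" "lc Q * pb ^ a = smult c (pb ^ k * lc \<phi> ^ i)"
          "om Q - mu Q * E = i * (om \<phi> - mu \<phi> * E)"
        using less.hyps[OF b(4,3)] by blast
      \<comment> \<open>The pseudo-division multiplier contributes a power of \<open>pb\<close> on
        the side of F; this is why the claim allows the factor \<open>pb ^ a\<close> there.\<close>
      have "smult d (lc F * pb ^ (mu [:b:] + a)) = lc F' * pb ^ a"
        unfolding F'(3) d(2) by (simp add: power_add mult_ac)
      also have "\<dots> = lc \<phi> * (lc Q * pb ^ a)" using 1(2) omPQ(3) by (simp add: mult_ac)
      also have "\<dots> = smult c (pb ^ k * lc \<phi> ^ Suc i)" unfolding IH(2) by (simp add: mult_ac)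
      finally have "smult (inverse d) (smult d (lc F * pb ^ (mu [:b:] + a))) =
          smult (inverse d) (smult c (pb ^ k * lc \<phi> ^ Suc i))" by simp
      then have "lc F * pb ^ (mu [:b:] + a) = smult (inverse d * c) (pb ^ k * lc \<phi> ^ Suc i)"
        using d(1) by simp
      moreover have "om F - mu F * E = Suc i * (om \<phi> - mu \<phi> * E)"
      proof -
        have "om F - mu F * E = om F' - mu F' * E" using F' om_b by (simp add: algebra_simps)
        also have "\<dots> = (om \<phi> - mu \<phi> * E) + (om Q - mu Q * E)"
          unfolding 1(1) mu omPQ(1) using phi ge[OF b(3)] by (simp add: algebra_simps)
        finally show ?thesis using IH(3) by simp
      qed
      ultimately show ?thesis using d(1) IH(1)
        by (intro exI[of _ "mu [:b:] + a"] exI[of _ k] exI[of _ "Suc i"] exI[of _ "inverse d * c"]) simp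
    next
      case 2
      then have "om F = mu F * E" using F' om_b by (simp add: algebra_simps)
      then show ?thesis by (rule done0)
    next
      case 3
      \<comment> \<open>Here R ties with \<phi> Q in degree but has larger \<open>mu\<close>. Having
        excess zero, it pushes the common degree up to at least (\<open>mu F'\<close> + 1) E, beyond
        the threshold.\<close>
      have "mu (\<phi> * Q) * E < mu R * E" using PQ_pos 3(4,5) by simp
      then have "Suc (mu (\<phi> * Q)) \<le> mu R" by simp
      then have "Suc (mu (\<phi> * Q)) * E \<le> mu R * E" by (rule mult_le_mono1)
      then show ?thesis using F'_lt 3 by simp
    qed
  qed
qed

end

section \<open>Weighted leading forms of a coordinate\<close>

lemma mult_at_ge:
  fixes p :: "'k::field poly"
  assumes p: "prime_elem p" and "f \<noteq> 0" "p ^ n dvd f"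
  shows "n \<le> mult_at p f"
proof -
  obtain g where g: "f = p ^ n * g" using assms(3) by (elim dvdE)
  then have "g \<noteq> 0" "p \<noteq> 0" using assms by auto
  then show ?thesis
    unfolding g by (simp add: mult_at_mult[OF p] mult_at_power[OF p] mult_at_self[OF p])
qed

definition c2 :: "'k::field poly poly \<Rightarrow> nat \<Rightarrow> nat \<Rightarrow> 'k"
  where "c2 P i j = coeff (coeff P i) j"

lemma c2_simps [simp]: "c2 0 i j = 0" "c2 (P + Q) i j = c2 P i j + c2 Q i j"
  "c2 (monom (monom c j) i) i' j' = (if i = i' \<and> j = j' then c else 0)"
  by (simp_all add: c2_def)

lemma c2_nonzero: "P \<noteq> 0 \<Longrightarrow> \<exists>i j. c2 P i j \<noteq> 0"
  by (metis c2_def leading_coeff_0_iff)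

lemma X_power: "X ^ i = monom 1 i"
  by (simp add: X_def monom_altdef)

lemma Y_power: "Y ^ j = [:monom 1 j:]"
  unfolding Y_in_y in_y_power[symmetric] by (simp add: monom_altdef in_y_def)

lemma monom_eq: "monom (monom c j) i = cst c * Y ^ j * X ^ i"
  by (simp add: X_power Y_power cst_def smult_monom)

lemma poly2_add_induct [case_names monom add]:
  fixes P :: "'k::field poly poly"
  assumes m: "\<And>c i j. Pr (monom (monom c j) i)"
    and add: "\<And>P Q. Pr P \<Longrightarrow> Pr Q \<Longrightarrow> Pr (P + Q)"
  shows "Pr P"
proof -
  have zero: "Pr 0" using m[of 0 0 0] by simp
  have "Pr (sum f I)" if "\<And>k. Pr (f k)" for f :: "nat \<Rightarrow> _" and I
    by (induction I rule: infinite_finite_induct) (use that zero add in auto)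
  note sum = this
  have "monom g i = (\<Sum>j\<le>degree g. monom (monom (coeff g j) j) i)" for g :: "'k poly" and i
    by (metis monom_sum poly_as_sum_of_monoms)
  moreover have "Pr (\<Sum>j\<le>degree g. monom (monom (coeff g j) j) i)" for g i
    by (rule sum) (rule m)
  ultimately have *: "Pr (monom g i)" for g i by metis
  have "Pr (\<Sum>i\<le>degree P. monom (coeff P i) i)" by (rule sum) (rule *)
  then show ?thesis by (simp add: poly_as_sum_of_monoms)
qed

text \<open>
  The weights \<open>w1, w2\<close> of the variables are read off as the degree in \<open>X\<close> after the monomial
  substitution \<open>x \<mapsto> Y^\<alpha> X^w1, y \<mapsto> Y^\<beta> X^w2\<close>; the substitution is unimodular, so that \<open>Y\<close>
  becomes the degree-zero coordinate \<open>x^w2 / y^w1\<close>.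
\<close>

locale weights =
  fixes w1 w2 al be :: nat
  assumes wpos: "w1 > 0" "w2 > 0" and unimod: "al * w2 = Suc (be * w1)"
begin

definition Psi :: "'k::field poly poly \<Rightarrow> 'k poly poly"
  where "Psi P = subst2 P (Y ^ al * X ^ w1) (Y ^ be * X ^ w2)"

lemma Psi_simps [simp]: "Psi (P + Q) = Psi P + Psi Q" "Psi (P * Q) = Psi P * Psi Q"
  "Psi (cst c) = cst c" "Psi (P ^ n) = Psi P ^ n" "Psi X = Y ^ al * X ^ w1" "Psi Y = Y ^ be * X ^ w2"
  by (simp_all add: Psi_def)

lemma Psi_subst2: "Psi (subst2 F P Q) = subst2 F (Psi P) (Psi Q)"
  by (simp add: Psi_def subst2_assoc)

lemma Psi_monom:
  "Psi (monom (monom c j) i) = monom (monom c (al * i + be * j)) (w1 * i + w2 * j)"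
  by (simp add: monom_eq power_mult_distrib power_add mult_ac flip: power_mult)

lemma exponent: "w2 * (al * i + be * j) = i + be * (w1 * i + w2 * j)"
proof -
  have "w2 * (al * i + be * j) = (al * w2) * i + be * (w2 * j)" by (simp add: algebra_simps)
  then show ?thesis by (simp add: unimod algebra_simps)
qed

lemma exponent_inj:
  assumes "w1 * i + w2 * j = w1 * i' + w2 * j'" "al * i + be * j = al * i' + be * j'"
  shows "i = i' \<and> j = j'"
proof -
  have "i = i'" using exponent[of i j] exponent[of i' j'] assms by simp
  then show ?thesis using assms(1) wpos by simp
qed

lemma c2_Psi_aux:
  "(\<forall>i j. c2 (Psi P) (w1 * i + w2 * j) (al * i + be * j) = c2 P i j) \<and>
   (\<forall>d e. (\<nexists>i j. d = w1 * i + w2 * j \<and> e = al * i + be * j) \<longrightarrow> c2 (Psi P) d e = 0)"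
proof (induction P rule: poly2_add_induct)
  case (monom c i j)
  have inj: "(w1 * i + w2 * j = w1 * i' + w2 * j' \<and> al * i + be * j = al * i' + be * j') = (i = i' \<and> j = j')"
    for i' j' using exponent_inj[of i j i' j'] by blast
  show ?case
  proof (intro conjI allI impI)
    show "c2 (Psi (monom (monom c j) i)) (w1 * i' + w2 * j') (al * i' + be * j') =
        c2 (monom (monom c j) i) i' j'" for i' j'
      unfolding Psi_monom c2_simps inj ..
    show "c2 (Psi (monom (monom c j) i)) d e = 0"
      if "\<nexists>i j. d = w1 * i + w2 * j \<and> e = al * i + be * j" for d e
    proof -
      have "\<not> (w1 * i + w2 * j = d \<and> al * i + be * j = e)" using that by blast
      then show ?thesis unfolding Psi_monom c2_simps by (rule if_not_P)
    qed
  qed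
next
  case (add P Q)
  then show ?case by (metis (no_types, lifting) Psi_simps(1) c2_simps(2) add_0)
qed

lemma c2_Psi: "c2 (Psi P) (w1 * i + w2 * j) (al * i + be * j) = c2 P i j"
  using c2_Psi_aux by blast

lemma c2_Psi_nonzero:
  assumes "c2 (Psi P) d e \<noteq> 0"
  obtains i j where "d = w1 * i + w2 * j" "e = al * i + be * j" "c2 P i j \<noteq> 0"
  using c2_Psi_aux[of P] assms by metis

lemma Psi_eq_0_iff [simp]: "Psi P = 0 \<longleftrightarrow> P = 0"
proof
  assume "Psi P = 0"
  then have "c2 P i j = 0" for i j using c2_Psi[of P i j] by simp
  then show "P = 0" using c2_nonzero[of P] by auto
qed (simp add: Psi_def)

lemma degree_Psi_ge: "c2 P i j \<noteq> 0 \<Longrightarrow> w1 * i + w2 * j \<le> degree (Psi P)"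
  using c2_Psi[of P i j] by (intro le_degree) (auto simp: c2_def)

lemma lead_Psi_nonzero:
  assumes "coeff (lead_coeff (Psi P)) e \<noteq> 0"
  obtains i j where "w1 * i + w2 * j = degree (Psi P)" "e = al * i + be * j" "c2 P i j \<noteq> 0"
  using c2_Psi_nonzero[of P "degree (Psi P)" e] assms by (metis c2_def)

lemma degree_Psi_exists:
  assumes "P \<noteq> 0"
  obtains i j where "w1 * i + w2 * j = degree (Psi P)" "c2 P i j \<noteq> 0"
proof -
  have "lead_coeff (Psi P) \<noteq> 0" using assms by simp
  then obtain e where "coeff (lead_coeff (Psi P)) e \<noteq> 0" by (metis leading_coeff_0_iff)
  then show thesis using lead_Psi_nonzero that by metis
qed

text \<open>The leading form lives on the lattice points of w1 i + w2 j = D, and by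
  \<open>exponent\<close> raising the power of Y by 1 raises i by w2. A factor p^\<mu> with p prime
  to Y therefore makes the support at least \<mu> w2 deg p long in the direction of i, whereas w1 i
  is at most D. In case of equality the whole segment is used up: the smallest i is 0 and the
  remaining cofactor is constant.\<close>

lemma range_bound:
  fixes p :: "'k::field poly"
  assumes p: "prime_elem p" "\<not> p dvd [:0, 1:]" and P: "P \<noteq> 0" and dvd: "p ^ \<mu> dvd lead_coeff (Psi P)"
  shows "\<mu> * (w1 * w2 * degree p) \<le> degree (Psi P)"
    and "degree (Psi P) \<le> \<mu> * (w1 * w2 * degree p) \<Longrightarrow>
      \<exists>c. c \<noteq> 0 \<and> lead_coeff (Psi P) = smult c ((monom 1 (be * w1 * degree p) * p) ^ \<mu>)"
proof -
  let ?L = "lead_coeff (Psi P)" and ?D = "degree (Psi P)"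
  have L: "?L \<noteq> 0" using P by simp
  define l where "l = (LEAST e. coeff ?L e \<noteq> 0)"
  have "coeff ?L (degree ?L) \<noteq> 0" using L by simp
  then have cl: "coeff ?L l \<noteq> 0" unfolding l_def by (rule LeastI)
  have "monom 1 l dvd ?L"
    unfolding monom_1_dvd_iff' using not_less_Least[of _ "\<lambda>e. coeff ?L e \<noteq> 0"] l_def by blast
  then obtain G where G: "?L = monom 1 l * G" by (elim dvdE)
  have G0: "G \<noteq> 0" using L G by auto
  have "mult_at p (monom 1 l) = 0"
  proof -
    have "monom (1::'k) l = [:0, 1:] ^ l" by (simp add: monom_altdef)
    then show ?thesis using p(2) by (simp add: mult_at_power[OF p(1)] mult_at_not_dvd[OF p(1)])
  qed
  moreover have "\<mu> \<le> mult_at p ?L" using mult_at_ge[OF p(1) L dvd] .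
  moreover have "monom (1::'k) l \<noteq> 0" by simp
  ultimately have "\<mu> \<le> mult_at p G" using mult_at_mult[OF p(1) _ G0, of "monom 1 l"] G by simp
  then have "p ^ \<mu> dvd G" using mult_at_dvd[OF p(1) G0] le_imp_power_dvd dvd_trans by blast
  then obtain H where H: "G = p ^ \<mu> * H" by (elim dvdE)
  have nz: "p \<noteq> 0" "H \<noteq> 0" using p(1) G0 H by auto
  have degL: "degree ?L = l + \<mu> * degree p + degree H"
    unfolding G H using nz by (simp add: degree_mult_eq degree_monom_eq degree_power_eq)
  obtain i0 j0 where 0: "w1 * i0 + w2 * j0 = ?D" "l = al * i0 + be * j0"
    using lead_Psi_nonzero[OF cl] by metis
  obtain i1 j1 where 1: "w1 * i1 + w2 * j1 = ?D" "degree ?L = al * i1 + be * j1"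
    using lead_Psi_nonzero[of P "degree ?L"] L by (metis leading_coeff_0_iff)
  have e0: "w2 * l = i0 + be * ?D" using exponent[of i0 j0] 0 by simp
  have e1: "w2 * degree ?L = i1 + be * ?D" using exponent[of i1 j1] 1 by simp
  have "i1 = i0 + w2 * (\<mu> * degree p + degree H)"
    using e0 e1 degL by (simp add: algebra_simps)
  then have "w1 * i1 = w1 * i0 + \<mu> * (w1 * w2 * degree p) + w1 * w2 * degree H"
    by (simp add: algebra_simps)
  then have le: "w1 * i0 + \<mu> * (w1 * w2 * degree p) + w1 * w2 * degree H \<le> ?D"
    using 1(1) by linarith
  then show "\<mu> * (w1 * w2 * degree p) \<le> ?D" by linarith
  assume le2: "?D \<le> \<mu> * (w1 * w2 * degree p)"
  have "w1 * i0 = 0" "w1 * w2 * degree H = 0" "?D = \<mu> * (w1 * w2 * degree p)"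
    using le le2 by linarith+
  then have i0: "i0 = 0" "degree H = 0" "?D = \<mu> * (w1 * w2 * degree p)" using wpos by auto
  obtain c where c: "H = [:c:]" "c \<noteq> 0" using i0(2) nz(2) by (auto elim: degree_eq_zeroE)
  have "w2 * l = w2 * (be * w1 * degree p * \<mu>)" using e0 i0 by (simp add: algebra_simps)
  then have "l = be * w1 * degree p * \<mu>" using wpos by simp
  then have "?L = smult c ((monom 1 (be * w1 * degree p) * p) ^ \<mu>)"
    unfolding G H c(1) by (simp add: power_mult_distrib monom_power mult_ac)
  then show "\<exists>c. c \<noteq> 0 \<and> ?L = smult c ((monom 1 (be * w1 * degree p) * p) ^ \<mu>)"
    using c(2) by blast
qed

end

section \<open>Components of automorphisms and their leading forms\<close>

lemma GA2_inverse:
  assumes "(P, Q) \<in> carrier GA2"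
  obtains P' Q' where "(P', Q') \<in> carrier GA2"
    "subst2 P' P Q = X" "subst2 Q' P Q = Y" "subst2 P P' Q' = X" "subst2 Q P' Q' = Y"
proof -
  obtain g where g: "pm_comp g (P, Q) = pm_id" "pm_comp (P, Q) g = pm_id"
    using assms unfolding carrier_GA2 by blast
  show thesis
    by (rule that[of "fst g" "snd g"])
      (use g GA2_I[OF g] in \<open>simp_all add: pm_comp_def pm_id_def\<close>)
qed

lemma GA2_subst2_surj:
  assumes "(P, Q) \<in> carrier GA2"
  obtains F where "subst2 F P Q = R"
  using GA2_inverse[OF assms] subst2_assoc[of R _ _ P Q] by (metis subst2_id)

lemma GA2_subst2_inj:
  assumes "(P, Q) \<in> carrier GA2" "subst2 F P Q = 0"
  shows "F = 0"
proof -
  obtain P' Q' where "subst2 P P' Q' = X" "subst2 Q P' Q' = Y" using GA2_inverse[OF assms(1)] by metis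
  then have "F = subst2 (subst2 F P Q) P' Q'" by (simp add: subst2_assoc)
  then show ?thesis by (simp add: assms(2))
qed

lemma (in weights) degree_valuation:
  assumes "(P, Q) \<in> carrier GA2" "prime_elem p" "degree (Psi Q) > 0"
  shows "degree_valuation (Psi P) (Psi Q) p"
proof
  show "subst2 F (Psi P) (Psi Q) \<noteq> 0" if "F \<noteq> 0" for F
    using GA2_subst2_inj[OF assms(1), of F] that by (auto simp flip: Psi_subst2)
qed (use assms in auto)

lemma lead_in_y_X: "g \<noteq> 0 \<Longrightarrow> degree (in_y g * X ^ n) = n" "lead_coeff (in_y g * X ^ n) = g"
  by (simp_all add: in_y_def X_power smult_monom degree_monom_eq)
     (cases "g = 0"; simp add: degree_monom_eq)

lemma (in degree_valuation) om_lc_eq: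
  assumes "subst2 F P0 Q0 = in_y g * X ^ n" "g \<noteq> 0"
  shows "om F = n" "lc F = g"
  using lead_in_y_X(1)[OF assms(2), of n] lead_in_y_X(2)[of g n] by (simp_all add: om_def lc_def assms(1))

text \<open>Such a Q would have the leading form c x^a y^b for the weights (1, 1). Measuring
  multiplicity at the factor x, the elements x and y would get \<open>lam\<close> equal to -b and a,
  of opposite signs.\<close>

lemma no_corner:
  assumes GA: "(P, Q) \<in> carrier GA2"
    and corner: "c2 Q a b \<noteq> 0" "\<And>i j. c2 Q i j \<noteq> 0 \<Longrightarrow> i \<le> a \<and> j \<le> b"
    and "a > 0" "b > 0"
  shows False
proof -
  interpret weights 1 1 1 0 by unfold_locales auto
  let ?t = "[:0, 1:] :: 'a poly"
  have t: "prime_elem ?t" by (rule prime_elem_linear_field_poly) simp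
  have Q: "Q \<noteq> 0" using corner(1) by auto
  have deg: "degree (Psi Q) = a + b"
  proof (rule antisym)
    obtain i j where "1 * i + 1 * j = degree (Psi Q)" "c2 Q i j \<noteq> 0"
      using degree_Psi_exists[OF Q] by metis
    then show "degree (Psi Q) \<le> a + b" using corner(2)[of i j] by simp
    show "a + b \<le> degree (Psi Q)" using degree_Psi_ge[OF corner(1)] by simp
  qed
  have "coeff (lead_coeff (Psi Q)) e = 0" if "e \<noteq> a" for e
  proof (rule ccontr)
    assume "coeff (lead_coeff (Psi Q)) e \<noteq> 0"
    from lead_Psi_nonzero[OF this] obtain i j
      where "i + j = a + b" "e = i" "c2 Q i j \<noteq> 0" by (metis deg mult_1 mult_0 add_0_right)
    then show False using corner(2)[of i j] that by simp
  qed
  moreover have "coeff (lead_coeff (Psi Q)) a = c2 Q a b"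
    using c2_Psi[of Q a b] deg by (simp add: c2_def)
  ultimately have "lead_coeff (Psi Q) = smult (c2 Q a b) (?t ^ a)"
    by (intro poly_eqI) (auto simp: monom_altdef[symmetric] smult_monom)
  also have "\<dots> = [:c2 Q a b:] * ?t ^ a" by simp
  finally have mult: "mult_at ?t (lead_coeff (Psi Q)) = a"
    using corner(1) by (simp add: mult_at_mult[OF t] mult_at_power[OF t] mult_at_self[OF t] mult_at_const[OF t]
        del: mult_pCons_left)
  interpret degree_valuation "Psi P" "Psi Q" ?t
    by (rule degree_valuation[OF GA t]) (use deg assms in simp)
  obtain F where F: "subst2 F P Q = X" using GA2_subst2_surj[OF GA] .
  obtain G where G: "subst2 G P Q = Y" using GA2_subst2_surj[OF GA] .
  have XY: "(X :: 'a poly poly) \<noteq> 0" "(Y :: 'a poly poly) \<noteq> 0" by (simp_all add: X_def Y_def)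
  have nz: "F \<noteq> 0" "G \<noteq> 0" using F G XY by auto
  have "subst2 F (Psi P) (Psi Q) = in_y ?t * X ^ 1"
    unfolding Psi_subst2[symmetric] F Psi_simps Y_in_y[symmetric] by simp
  from om_lc_eq[OF this] have "om F = 1" "lc F = ?t" by simp_all
  then have "lam F = int a - int (a + b)"
    unfolding lam_def mu_def deg mult[unfolded deg] by (simp add: mult_at_self[OF t])
  moreover have "subst2 G (Psi P) (Psi Q) = in_y 1 * X ^ 1"
    unfolding Psi_subst2[symmetric] G Psi_simps by simp
  from om_lc_eq[OF this] have "om G = 1" "lc G = 1" by simp_all
  then have "lam G = int a"
    unfolding lam_def mu_def deg mult[unfolded deg] by (simp add: mult_at_one[OF t])
  ultimately show False using lam_nonneg[OF nz(2) _ nz(1)] assms(4,5) by simp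
qed

text \<open>H is the weighted homogenisation of p(x^w2 / y^w1), cleared of denominators by y^(w1 deg
  p). It serves as a test element whose leading coefficient is p up to a power of Y.\<close>

lemma (in weights) Psi_homogenise:
  fixes p :: "'k::field poly"
  shows "\<exists>H. Psi H = in_y (monom 1 (be * w1 * degree p) * p) * X ^ (w1 * w2 * degree p)"
proof -
  define N where "N = be * w1 * degree p"
  define E where "E = w1 * w2 * degree p"
  have summand: "Psi (monom (monom c (w1 * (degree p - l))) (w2 * l)) = monom (monom c (N + l)) E"
    if l: "l \<in> {..degree p}" for c :: 'k and l
  proof -
    obtain r where r: "degree p = l + r" using l le_Suc_ex by auto
    have "al * (w2 * l) = Suc (be * w1) * l" using unimod by (metis mult.assoc)
    then have "al * (w2 * l) + be * (w1 * r) = N + l"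
      by (simp add: N_def r algebra_simps)
    moreover have "w1 * (w2 * l) + w2 * (w1 * r) = E" by (simp add: E_def r algebra_simps)
    ultimately show ?thesis by (simp add: Psi_monom r)
  qed
  have Psi_sum: "Psi (sum f I) = (\<Sum>l\<in>I. Psi (f l))" for f :: "nat \<Rightarrow> 'k poly poly" and I
    by (simp add: Psi_def subst2_sum)
  have "Psi (\<Sum>l\<le>degree p. monom (monom (coeff p l) (w1 * (degree p - l))) (w2 * l)) =
      (\<Sum>l\<le>degree p. monom (monom (coeff p l) (N + l)) E)"
    unfolding Psi_sum by (rule sum.cong[OF refl]) (rule summand)
  also have "\<dots> = monom (\<Sum>l\<le>degree p. monom 1 N * monom (coeff p l) l) E"
    by (simp add: monom_sum mult_monom)
  also have "(\<Sum>l\<le>degree p. monom 1 N * monom (coeff p l) l) = monom 1 N * p"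
    by (metis poly_as_sum_of_monoms sum_distrib_left)
  also have "monom (monom 1 N * p) E = in_y (monom 1 N * p) * X ^ E"
    by (simp add: in_y_def X_power smult_monom)
  finally show ?thesis unfolding N_def E_def by blast
qed

text \<open>Since y has positive \<open>lam\<close>, the homogenisation of p has nonnegative
  \<open>lam\<close>, which bounds the degree of Q above by m E; \<open>range_bound\<close> gives
  the opposite bound, and its equality case gives the shape of the leading form. For the last claim
  suppose that both weights are below E. Then \<open>lead_monomial\<close> applies to x and y, and
  expresses both leading coefficients through \<open>pb\<close> and a common h, with exponents i and
  i' of h proportional to w1 and w2. Eliminating h yields al w2 = be w1, against
  unimodularity.\<close>

theorem (in weights) coordinate_leading_form:
  fixes Q :: "'k::field poly poly" and p :: "'k poly"
  assumes GA: "(P, Q) \<in> carrier GA2" and Q: "Q \<noteq> 0"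
    and p: "prime_elem p" "\<not> p dvd [:0, 1:]" and dvd: "p dvd lead_coeff (Psi Q)"
  defines "E \<equiv> w1 * w2 * degree p" and "m \<equiv> mult_at p (lead_coeff (Psi Q))"
  shows "m > 0" "degree (Psi Q) = m * E"
    and "\<exists>c. c \<noteq> 0 \<and> lead_coeff (Psi Q) = smult c ((monom 1 (be * w1 * degree p) * p) ^ m)"
    and "E \<le> w1 \<or> E \<le> w2"
proof -
  define pb where "pb = monom 1 (be * w1 * degree p) * p"
  have p0: "p \<noteq> 0" "degree p > 0" using p(1) prime_degree_pos[OF p(1)] by auto
  have pb0: "pb \<noteq> 0" using p0 by (simp add: pb_def)
  have E: "E > 0" using p0 wpos by (simp add: E_def)
  have t: "mult_at p (monom 1 n) = 0" for n
  proof -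
    have "monom (1::'k) n = [:0, 1:] ^ n" by (simp add: monom_altdef)
    then show ?thesis using p(2) by (simp add: mult_at_power[OF p(1)] mult_at_not_dvd[OF p(1)])
  qed
  have mpb: "mult_at p pb = 1"
    unfolding pb_def using p0 by (simp add: mult_at_mult[OF p(1)] t mult_at_self[OF p(1)])
  have L: "lead_coeff (Psi Q) \<noteq> 0" using Q by simp
  show m: "m > 0" unfolding m_def by (rule mult_at_pos[OF p(1) L dvd])
  have low: "m * E \<le> degree (Psi Q)"
    using range_bound(1)[OF p Q mult_at_dvd[OF p(1) L]] by (simp add: m_def E_def)
  then have degQ: "degree (Psi Q) > 0" using m E by (metis gr0I le_zero_eq nat_0_less_mult_iff not_less_zero)
  interpret degree_valuation "Psi P" "Psi Q" p
    by (rule degree_valuation[OF GA p(1) degQ])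
  have eval: "F \<noteq> 0 \<and> om F = n \<and> lc F = g"
    if "subst2 F P Q = R" "Psi R = in_y g * X ^ n" "g \<noteq> 0" for F R g n
  proof -
    have "subst2 F (Psi P) (Psi Q) = in_y g * X ^ n" using that(1,2) by (simp add: Psi_subst2[symmetric])
    moreover from this have "F \<noteq> 0"
      using that(3) lead_in_y_X(2)[of g n] by (metis leading_coeff_0_iff subst2_0)
    ultimately show ?thesis using om_lc_eq that(3) by blast
  qed
  have YX: "Y ^ a * X ^ b = in_y (monom 1 a) * X ^ b" for a b
    by (simp add: Y_power in_y_def)
  obtain G where "subst2 G P Q = Y" using GA2_subst2_surj[OF GA] .
  from eval[OF this] have G: "G \<noteq> 0" "om G = w2" "lc G = monom 1 be" by (simp_all add: YX)
  have "lam G = int (w2 * m)" unfolding lam_def mu_def m_def[symmetric] G(2,3) by (simp add: t)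
  then have lamG: "lam G > 0" using wpos m by simp
  obtain H :: "'k poly poly" where H: "Psi H = in_y pb * X ^ E"
    using Psi_homogenise unfolding pb_def E_def by blast
  obtain F where "subst2 F P Q = H" using GA2_subst2_surj[OF GA] .
  from eval[OF this H pb0] have F: "F \<noteq> 0" "om F = E" "lc F = pb" by simp_all
  have "lam F = int (E * m) - int (degree (Psi Q))"
    unfolding lam_def mu_def m_def[symmetric] F(2,3) mpb by simp
  then have "int (degree (Psi Q)) \<le> int (E * m)" using lam_nonneg[OF G(1) lamG F(1)] by linarith
  then have "degree (Psi Q) \<le> m * E" by (simp only: of_nat_le_iff mult.commute)
  then show D: "degree (Psi Q) = m * E" using low by (rule antisym)
  show "\<exists>c. c \<noteq> 0 \<and> lead_coeff (Psi Q) = smult c ((monom 1 (be * w1 * degree p) * p) ^ m)"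
    using range_bound(2)[OF p Q mult_at_dvd[OF p(1) L], folded m_def E_def] D by simp
  show "E \<le> w1 \<or> E \<le> w2"
  proof (rule ccontr)
    assume "\<not> (E \<le> w1 \<or> E \<le> w2)"
    then have less: "w1 < E" "w2 < E" by auto
    obtain \<phi> where \<phi>: "minimal \<phi>" using minimal_exists[OF G(1)] lamG by auto
    have bound: "mu F * E \<le> om F \<and> (om F = mu F * E \<longrightarrow> (\<exists>c. c \<noteq> 0 \<and> lc F = smult c (pb ^ mu F)))"
      if "F \<noteq> 0" for F
    proof -
      have nz: "subst2 F P Q \<noteq> 0" using GA2_subst2_inj[OF GA] that by blast
      have eq: "om F = degree (Psi (subst2 F P Q))" "lc F = lead_coeff (Psi (subst2 F P Q))"
        by (simp_all add: om_def lc_def Psi_subst2)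
      have "p ^ mu F dvd lead_coeff (Psi (subst2 F P Q))"
        using mult_at_dvd[OF p(1) lc_nonzero[OF that]] by (simp add: mu_def eq(2))
      from range_bound[OF p nz this] show ?thesis unfolding eq E_def pb_def by simp
    qed
    have mono: "\<exists>a b i c. c \<noteq> 0 \<and> lc F * pb ^ a = smult c (pb ^ b * lc \<phi> ^ i) \<and>
        om F - mu F * E = i * (om \<phi> - mu \<phi> * E)" if "F \<noteq> 0" "om F < mu F * E + E" for F
    proof (rule lead_monomial[OF \<phi> E m[unfolded m_def] D[unfolded m_def] _ _ pb0 that])
      show "mu F * E \<le> om F" if "F \<noteq> 0" for F using bound[OF that] by blast
      show "\<exists>c. c \<noteq> 0 \<and> lc F = smult c (pb ^ mu F)" if "F \<noteq> 0" "om F = mu F * E" for F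
        using bound[OF that(1)] that(2) by blast
    qed
    obtain F where "subst2 F P Q = X" using GA2_subst2_surj[OF GA] .
    from eval[OF this] have F: "F \<noteq> 0" "om F = w1" "lc F = monom 1 al" by (simp_all add: YX)
    have mu: "mu F = 0" "mu G = 0" by (simp_all add: mu_def F G t)
    define k where "k = om \<phi> - mu \<phi> * E"
    define h where "h = lc \<phi>"
    obtain a b i c where 1: "c \<noteq> 0" "monom 1 al * pb ^ a = smult c (pb ^ b * h ^ i)" "w1 = i * k"
      using mono[OF F(1)] less(1) unfolding F(2,3) mu k_def h_def by auto
    obtain a' b' i' c' where 2: "c' \<noteq> 0" "monom 1 be * pb ^ a' = smult c' (pb ^ b' * h ^ i')" "w2 = i' * k"
      using mono[OF G(1)] less(2) unfolding G(2,3) mu k_def h_def by auto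
    \<comment> \<open>The relations for x and y are raised to the powers i' and i, so that both
      contain h to the power i i'.\<close>
    have "(monom 1 al * pb ^ a) ^ i' * pb ^ (b' * i) * [:c' ^ i:] =
        [:c ^ i' * c' ^ i:] * pb ^ (b * i' + b' * i) * h ^ (i * i')"
      unfolding 1(2) by (simp add: power_mult_distrib smult_power power_add mult_ac flip: power_mult)
    moreover have "(monom 1 be * pb ^ a') ^ i * pb ^ (b * i') * [:c ^ i':] =
        [:c ^ i' * c' ^ i:] * pb ^ (b * i' + b' * i) * h ^ (i * i')"
      unfolding 2(2) by (simp add: power_mult_distrib smult_power power_add mult_ac flip: power_mult)
    ultimately have "(monom 1 al * pb ^ a) ^ i' * pb ^ (b' * i) * [:c' ^ i:] =
        (monom 1 be * pb ^ a') ^ i * pb ^ (b * i') * [:c ^ i':]" by simp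
    then have eq: "monom 1 (al * i') * pb ^ (a * i' + b' * i) * [:c' ^ i:] =
        monom 1 (be * i) * pb ^ (a' * i + b * i') * [:c ^ i':]"
      by (simp add: power_mult_distrib power_add monom_power mult_ac flip: power_mult)
    have multn: "mult_at p (monom 1 n * pb ^ r * [:d:]) = r" if "d \<noteq> 0" for n r d
      using that pb0 by (simp add: mult_at_mult[OF p(1)] mult_at_power[OF p(1)] mpb t mult_at_const[OF p(1)]
          del: mult_pCons_right)
    have degn: "degree (monom 1 n * pb ^ r * [:d:]) = n + r * degree pb" if "d \<noteq> 0" for n r d
      using that pb0 by (simp add: degree_mult_eq degree_monom_eq degree_power_eq)
    have nz: "c' ^ i \<noteq> 0" "c ^ i' \<noteq> 0" using 1(1) 2(1) by simp_all
    \<comment> \<open>Multiplicity at p compares the powers of \<open>pb\<close>; once these agree,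
      the degree compares the remaining powers of Y.\<close>
    have "a * i' + b' * i = a' * i + b * i'"
      using arg_cong[OF eq, of "mult_at p"] unfolding multn[OF nz(1)] multn[OF nz(2)] .
    then have "al * i' = be * i"
      using arg_cong[OF eq, of degree] unfolding degn[OF nz(1)] degn[OF nz(2)] by simp
    then have "al * w2 = be * w1" unfolding 1(3) 2(3) by (metis mult.assoc)
    then show False using unimod by simp
  qed
qed

section \<open>Tameness: the Jung--van der Kulk theorem\<close>

lemma subst2_X_in_y: "subst2 R X (in_y r) = map_poly (\<lambda>c. pcompose c r) R"
proof (induction R)
  case (pCons c R)
  then show ?case
    by (simp add: subst2_pCons map_poly_pCons X_def) (simp add: in_y_def)
qed simp

lemma subst2_in_y_right: "subst2 F P (in_y r) = pcompose (map_poly (\<lambda>c. pcompose c r) F) P"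
proof (induction F)
  case (pCons c F)
  then show ?case
    by (simp add: subst2_pCons map_poly_pCons pcompose_pCons) (simp add: in_y_def)
qed simp

section \<open>Bidegree and edges of the Newton polygon\<close>

lemma c2_swap: "c2 (subst2 Q Y X) i j = c2 Q j i"
proof (induction Q arbitrary: i j rule: poly2_add_induct)
  case (monom c i' j')
  have "subst2 (monom (monom c j') i') Y X = monom (monom c i') j'"
    by (simp add: monom_eq mult_ac)
  then show ?case by auto
qed simp

definition bidegree_le :: "'k::field poly poly \<Rightarrow> nat \<Rightarrow> nat \<Rightarrow> bool"
  where "bidegree_le Q a b \<longleftrightarrow> (\<forall>i j. c2 Q i j \<noteq> 0 \<longrightarrow> i \<le> a \<and> j \<le> b)"

lemma bidegree_exists: "\<exists>a b. bidegree_le Q a b"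
proof (induction Q rule: poly2_add_induct)
  case (monom c i j)
  show ?case by (rule exI[of _ i], rule exI[of _ j]) (auto simp: bidegree_le_def)
next
  case (add P Q)
  then obtain a b a' b' where ab: "bidegree_le P a b" "bidegree_le Q a' b'" by blast
  have "bidegree_le (P + Q) (max a a') (max b b')"
    unfolding bidegree_le_def
  proof (intro allI impI)
    fix i j assume "c2 (P + Q) i j \<noteq> 0"
    then have "c2 P i j \<noteq> 0 \<or> c2 Q i j \<noteq> 0" by auto
    then show "i \<le> max a a' \<and> j \<le> max b b'" using ab unfolding bidegree_le_def by fastforce
  qed
  then show ?case by blast
qed

lemma bidegree_swap: "bidegree_le Q a b \<Longrightarrow> bidegree_le (subst2 Q Y X) b a"
  by (auto simp: bidegree_le_def c2_swap)

text \<open>After division by the highest power of the variable, two terms still survive, so the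
  quotient has positive degree and nonzero constant term. None of its prime factors can divide the
  variable.\<close>

lemma prime_factor_not_X:
  fixes f :: "'k::field poly"
  assumes "coeff f e \<noteq> 0" "coeff f e' \<noteq> 0" "e < e'"
  obtains p where "prime_elem p" "p dvd f" "\<not> p dvd [:0, 1:]"
proof -
  define l where "l = (LEAST e. coeff f e \<noteq> 0)"
  have cl: "coeff f l \<noteq> 0" unfolding l_def using assms(1) by (rule LeastI)
  have "l \<le> e" unfolding l_def using assms(1) by (rule Least_le)
  have "monom 1 l dvd f"
    unfolding monom_1_dvd_iff' using not_less_Least[of _ "\<lambda>e. coeff f e \<noteq> 0"] l_def by blast
  then obtain G where G: "f = monom 1 l * G" by (elim dvdE)
  have c: "coeff f (l + k) = coeff G k" for k by (simp add: G coeff_monom_mult)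
  have "coeff G (e' - l) \<noteq> 0" using c[of "e' - l"] assms(2,3) \<open>l \<le> e\<close> by simp
  then have "degree G \<ge> e' - l" by (rule le_degree)
  then have "degree G > 0" using assms(3) \<open>l \<le> e\<close> by simp
  then obtain p where p: "prime_elem p" "p dvd G" "degree p > 0" using prime_factor_exists by blast
  have "\<not> p dvd [:0, 1:]"
  proof
    assume "p dvd [:0, 1:]"
    then obtain q where q: "[:0, 1:] = p * q" by (elim dvdE)
    then have nz: "p \<noteq> 0" "q \<noteq> 0" by auto
    then have "degree p + degree q = 1" using q degree_mult_eq[of p q] by (metis degree_pCons_eq_if degree_0 One_nat_def one_neq_zero pCons_eq_0_iff)
    then have "degree q = 0" using p(3) by simp
    then obtain d where "q = [:d:]" by (auto elim: degree_eq_zeroE)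
    then have "poly p 0 = 0" using q nz by (metis mult_eq_0_iff pCons_eq_0_iff poly_0_coeff_0 coeff_pCons_0 poly_mult poly_pCons mult_zero_left add_0_right)
    then have "poly G 0 = 0" using p(2) by (auto elim!: dvdE)
    then have "coeff f l = 0" using c[of 0] by (simp add: poly_0_coeff_0)
    then show False using cl by contradiction
  qed
  then show thesis using that p G by (metis dvd_mult)
qed

text \<open>The line w1 i + w2 j = d supports the Newton polygon of Q and contains at least two
  points of the support of Q, hence an edge.\<close>

definition on_edge :: "'k::field poly poly \<Rightarrow> nat \<Rightarrow> nat \<Rightarrow> nat \<Rightarrow> bool"
  where "on_edge Q w1 w2 d \<longleftrightarrow> (\<forall>i j. c2 Q i j \<noteq> 0 \<longrightarrow> w1 * i + w2 * j \<le> d) \<and>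
    (\<exists>i j i' j'. c2 Q i j \<noteq> 0 \<and> c2 Q i' j' \<noteq> 0 \<and> (i, j) \<noteq> (i', j') \<and>
      w1 * i + w2 * j = d \<and> w1 * i' + w2 * j' = d)"

lemma on_edge_swap: "on_edge Q w1 w2 d \<Longrightarrow> on_edge (subst2 Q Y X) w2 w1 d"
  unfolding on_edge_def c2_swap by (metis add.commute prod.inject)

lemma (in weights) edge_prime:
  fixes Q :: "'k::field poly poly"
  assumes "on_edge Q w1 w2 d"
  obtains p where "prime_elem p" "p dvd lead_coeff (Psi Q)" "\<not> p dvd [:0, 1:]"
    "degree (Psi Q) = d" "Q \<noteq> 0"
proof -
  obtain i j i' j' where ij: "c2 Q i j \<noteq> 0" "c2 Q i' j' \<noteq> 0" "(i, j) \<noteq> (i', j')"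
      "w1 * i + w2 * j = d" "w1 * i' + w2 * j' = d"
    using assms unfolding on_edge_def by blast
  have Q: "Q \<noteq> 0" using ij(1) by auto
  have deg: "degree (Psi Q) = d"
  proof (rule antisym)
    show "degree (Psi Q) \<le> d"
      using degree_Psi_exists[OF Q] assms unfolding on_edge_def by metis
    show "d \<le> degree (Psi Q)" using degree_Psi_ge[OF ij(1)] ij(4) by simp
  qed
  have c: "coeff (lead_coeff (Psi Q)) (al * i + be * j) \<noteq> 0"
      "coeff (lead_coeff (Psi Q)) (al * i' + be * j') \<noteq> 0"
    using ij(1,2) c2_Psi[of Q i j] c2_Psi[of Q i' j'] unfolding ij(4,5) by (simp_all add: c2_def deg)
  have "al * i + be * j \<noteq> al * i' + be * j'" using exponent_inj[of i j i' j'] ij by auto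
  then obtain e e' where "coeff (lead_coeff (Psi Q)) e \<noteq> 0" "coeff (lead_coeff (Psi Q)) e' \<noteq> 0" "e < e'"
    using c by (metis nat_neq_iff)
  from prime_factor_not_X[OF this] that deg Q show thesis by metis
qed

text \<open>For the weights (w, 1) the bound on E makes p linear, so the leading form is c (p1 x +
  p0 y^w)^m with both coefficients nonzero. The shear with c0 = - p0 / p1 turns it into a multiple
  of x^m. This removes y^(m w) and leaves only y-exponents below m w, while the x-exponents stay at
  most m.\<close>

lemma edge_reduction:
  fixes Q :: "'k::field poly poly"
  assumes GA: "(P, Q) \<in> carrier GA2" and w: "w > 0" and edge: "on_edge Q w 1 d"
    and bd: "bidegree_le Q a b"
  obtains c0 where "bidegree_le (subst2 Q (X + cst c0 * Y ^ w) Y) a (b - 1)" "b > 0"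
proof -
  interpret weights w 1 1 0 using w by unfold_locales auto
  obtain p where p: "prime_elem p" "p dvd lead_coeff (Psi Q)" "\<not> p dvd [:0, 1:]"
      and d: "degree (Psi Q) = d" and Q: "Q \<noteq> 0" using edge_prime[OF edge] .
  define m where "m = mult_at p (lead_coeff (Psi Q))"
  note form = coordinate_leading_form[OF GA Q p(1,3,2), folded m_def]
  have "1 \<le> w" using w by simp
  then have "w * degree p \<le> w * 1" using form(4) by (metis le_trans mult.right_neutral)
  then have "degree p \<le> 1" using w by (simp only: nat_mult_le_cancel1)
  then have "degree p = 1" using prime_degree_pos[OF p(1)] by simp
  then obtain p0 p1 where pp: "p = [:p0, p1:]" "p1 \<noteq> 0"
    by (metis degree_pCons_eq_if One_nat_def degree_0 degree_eq_zeroE nat.inject nat.distinct(1) pCons_cases pCons_0_0 pCons_eq_0_iff)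
  have p0: "p0 \<noteq> 0"
  proof
    assume "p0 = 0"
    then have "[:0, 1:] = p * [:inverse p1:]" using pp by simp
    then show False using p(3) by (metis dvd_triv_left)
  qed
  have m: "m > 0" "d = m * w" using form(1,2) d \<open>degree p = 1\<close> by simp_all
  obtain c where c: "c \<noteq> 0" "lead_coeff (Psi Q) = smult c (p ^ m)" using form(3) by auto
  define c0 where "c0 = - p0 / p1"
  define Q' where "Q' = subst2 Q (X + cst c0 * Y ^ w) Y"
  \<comment> \<open>Under \<open>Psi\<close> the polynomial x + c0 y^w becomes (Y + c0) X^w. The
    shear thus acts on the coefficients as the shift of Y by c0, and the weighted degree is
    unchanged.\<close>
  have "Psi Q' = subst2 (Psi Q) X (in_y [:c0, 1:])"
    unfolding Q'_def Psi_subst2 unfolding Psi_def subst2_assoc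
    by (simp add: linear_Y[symmetric] algebra_simps)
  then have Psi: "Psi Q' = map_poly (\<lambda>c. pcompose c [:c0, 1:]) (Psi Q)"
    by (simp add: subst2_X_in_y)
  have inj: "pcompose f [:c0, 1:] = 0 \<longleftrightarrow> f = 0" for f
    by (rule pcompose_eq_0_iff) simp
  have deg: "degree (Psi Q') = d"
    unfolding Psi d[symmetric] by (rule degree_map_poly) (simp add: inj)
  have "lead_coeff (Psi Q') = pcompose (lead_coeff (Psi Q)) [:c0, 1:]"
    unfolding deg d unfolding Psi by (simp add: coeff_map_poly)
  also have "\<dots> = smult c ([:0, p1:] ^ m)"
  proof -
    have "pcompose (p ^ n) r = pcompose p r ^ n" for n and r :: "'k poly"
      by (induction n) (simp_all add: pcompose_mult pcompose_1)
    moreover have "pcompose p [:c0, 1:] = [:0, p1:]"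
      using pp by (simp add: pcompose_pCons c0_def)
    ultimately show ?thesis unfolding c(2) by (simp add: pcompose_smult)
  qed
  also have "[:0, p1:] = monom p1 1" by (simp add: monom_altdef)
  finally have lead: "lead_coeff (Psi Q') = monom (c * p1 ^ m) m" by (simp add: monom_power smult_monom)
  \<comment> \<open>Of the old edge only the point (m, 0) is left.\<close>
  have supp: "w * i + j \<le> m * w \<and> (w * i + j = m * w \<longrightarrow> i = m)" if "c2 Q' i j \<noteq> 0" for i j
  proof -
    have "w * i + 1 * j \<le> m * w" using degree_Psi_ge[OF that] unfolding deg m(2) .
    moreover have "i = m" if *: "w * i + 1 * j = m * w"
    proof -
      have "c2 (Psi Q') (degree (Psi Q')) (1 * i + 0 * j) \<noteq> 0"
        using c2_Psi[of Q' i j] \<open>c2 Q' i j \<noteq> 0\<close> unfolding deg m(2) * by simp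
      then show ?thesis unfolding c2_def lead by (simp split: if_splits)
    qed
    ultimately show ?thesis by simp
  qed
  \<comment> \<open>The top and bottom coefficients of p^m show that x^m and y^(m w) both occur in
    Q. Hence m is at most a and m w is at most b.\<close>
  have "coeff (lead_coeff (Psi Q)) m \<noteq> 0"
  proof -
    have "degree (p ^ m) = m" using pp \<open>degree p = 1\<close> by (simp add: degree_power_eq)
    then show ?thesis unfolding c(2) using c(1) pp
      by (metis coeff_smult leading_coeff_0_iff mult_eq_0_iff pCons_eq_0_iff power_not_zero)
  qed
  from lead_Psi_nonzero[OF this] obtain i j where "w * i + 1 * j = d" "m = 1 * i + 0 * j" "c2 Q i j \<noteq> 0"
    unfolding d by metis
  then have ma: "m \<le> a" using bd by (auto simp: bidegree_le_def)
  have "coeff (lead_coeff (Psi Q)) 0 \<noteq> 0"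
    unfolding c(2) using c(1) p0 pp by (simp add: coeff_0_power)
  from lead_Psi_nonzero[OF this] obtain i j where "w * i + 1 * j = d" "0 = 1 * i + 0 * j" "c2 Q i j \<noteq> 0"
    unfolding d by metis
  then have mb: "m * w \<le> b" using bd m(2) by (auto simp: bidegree_le_def)
  have "b > 0" using mb m(1) w by (metis gr0I le_zero_eq nat_0_less_mult_iff not_less_zero)
  moreover have "bidegree_le Q' a (b - 1)"
    unfolding bidegree_le_def
  proof (intro allI impI)
    fix i j assume "c2 Q' i j \<noteq> 0"
    note s = supp[OF this]
    have "w * i \<le> m * w" using s by linarith
    then have "i \<le> m" using w by (simp add: mult.commute)
    moreover have "j < m * w"
    proof (rule ccontr)
      assume "\<not> j < m * w"
      then have "w * i = 0" "j = m * w" using s by linarith+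
      then show False using s m(1) w by auto
    qed
    ultimately show "i \<le> a \<and> j \<le> b - 1" using ma mb by simp
  qed
  ultimately show thesis using that unfolding Q'_def by blast
qed

lemma elementary_I: "\<alpha> * \<beta> \<noteq> 0 \<Longrightarrow> elementary_pm \<alpha> P \<beta> v \<in> \<E>"
  by (auto simp: elementary_maps_def)

text \<open>Here Q = r(y), and substitution of the map into its inverse is composition in x over
  K[y]. Degrees in x multiply, so P has degree 1 in x, and the degree in y of the second identity
  makes r linear. The leading coefficient of P is a unit of K[y], hence a constant.\<close>

lemma elementary_of_bidegree_0:
  assumes GA: "(P, Q) \<in> carrier GA2" and "bidegree_le Q 0 b"
  shows "(P, Q) \<in> \<E>"
proof -
  have "degree Q = 0"
  proof (rule ccontr)
    assume "degree Q \<noteq> 0"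
    then have "lead_coeff Q \<noteq> 0" by auto
    then obtain j where "c2 Q (degree Q) j \<noteq> 0" by (metis c2_def leading_coeff_0_iff)
    then show False using assms(2) \<open>degree Q \<noteq> 0\<close> by (auto simp: bidegree_le_def)
  qed
  then obtain r where Q: "Q = in_y r" by (auto simp: in_y_def elim: degree_eq_zeroE)
  obtain P' Q' where inv: "subst2 P' P Q = X" "subst2 Q' P Q = Y" using GA2_inverse[OF GA] by metis
  let ?m = "map_poly (\<lambda>c. pcompose c r)"
  have X: "pcompose (?m P') P = X" and Y: "pcompose (?m Q') P = Y"
    using inv by (simp_all add: Q subst2_in_y_right)
  have "degree (?m P') * degree P = 1" using degree_pcompose[of "?m P'" P] X by (simp add: X_def)
  then have deg: "degree (?m P') = 1" "degree P = 1" by auto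
  have "degree (?m Q') = 0" using degree_pcompose[of "?m Q'" P] Y deg by (simp add: Y_def)
  then obtain g where g: "?m Q' = [:g:]" by (auto elim: degree_eq_zeroE)
  then have "g = [:0, 1:]" using Y by (simp add: Y_def)
  then have "coeff (?m Q') 0 = [:0, 1:]" using g by simp
  then have "pcompose (coeff Q' 0) r = [:0, 1:]" by (simp add: coeff_map_poly)
  then have "degree (coeff Q' 0) * degree r = 1" by (metis degree_pcompose degree_pCons_eq_if degree_0 One_nat_def one_neq_zero pCons_eq_0_iff)
  then have "degree r = 1" by auto
  then obtain v \<beta> where r: "r = [:v, \<beta>:]" "\<beta> \<noteq> 0"
    by (metis degree_pCons_eq_if One_nat_def degree_0 degree_eq_zeroE nat.inject nat.distinct(1) pCons_cases pCons_0_0 pCons_eq_0_iff)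
  obtain f0 f1 where P: "P = [:f0, f1:]" "f1 \<noteq> 0"
    using deg(2) by (metis degree_pCons_eq_if One_nat_def degree_0 degree_eq_zeroE nat.inject nat.distinct(1) pCons_cases pCons_0_0 pCons_eq_0_iff)
  obtain g0 g1 where P': "?m P' = [:g0, g1:]"
    using deg(1) by (metis degree_pCons_eq_if One_nat_def degree_0 degree_eq_zeroE nat.inject nat.distinct(1) pCons_cases pCons_0_0 pCons_eq_0_iff)
  have "pcompose (?m P') P = [:g0 + g1 * f0, g1 * f1:]"
    unfolding P P' by (simp add: pcompose_pCons mult.commute)
  then have "g1 * f1 = 1" unfolding X X_def by simp
  then have "is_unit f1" by (metis dvd_triv_right)
  then obtain \<alpha> where f1: "f1 = [:\<alpha>:]" "\<alpha> \<noteq> 0" using P(2) by (auto simp: is_unit_poly_iff)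
  have "(P, Q) = elementary_pm \<alpha> f0 \<beta> v"
    unfolding elementary_pm_def linear_Y Q r(1) P(1) f1(1) by (simp add: cst_def X_def in_y_def)
  then show ?thesis using r(2) f1(2) by (simp add: elementary_I)
qed

section \<open>Reduction to affine and elementary maps\<close>

inductive_set tame :: "'k::field polymap set" where
  affine: "f \<in> \<A> \<Longrightarrow> f \<in> tame"
| elementary: "f \<in> \<E> \<Longrightarrow> f \<in> tame"
| comp: "f \<in> tame \<Longrightarrow> g \<in> tame \<Longrightarrow> pm_comp f g \<in> tame"

definition swap :: "'k::field polymap" where "swap = (Y, X)"

lemma swap_affine: "swap = affine_pm 0 1 1 0 0 0"
  by (simp add: swap_def affine_pm_def)

lemma swap_tame: "swap \<in> tame"
  by (rule tame.affine) (unfold swap_affine affine_maps_def, force)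

lemma swap_swap [simp]: "pm_comp swap swap = pm_id"
  by (simp add: swap_def pm_comp_def pm_id_def)

lemma swap_GA2: "swap \<in> carrier GA2"
  using GA2_I[OF swap_swap swap_swap] .

lemma shear_inverse:
  "pm_comp (elementary_pm 1 P 1 0) (elementary_pm 1 (- P) 1 0) = pm_id"
  "pm_comp (elementary_pm 1 (- P) 1 0) (elementary_pm 1 P 1 0) = pm_id"
  by (simp_all add: elementary_comp elementary_id)

lemma shear_GA2: "elementary_pm 1 P 1 0 \<in> carrier GA2"
  using GA2_I[OF shear_inverse] .

lemma GA2_comp: "f \<in> carrier GA2 \<Longrightarrow> g \<in> carrier GA2 \<Longrightarrow> pm_comp f g \<in> carrier GA2"
  using monoid.m_closed[OF group.is_monoid[OF group_GA2], of f g] by simp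

lemma tame_cancel:
  assumes "pm_comp f g \<in> tame" "h \<in> tame" "pm_comp g h = pm_id"
  shows "f \<in> tame"
  using tame.comp[OF assms(1,2)] by (simp add: pm_comp_assoc assms(3))

lemma tame_of_swap: "pm_comp f swap \<in> tame \<Longrightarrow> f \<in> tame"
  by (rule tame_cancel[OF _ swap_tame swap_swap])

lemma tame_of_shear: "pm_comp f (elementary_pm 1 P 1 0) \<in> tame \<Longrightarrow> f \<in> tame"
  by (rule tame_cancel[OF _ tame.elementary[OF elementary_I] shear_inverse(1)]) simp_all

text \<open>The edge starts at (k, b), the right end of the top side of the support. As the corner
  (a, b) is missing, k < a and there are points further right; the one with the largest ratio (i -
  k) / (b - j) spans a supporting line with (k, b).\<close>

lemma Newton_edge:
  assumes bd: "bidegree_le Q a b" and "a > 0" "b > 0" "c2 Q a b = 0"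
    and tight: "c2 Q i0 b \<noteq> 0" "c2 Q a j0 \<noteq> 0"
  obtains w1 w2 d where "w1 > 0" "w2 > 0" "coprime w1 w2" "on_edge Q w1 w2 d"
proof -
  define T where "T = {i. c2 Q i b \<noteq> 0}"
  have T: "finite T" "T \<noteq> {}"
    using bd tight finite_subset[of T "{..a}"] by (auto simp: T_def bidegree_le_def)
  define k where "k = Max T"
  have k: "c2 Q k b \<noteq> 0" using Max_in[OF T] by (simp add: T_def k_def)
  have k_max: "i \<le> k" if "c2 Q i b \<noteq> 0" for i using that T by (simp add: T_def k_def)
  have "k < a" using k bd assms(4) by (metis bidegree_le_def le_neq_implies_less)
  define S where "S = {(i, j). c2 Q i j \<noteq> 0 \<and> i > k}"
  have "finite S" by (rule finite_subset[of _ "{..a} \<times> {..b}"]) (use bd in \<open>auto simp: S_def bidegree_le_def\<close>)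
  moreover have "(a, j0) \<in> S" using tight \<open>k < a\<close> by (simp add: S_def)
  ultimately have S: "finite S" "S \<noteq> {}" by auto
  define r where "r = (\<lambda>y. real (fst y - k) / real (b - snd y))"
  have "Max (r ` S) \<in> r ` S" using S by (intro Max_in) auto
  then obtain z where z: "z \<in> S" "Max (r ` S) = r z" by blast
  have z_max: "r y \<le> r z" if "y \<in> S" for y
    unfolding z(2)[symmetric] using S that by (intro Max_ge) auto
  obtain i1 j1 where z_eq: "z = (i1, j1)" by (cases z)
  have lt: "j < b" if "(i, j) \<in> S" for i j
    using that k_max[of i] bd by (auto simp: S_def bidegree_le_def le_less)
  have 1: "c2 Q i1 j1 \<noteq> 0" "k < i1" "j1 < b" using z(1) lt unfolding z_eq S_def by auto
  \<comment> \<open>Dividing the normal vector by the gcd makes the weights coprime, as needed for a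
    unimodular substitution.\<close>
  define g where "g = gcd (b - j1) (i1 - k)"
  have g: "g > 0" using 1 by (simp add: g_def)
  obtain w1 w2 where w: "b - j1 = w1 * g" "i1 - k = w2 * g" "coprime w1 w2"
    using gcd_coprime_exists[of "b - j1" "i1 - k"] g unfolding g_def by auto
  have wpos: "w1 > 0" "w2 > 0" using w 1 by (auto intro!: gr0I)
  define d where "d = w1 * k + w2 * b"
  have "w1 * i + w2 * j \<le> d" if "c2 Q i j \<noteq> 0" for i j
  proof (cases "i \<le> k")
    case True
    moreover have "j \<le> b" using bd that by (auto simp: bidegree_le_def)
    ultimately show ?thesis unfolding d_def by (intro add_mono mult_le_mono2)
  next
    case False
    then have S: "(i, j) \<in> S" using that by (simp add: S_def)
    have "real (i - k) / real (b - j) \<le> real (w2 * g) / real (w1 * g)"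
      using z_max[OF S] unfolding r_def z_eq w(1,2)[symmetric] by simp
    also have "\<dots> = real w2 / real w1" using g by simp
    finally have "real (i - k) * real w1 \<le> real w2 * real (b - j)"
      using wpos lt[OF S] by (simp add: field_simps)
    then have le: "(i - k) * w1 \<le> w2 * (b - j)" by (metis of_nat_le_iff of_nat_mult)
    obtain s r where sr: "i = k + s" "b = j + r"
      using False lt[OF S] by (metis le_Suc_ex less_imp_le nat_le_linear)
    show ?thesis using le unfolding d_def sr by (simp add: algebra_simps)
  qed
  moreover have "w1 * i1 + w2 * j1 = d"
  proof -
    have "i1 = k + w2 * g" "b = j1 + w1 * g" using w 1 by linarith+
    then show ?thesis unfolding d_def by (simp add: algebra_simps)
  qed
  moreover have "(k, b) \<noteq> (i1, j1)" using 1 by simp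
  ultimately have "on_edge Q w1 w2 d" unfolding on_edge_def using k 1(1) d_def by metis
  then show thesis using that wpos w(3) by blast
qed

text \<open>Induction on a + b for a bidegree bound (a, b) of the second component. If the bound is
  tight and both entries are positive, the missing corner yields an edge, and the edge yields a
  shear, possibly after exchanging the variables, that lowers the sum.\<close>

theorem GA2_tame:
  fixes f :: "'k::field polymap"
  assumes "f \<in> carrier GA2"
  shows "f \<in> tame"
proof -
  have "(P, Q) \<in> tame" if "(P, Q) \<in> carrier GA2" "bidegree_le Q a b" "a + b = n" for P Q :: "'k poly poly" and a b n
    using that
  proof (induction n arbitrary: P Q a b rule: less_induct)
    case (less n)
    note GA = less.prems(1) and bd = less.prems(2)
    have swap_comp: "pm_comp (P, Q) swap = (subst2 P Y X, subst2 Q Y X)"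
      by (simp add: pm_comp_def swap_def)
    have swap_GA: "(subst2 P Y X, subst2 Q Y X) \<in> carrier GA2"
      using GA2_comp[OF GA swap_GA2] by (simp add: swap_comp)
    have shear: "(R, S) \<in> tame" if RS: "(R, S) \<in> carrier GA2" "on_edge S w 1 d" "bidegree_le S a' b'" "w > 0" "a' + b' = n"
      for R S :: "'k poly poly" and w d a' b'
    proof -
      obtain c0 where c0: "bidegree_le (subst2 S (X + cst c0 * Y ^ w) Y) a' (b' - 1)" "b' > 0"
        using edge_reduction[OF RS(1,4,2,3)] .
      define e where "e = elementary_pm 1 (monom c0 w) 1 0"
      have e: "e = (X + cst c0 * Y ^ w, Y)"
        by (simp add: e_def elementary_pm_def in_y_def Y_power cst_def smult_monom flip: one_pCons)
      have "pm_comp (R, S) e \<in> carrier GA2" unfolding e_def by (rule GA2_comp[OF RS(1) shear_GA2])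
      then have "pm_comp (R, S) e \<in> tame"
        using less.IH[OF _ _ c0(1) refl, of "subst2 R (X + cst c0 * Y ^ w) Y"] c0(2) RS(5)
        by (simp add: pm_comp_def e)
      then show ?thesis unfolding e_def by (rule tame_of_shear)
    qed
    show ?case
    proof (cases "\<exists>a' b'. bidegree_le Q a' b' \<and> a' + b' < n")
      case True
      then show ?thesis using less.IH GA by blast
    next
      case False
      consider "a = 0" | "b = 0" | "a > 0" "b > 0" by blast
      then show ?thesis
      proof cases
        case 1
        then show ?thesis using elementary_of_bidegree_0[OF GA] bd by (auto intro: tame.elementary)
      next
        case 2
        then have "pm_comp (P, Q) swap \<in> \<E>"
          unfolding swap_comp using elementary_of_bidegree_0[OF swap_GA] bidegree_swap[OF bd] by blast
        then show ?thesis by (rule tame_of_swap[OF tame.elementary])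
      next
        case 3
        have "a + (b - 1) < n" "a - 1 + b < n" using 3 less.prems(3) by auto
        then have not_le: "\<not> bidegree_le Q a (b - 1)" "\<not> bidegree_le Q (a - 1) b" using False by blast+
        from not_le(1) obtain i0 where i0: "c2 Q i0 b \<noteq> 0"
          using bd unfolding bidegree_le_def by (metis Suc_diff_1 3(2) le_Suc_eq)
        from not_le(2) obtain j0 where j0: "c2 Q a j0 \<noteq> 0"
          using bd unfolding bidegree_le_def by (metis Suc_diff_1 3(1) le_Suc_eq)
        have "c2 Q a b = 0" using no_corner[OF GA _ _ 3] bd unfolding bidegree_le_def by blast
        then obtain w1 w2 d where w: "w1 > 0" "w2 > 0" "coprime w1 w2" "on_edge Q w1 w2 d"
          using Newton_edge[OF bd 3 _ i0 j0] by blast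
        \<comment> \<open>Bezout coefficients of the coprime weights complete them to a unimodular
          substitution.\<close>
        obtain al be where "w2 * al = w1 * be + gcd w2 w1" using bezout_nat[of w2 w1] w(2) by auto
        then have unimod: "al * w2 = Suc (be * w1)" using w(3) by (simp add: gcd.commute mult.commute)
        interpret weights w1 w2 al be by unfold_locales (use w unimod in auto)
        obtain p where p: "prime_elem p" "p dvd lead_coeff (Psi Q)" "\<not> p dvd [:0, 1:]" "Q \<noteq> 0"
          using edge_prime[OF w(4)] by metis
        have le: "w1 * w2 * degree p \<le> w1 \<or> w1 * w2 * degree p \<le> w2"
          using coordinate_leading_form(4)[OF GA p(4,1,3,2)] .
        have "degree p > 0" using prime_degree_pos[OF p(1)] .
        \<comment> \<open>With both weights at least 2, the product w1 w2 deg p would exceed each of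
          them.\<close>
        have "w2 = 1 \<or> w1 = 1"
        proof (rule ccontr)
          assume "\<not> (w2 = 1 \<or> w1 = 1)"
          then have "w1 * 2 \<le> w1 * w2" "2 * w2 \<le> w1 * w2" using w by (intro mult_le_mono; simp)+
          moreover have "w1 * w2 * 1 \<le> w1 * w2 * degree p" using \<open>degree p > 0\<close> by (intro mult_le_mono2) simp
          ultimately show False using le w by linarith
        qed
        then show ?thesis
        proof
          assume "w2 = 1"
          then show ?thesis using shear[OF GA _ bd w(1) less.prems(3)] w(4) by blast
        next
          assume "w1 = 1"
          then have "(subst2 P Y X, subst2 Q Y X) \<in> tame"
            using shear[OF swap_GA _ bidegree_swap[OF bd] w(2)] on_edge_swap[OF w(4)] less.prems(3)
            by (metis add.commute)
          then show ?thesis using tame_of_swap[of "(P, Q)"] by (simp add: swap_comp)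
        qed
      qed
    qed
  qed
  then show ?thesis using bidegree_exists[of "snd f"] assms by (metis prod.collapse)
qed

section \<open>Reduced words in an amalgamated product\<close>

primrec alternating :: "bool list \<Rightarrow> bool" where
  "alternating [] \<longleftrightarrow> True"
| alternating_Cons: "alternating (x # xs) \<longleftrightarrow> alternating xs \<and> (xs = [] \<or> x \<noteq> hd xs)"

lemma alternating_append:
  "alternating (xs @ ys) \<longleftrightarrow> alternating xs \<and> alternating ys \<and> (xs = [] \<or> ys = [] \<or> last xs \<noteq> hd ys)"
  by (induction xs) auto

lemma alternating_rev: "alternating (rev xs) \<longleftrightarrow> alternating xs"
  by (induction xs) (auto simp: alternating_append last_rev)

lemma alternating_hd_last:
  "alternating xs \<Longrightarrow> xs \<noteq> [] \<Longrightarrow> hd xs = last xs \<longleftrightarrow> odd (length xs)"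
  by (induction xs) auto

locale two_subgroups = group G for G (structure) +
  fixes A E :: "'a set"
  assumes A: "subgroup A G" and E: "subgroup E G"
begin

definition factor :: "bool \<Rightarrow> 'a set" where "factor t = (if t then A else E)"
definition letter :: "bool \<Rightarrow> 'a set" where "letter t = factor t - A \<inter> E"

text \<open>The type of a letter is \<open>True\<close> for \<open>A\<close> and \<open>False\<close> for \<open>E\<close>.\<close>

primrec red :: "bool list \<Rightarrow> 'a set" where
  "red [] = A \<inter> E"
| "red (t # ts) = {a \<otimes> g | a g. a \<in> letter t \<and> g \<in> red ts}"

lemma factor_subgroup: "subgroup (factor t) G"
  by (simp add: factor_def A E)

lemma base_subgroup: "subgroup (A \<inter> E) G"
  using subgroups_Inter_pair[OF A E] .

lemma base_factor: "b \<in> A \<inter> E \<Longrightarrow> b \<in> factor t"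
  by (simp add: factor_def)

lemma factor_closed: "x \<in> factor t \<Longrightarrow> x \<in> carrier G"
  using subgroup.subset[OF factor_subgroup] by blast

lemma base_closed: "b \<in> A \<inter> E \<Longrightarrow> b \<in> carrier G"
  using base_factor factor_closed by blast

lemma letter_factor: "a \<in> letter t \<Longrightarrow> a \<in> factor t"
  by (simp add: letter_def)

lemma letter_closed: "a \<in> letter t \<Longrightarrow> a \<in> carrier G"
  using letter_factor factor_closed by blast

lemma factor_mult: "x \<in> factor t \<Longrightarrow> y \<in> factor t \<Longrightarrow> x \<otimes> y \<in> factor t"
  by (rule subgroup.m_closed[OF factor_subgroup])

lemma factor_inv: "x \<in> factor t \<Longrightarrow> inv x \<in> factor t"
  by (rule subgroup.m_inv_closed[OF factor_subgroup])

lemma base_mult: "x \<in> A \<inter> E \<Longrightarrow> y \<in> A \<inter> E \<Longrightarrow> x \<otimes> y \<in> A \<inter> E"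
  by (rule subgroup.m_closed[OF base_subgroup])

lemma base_inv: "x \<in> A \<inter> E \<Longrightarrow> inv x \<in> A \<inter> E"
  by (rule subgroup.m_inv_closed[OF base_subgroup])

lemma base_one: "\<one> \<in> A \<inter> E"
  by (rule subgroup.one_closed[OF base_subgroup])

lemma factor_cases: "x \<in> factor t \<Longrightarrow> x \<in> A \<inter> E \<or> x \<in> letter t"
  by (auto simp: letter_def)

lemma letter_base:
  assumes "a \<in> letter t" "b \<in> A \<inter> E"
  shows "a \<otimes> b \<in> letter t"
proof -
  have "a \<in> A \<inter> E" if "a \<otimes> b \<in> A \<inter> E"
  proof -
    have "a = a \<otimes> b \<otimes> inv b" using letter_closed[OF assms(1)] base_closed[OF assms(2)] by (simp add: m_assoc)
    then show ?thesis using base_mult[OF that base_inv[OF assms(2)]] by simp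
  qed
  then show ?thesis
    using assms factor_mult[OF letter_factor base_factor] unfolding letter_def by blast
qed

lemma letter_inv: "a \<in> letter t \<Longrightarrow> inv a \<in> letter t"
  using base_inv[of "inv a"] factor_inv[of a t] letter_closed[of a t] unfolding letter_def by auto

lemma base_letter:
  assumes "a \<in> letter t" "b \<in> A \<inter> E"
  shows "b \<otimes> a \<in> letter t"
proof -
  have "inv (inv a \<otimes> inv b) \<in> letter t"
    using letter_inv[OF letter_base[OF letter_inv[OF assms(1)] base_inv[OF assms(2)]]] .
  then show ?thesis using letter_closed[OF assms(1)] base_closed[OF assms(2)] by (simp add: inv_mult_group)
qed

lemma red_closed: "g \<in> red ts \<Longrightarrow> g \<in> carrier G"
  by (induction ts arbitrary: g) (auto intro: base_closed letter_closed)

lemma red_ConsI: "a \<in> letter t \<Longrightarrow> g \<in> red ts \<Longrightarrow> a \<otimes> g \<in> red (t # ts)"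
  by auto

lemma base_red: "b \<in> A \<inter> E \<Longrightarrow> g \<in> red ts \<Longrightarrow> b \<otimes> g \<in> red ts"
proof (cases ts)
  case (Cons t us)
  assume b: "b \<in> A \<inter> E" and "g \<in> red ts"
  then obtain a h where "g = a \<otimes> h" "a \<in> letter t" "h \<in> red us" using Cons by auto
  moreover from this have "b \<otimes> g = (b \<otimes> a) \<otimes> h"
    using letter_closed red_closed base_closed[OF b] by (simp add: m_assoc)
  ultimately show ?thesis using base_letter[OF _ b] Cons by auto
qed (simp add: base_mult del: Int_iff)

lemma red_append: "g \<in> red ts \<Longrightarrow> h \<in> red us \<Longrightarrow> g \<otimes> h \<in> red (ts @ us)"
proof (induction ts arbitrary: g)
  case Nil
  then show ?case by (simp add: base_red del: Int_iff)
next
  case (Cons t ts)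
  then obtain a k where "g = a \<otimes> k" "a \<in> letter t" "k \<in> red ts" by auto
  moreover from this have "g \<otimes> h = a \<otimes> (k \<otimes> h)"
    using letter_closed red_closed Cons.prems by (simp add: m_assoc)
  ultimately show ?case using Cons.IH Cons.prems by auto
qed

lemma red_base: "g \<in> red ts \<Longrightarrow> b \<in> A \<inter> E \<Longrightarrow> g \<otimes> b \<in> red ts"
  using red_append[of g ts b "[]"] by simp

lemma red_letter: "a \<in> letter t \<Longrightarrow> a \<in> red [t]"
  using red_ConsI[of a t \<one> "[]"] base_one letter_closed[of a t] by simp

lemma red_single: "red [t] = letter t"
  using letter_base red_letter by auto

lemma red_snoc: "g \<in> red ts \<Longrightarrow> a \<in> letter t \<Longrightarrow> g \<otimes> a \<in> red (ts @ [t])"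
  using red_append red_letter by blast

lemma red_split:
  assumes "x \<in> red (ts @ us)"
  obtains g h where "g \<in> red ts" "h \<in> red us" "x = g \<otimes> h"
  using assms
proof (induction ts arbitrary: x thesis)
  case Nil
  then show ?case using base_one red_closed[of x us] by (metis append_Nil l_one red.simps(1))
next
  case (Cons t ts)
  then obtain a y where y: "x = a \<otimes> y" "a \<in> letter t" "y \<in> red (ts @ us)" by auto
  then obtain g h where gh: "g \<in> red ts" "h \<in> red us" "y = g \<otimes> h" using Cons.IH by metis
  have "x = (a \<otimes> g) \<otimes> h"
    using y gh letter_closed red_closed by (simp add: m_assoc)
  then show ?case using Cons.prems(1)[OF red_ConsI[OF y(2) gh(1)] gh(2)] by blast
qed

lemma red_inv: "g \<in> red ts \<Longrightarrow> inv g \<in> red (rev ts)"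
proof (induction ts arbitrary: g)
  case Nil
  then show ?case using base_inv by simp
next
  case (Cons t ts)
  then obtain a h where "g = a \<otimes> h" "a \<in> letter t" "h \<in> red ts" by auto
  moreover from this have "inv g = inv h \<otimes> inv a"
    using letter_closed red_closed by (simp add: inv_mult_group)
  ultimately show ?case using red_snoc[OF Cons.IH letter_inv] by auto
qed

lemma factor_red_closed:
  assumes "x \<in> factor t" "g \<in> red ts" "alternating ts"
  shows "\<exists>us. alternating us \<and> x \<otimes> g \<in> red us"
proof (cases "x \<in> A \<inter> E")
  case True
  then show ?thesis using base_red assms by blast
next
  case False
  then have x: "x \<in> letter t" using assms(1) factor_cases by blast
  show ?thesis
  proof (cases "ts = [] \<or> hd ts \<noteq> t")
    case True
    then have "alternating (t # ts)" using assms(3) by (auto simp: alternating_Cons)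
    then show ?thesis using red_ConsI[OF x assms(2)] by blast
  next
    case False
    then obtain us where ts: "ts = t # us" by (cases ts) auto
    then obtain a h where a: "g = a \<otimes> h" "a \<in> letter t" "h \<in> red us" using assms(2) by auto
    have "x \<otimes> g = (x \<otimes> a) \<otimes> h"
      using a letter_closed red_closed x by (simp add: m_assoc)
    moreover have "x \<otimes> a \<in> A \<inter> E \<or> x \<otimes> a \<in> letter t"
      using factor_cases factor_mult[OF assms(1) letter_factor[OF a(2)]] by blast
    moreover have "alternating us" using assms(3) ts by (simp add: alternating_Cons)
    ultimately show ?thesis using base_red red_ConsI a(3) assms(3) ts by metis
  qed
qed

end

section \<open>Amalgamated products: uniqueness of types and centralizers\<close>

locale amalgam = two_subgroups +
  assumes nontrivial: "ts \<noteq> [] \<Longrightarrow> alternating ts \<Longrightarrow> red ts \<inter> (A \<inter> E) = {}"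
begin

text \<open>Only the pattern of types is unique, as elements of \<open>A \<inter> E\<close> can be
  moved between letters. First letters of different types would give a nonempty alternating word for
  1. For equal types the quotient c of the first letters lies in \<open>A \<inter> E\<close> and is
  absorbed by the tail, or it is a letter that would force two equal neighbouring types.\<close>

theorem red_unique:
  assumes "g \<in> red ts" "g \<in> red us" "alternating ts" "alternating us"
  shows "ts = us"
  using assms
proof (induction "length ts + length us" arbitrary: ts us g rule: less_induct)
  case less
  note g = less.prems(1,2) and alt = less.prems(3,4)
  show ?case
  proof (cases ts)
    case Nil
    then show ?thesis using g nontrivial[of us] alt by (cases us) auto
  next
    case ts: (Cons t ts')
    show ?thesis
    proof (cases us)
      case Nil
      then show ?thesis using g nontrivial[of ts] alt ts by auto
    next
      case us: (Cons u us')
      obtain a h where a: "g = a \<otimes> h" "a \<in> letter t" "h \<in> red ts'" using g ts by auto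
      obtain a' h' where a': "g = a' \<otimes> h'" "a' \<in> letter u" "h' \<in> red us'" using g us by auto
      note closed = letter_closed[OF a(2)] letter_closed[OF a'(2)] red_closed[OF a(3)] red_closed[OF a'(3)]
      have alt': "alternating ts'" "alternating us'" using alt ts us by (simp_all add: alternating_Cons)
      show ?thesis
      proof (cases "t = u")
        case True
        define c where "c = inv a' \<otimes> a"
        have h': "h' = c \<otimes> h"
        proof -
          have "h' = inv a' \<otimes> (a' \<otimes> h')" using closed by (simp add: m_assoc[symmetric])
          also have "\<dots> = inv a' \<otimes> (a \<otimes> h)" using a(1) a'(1) by simp
          finally show ?thesis using closed by (simp add: c_def m_assoc)
        qed
        have "c \<in> factor t"
          unfolding c_def using a(2) a'(2) True by (intro factor_mult factor_inv letter_factor) auto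
        then consider "c \<in> A \<inter> E" | "c \<in> letter t" using factor_cases by blast
        then show ?thesis
        proof cases
          case 1
          then have "h' \<in> red ts'" using base_red a(3) h' by simp
          then have "ts' = us'" using less.hyps[of ts' us' h'] a'(3) alt' ts us by simp
          then show ?thesis using ts us True by simp
        next
          case 2
          then have "h' \<in> red (t # ts')" using red_ConsI a(3) h' by simp
          then have "t # ts' = us'" using less.hyps[of "t # ts'" us' h'] a'(3) alt alt' ts us by simp
          then show ?thesis using alt(2) us True by (auto simp: alternating_Cons)
        qed
      next
        case False
        have "inv g \<otimes> g \<in> red (rev ts @ us)" using red_append[OF red_inv] g by blast
        then have "\<one> \<in> red (rev ts @ us)" using red_closed[OF g(1)] by simp
        moreover have "alternating (rev ts @ us)"
          using alt ts us False by (simp add: alternating_append alternating_rev last_rev del: rev.simps)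
        ultimately show ?thesis using nontrivial[of "rev ts @ us"] base_one ts by auto
      qed
    qed
  qed
qed

text \<open>Where letters of equal type meet, they merge into one letter, or fall into
  \<open>A \<inter> E\<close> and the cancellation continues; either way at least one letter is
  lost.\<close>

lemma product_length:
  assumes "g \<in> red ts" "h \<in> red us" "alternating ts" "alternating us"
  shows "\<exists>vs. alternating vs \<and> g \<otimes> h \<in> red vs \<and> length vs \<le> length ts + length us \<and>
    (ts \<noteq> [] \<and> us \<noteq> [] \<and> last ts = hd us \<longrightarrow> length vs < length ts + length us)"
  using assms
proof (induction ts arbitrary: g h us rule: rev_induct)
  case Nil
  then show ?case using red_append[of g "[]" h us] by auto
next
  case (snoc t ts)
  show ?case
  proof (cases "us = [] \<or> hd us \<noteq> t")
    case True
    then show ?thesis using red_append[OF snoc.prems(1,2)] snoc.prems(3,4)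
      by (intro exI[of _ "(ts @ [t]) @ us"]) (auto simp: alternating_append)
  next
    case False
    then obtain us' where us: "us = t # us'" by (cases us) auto
    obtain k a where k: "k \<in> red ts" "a \<in> letter t" "g = k \<otimes> a"
      using red_split[OF snoc.prems(1)] red_single by metis
    obtain a' k' where k': "a' \<in> letter t" "k' \<in> red us'" "h = a' \<otimes> k'"
      using snoc.prems(2) us by auto
    have alt: "alternating ts" "alternating us'" using snoc.prems(3,4) us by (auto simp: alternating_append alternating_Cons)
    note closed = letter_closed[OF k(2)] letter_closed[OF k'(1)] red_closed[OF k(1)] red_closed[OF k'(2)]
    have eq: "g \<otimes> h = k \<otimes> ((a \<otimes> a') \<otimes> k')" using closed k(3) k'(3) by (simp add: m_assoc)
    have "a \<otimes> a' \<in> factor t" using k(2) k'(1) by (intro factor_mult letter_factor)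
    then consider "a \<otimes> a' \<in> A \<inter> E" | "a \<otimes> a' \<in> letter t" using factor_cases by blast
    then show ?thesis
    proof cases
      case 1
      then have "(a \<otimes> a') \<otimes> k' \<in> red us'" using base_red k'(2) by blast
      from snoc.IH[OF k(1) this alt] show ?thesis unfolding eq us by auto
    next
      case 2
      then have "(a \<otimes> a') \<otimes> k' \<in> red (t # us')" using red_ConsI k'(2) by blast
      then have "g \<otimes> h \<in> red (ts @ us)" unfolding eq us using red_append k(1) by blast
      moreover have "alternating (ts @ us)" using snoc.prems(3,4) us by (auto simp: alternating_append)
      ultimately show ?thesis by (intro exI[of _ "ts @ us"]) auto
    qed
  qed
qed

text \<open>
  In terms of the Bass--Serre tree: the base edge lies on the axis of \<open>g\<close>, and an element of finite
  order commuting with \<open>g\<close> fixes that axis pointwise.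
\<close>

theorem finite_order_centralizer:
  assumes g: "g \<in> red ts" "alternating ts" "ts \<noteq> []" "even (length ts)"
    and s: "s \<in> red us" "alternating us" "s \<otimes> g = g \<otimes> s"
    and order: "n > 0" "s [^] (n::nat) = \<one>"
  shows "s \<in> A \<inter> E"
proof -
  \<comment> \<open>If s h is reduced as written, then h s has the same full length and is reduced
    too, so us @ vs = vs @ us. The words of s and h then begin alike, the two ends of the word of s
    have different types, and all powers of s remain reduced; none of them is 1.\<close>
  have us_Nil: "us = []" if h: "h \<in> red vs" "alternating vs" "vs \<noteq> []" "even (length vs)"
      and comm: "s \<otimes> h = h \<otimes> s" and facing: "us \<noteq> [] \<longrightarrow> last us \<noteq> hd vs" for h vs
  proof (rule ccontr)
    assume us: "us \<noteq> []"
    have alt: "alternating (us @ vs)" using s h facing by (auto simp: alternating_append)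
    have sh: "h \<otimes> s \<in> red (us @ vs)" using red_append[OF s(1) h(1)] comm by simp
    have "last vs \<noteq> hd us"
    proof
      assume "last vs = hd us"
      then obtain ws where "alternating ws" "h \<otimes> s \<in> red ws" "length ws < length vs + length us"
        using product_length[OF h(1) s(1) h(2) s(2)] us h(3) by blast
      then show False using red_unique[OF sh _ alt] by fastforce
    qed
    then have "alternating (vs @ us)" using s h by (auto simp: alternating_append)
    then have "us @ vs = vs @ us" using red_unique[OF sh red_append[OF h(1) s(1)] alt] by simp
    then have "hd us = hd vs" using us h(3) by (metis hd_append2)
    then have *: "last us \<noteq> hd us" using facing us by simp
    have "\<exists>ws. alternating ws \<and> ws \<noteq> [] \<and> last ws = last us \<and> s [^] (Suc k) \<in> red ws" for k
    proof (induction k)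
      case 0
      then show ?case using s us red_closed[OF s(1)] by (intro exI[of _ us]) simp
    next
      case (Suc k)
      then obtain ws where ws: "alternating ws" "ws \<noteq> []" "last ws = last us" "s [^] (Suc k) \<in> red ws" by blast
      have "s [^] (Suc (Suc k)) = s [^] (Suc k) \<otimes> s" by simp
      then have "s [^] (Suc (Suc k)) \<in> red (ws @ us)" using red_append[OF ws(4) s(1)] by simp
      moreover have "alternating (ws @ us)" using ws s(2) * by (simp add: alternating_append)
      ultimately show ?case using us by (intro exI[of _ "ws @ us"]) simp
    qed
    then obtain ws where "alternating ws" "ws \<noteq> []" "s [^] n \<in> red ws" using order(1) by (metis Suc_pred)
    then show False using nontrivial[of ws] base_one order(2) by auto
  qed
  have "us = []"
  proof (cases "us \<noteq> [] \<longrightarrow> last us \<noteq> hd ts")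
    case True
    then show ?thesis using us_Nil[OF g s(3)] by blast
  next
    case False
    \<comment> \<open>A word of even length has ends of different types. If s meets g in equal
      types, it therefore meets the inverse of g in different ones, and it commutes with that
      inverse as well.\<close>
    have "hd ts \<noteq> last ts" using alternating_hd_last[OF g(2,3)] g(4) by simp
    then have "us \<noteq> [] \<longrightarrow> last us \<noteq> hd (rev ts)" using False g(3) by (simp add: hd_rev)
    moreover have "s \<otimes> inv g = inv g \<otimes> s"
    proof -
      note closed = red_closed[OF g(1)] red_closed[OF s(1)]
      have "inv g \<otimes> (s \<otimes> g) \<otimes> inv g = inv g \<otimes> (g \<otimes> s) \<otimes> inv g" using s(3) by simp
      then show ?thesis using closed by (simp add: m_assoc inv_solve_left)
    qed
    ultimately show ?thesis
      using us_Nil[OF red_inv[OF g(1)]] g by (simp add: alternating_rev)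
  qed
  then show ?thesis using s(1) by simp
qed

text \<open>Conjugation by x keeps s' in the factor of type t. Were the result a letter, k times it
  would have one letter more than s k, although the two are equal. The outcome is again an
  intertwining relation, for the shorter word k.\<close>

lemma base_intertwine_last:
  assumes k: "k \<in> red ts" "x \<in> letter t" "alternating (ts @ [t])"
    and s: "s \<in> A \<inter> E" "s' \<in> A \<inter> E" "(k \<otimes> x) \<otimes> s' = s \<otimes> (k \<otimes> x)"
  shows "x \<otimes> s' \<otimes> inv x \<in> A \<inter> E" "k \<otimes> (x \<otimes> s' \<otimes> inv x) = s \<otimes> k"
proof -
  note closed = red_closed[OF k(1)] letter_closed[OF k(2)] base_closed[OF s(1)] base_closed[OF s(2)]
  have "k \<otimes> (x \<otimes> s' \<otimes> inv x) = ((k \<otimes> x) \<otimes> s') \<otimes> inv x" using closed by (simp add: m_assoc)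
  also have "\<dots> = s \<otimes> k" unfolding s(3) using closed by (simp add: m_assoc)
  finally show eq: "k \<otimes> (x \<otimes> s' \<otimes> inv x) = s \<otimes> k" .
  show "x \<otimes> s' \<otimes> inv x \<in> A \<inter> E"
  proof (rule ccontr)
    assume "x \<otimes> s' \<otimes> inv x \<notin> A \<inter> E"
    moreover have "x \<otimes> s' \<otimes> inv x \<in> factor t"
      using k(2) s(2) by (intro factor_mult factor_inv letter_factor base_factor)
    ultimately have "x \<otimes> s' \<otimes> inv x \<in> letter t" using factor_cases by blast
    then have "s \<otimes> k \<in> red (ts @ [t])" using red_snoc[OF k(1)] eq by metis
    moreover have "s \<otimes> k \<in> red ts" using base_red s(1) k(1) by blast
    ultimately have "ts @ [t] = ts" using red_unique k(3) by (metis alternating_append)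
    then show False by simp
  qed
qed

end

section \<open>The plane automorphism group as an amalgamated product\<close>

definition base_pm :: "'k::field \<Rightarrow> 'k \<Rightarrow> 'k \<Rightarrow> 'k \<Rightarrow> 'k \<Rightarrow> 'k polymap"
  where "base_pm \<alpha> \<gamma> u \<beta> v = affine_pm \<alpha> \<gamma> 0 \<beta> u v"

lemma affine_eq_elementary:
  "affine_pm a b c d u v = elementary_pm a' P b' v' \<longleftrightarrow>
    c = 0 \<and> a = a' \<and> d = b' \<and> v = v' \<and> P = [:u, b:]"
  by (auto simp: affine_pm_def elementary_pm_def cst_def X_def Y_def in_y_def)

lemma base_pm_elementary: "base_pm \<alpha> \<gamma> u \<beta> v = elementary_pm \<alpha> [:u, \<gamma>:] \<beta> v"
  by (simp add: base_pm_def affine_eq_elementary)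

lemma triangular_affine_iff: "f \<in> \<B> \<longleftrightarrow> (\<exists>\<alpha> \<gamma> u \<beta> v. \<alpha> \<noteq> 0 \<and> \<beta> \<noteq> 0 \<and> f = base_pm \<alpha> \<gamma> u \<beta> v)"
proof
  assume "f \<in> \<B>"
  then obtain a b c d u v \<alpha> P \<beta> v' where f: "f = affine_pm a b c d u v" "a * d - b * c \<noteq> 0"
      "f = elementary_pm \<alpha> P \<beta> v'"
    unfolding triangular_affine_maps_def affine_maps_def elementary_maps_def by blast
  then have "c = 0" by (metis affine_eq_elementary)
  then have "a \<noteq> 0" "d \<noteq> 0" "f = base_pm a b u d v"
    using f(1,2) by (auto simp: base_pm_def)
  then show "\<exists>\<alpha> \<gamma> u \<beta> v. \<alpha> \<noteq> 0 \<and> \<beta> \<noteq> 0 \<and> f = base_pm \<alpha> \<gamma> u \<beta> v" by blast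
next
  assume "\<exists>\<alpha> \<gamma> u \<beta> v. \<alpha> \<noteq> 0 \<and> \<beta> \<noteq> 0 \<and> f = base_pm \<alpha> \<gamma> u \<beta> v"
  then obtain \<alpha> \<gamma> u \<beta> v where f: "\<alpha> \<noteq> 0" "\<beta> \<noteq> 0" "f = base_pm \<alpha> \<gamma> u \<beta> v" by blast
  have "f \<in> \<A>" unfolding affine_maps_def f(3) base_pm_def using f(1,2) by fastforce
  moreover have "f \<in> \<E>" unfolding f(3) base_pm_elementary using f by (simp add: elementary_I)
  ultimately show "f \<in> \<B>" by (simp add: triangular_affine_maps_def)
qed

lemma affine_I: "a * d - b * c \<noteq> 0 \<Longrightarrow> affine_pm a b c d u v \<in> \<A>"
  unfolding affine_maps_def by blast

lemma affine_inverse: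
  fixes a b c d u v :: "'k::field"
  assumes "a * d - b * c \<noteq> 0"
  obtains g where "g \<in> \<A>" "pm_comp (affine_pm a b c d u v) g = pm_id" "pm_comp g (affine_pm a b c d u v) = pm_id"
proof -
  define D where "D = a * d - b * c"
  have D: "D \<noteq> 0" "a * d = D + b * c" using assms by (simp_all add: D_def)
  then have ad: "a * (d * x) = D * x + b * (c * x)" for x by (metis distrib_right mult.assoc)
  let ?g = "affine_pm (d / D) (- b / D) (- c / D) (a / D) (- (d * u - b * v) / D) (- (a * v - c * u) / D)"
  have "pm_comp (affine_pm a b c d u v) ?g = pm_id" "pm_comp ?g (affine_pm a b c d u v) = pm_id"
    using D by (simp_all add: affine_comp affine_id affine_eq_iff field_simps ad)
  moreover have "?g \<in> \<A>"
    using D by (intro affine_I) (simp add: field_simps)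
  ultimately show thesis using that by blast
qed

lemma elementary_inverse:
  fixes \<alpha> \<beta> v :: "'k::field"
  assumes "\<alpha> * \<beta> \<noteq> 0"
  obtains g where "g \<in> \<E>" "pm_comp (elementary_pm \<alpha> P \<beta> v) g = pm_id" "pm_comp g (elementary_pm \<alpha> P \<beta> v) = pm_id"
proof -
  define R where "R = smult (- inverse \<alpha>) (pcompose P [:- v / \<beta>, 1 / \<beta>:])"
  have *: "pcompose [:- v / \<beta>, 1 / \<beta>:] [:v, \<beta>:] = [:0, 1:]"
    using assms by (simp add: pcompose_pCons)
  have "pcompose R [:v, \<beta>:] = smult (- inverse \<alpha>) P"
    unfolding R_def pcompose_smult pcompose_assoc[symmetric] * by simp
  then have "pm_comp (elementary_pm \<alpha> P \<beta> v) (elementary_pm (1 / \<alpha>) R (1 / \<beta>) (- v / \<beta>)) = pm_id"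
    "pm_comp (elementary_pm (1 / \<alpha>) R (1 / \<beta>) (- v / \<beta>)) (elementary_pm \<alpha> P \<beta> v) = pm_id"
    using assms by (simp_all add: elementary_comp elementary_id elementary_eq_iff divide_inverse) (simp add: R_def divide_inverse)
  moreover have "elementary_pm (1 / \<alpha>) R (1 / \<beta>) (- v / \<beta>) \<in> \<E>"
    using assms by (intro elementary_I) simp
  ultimately show thesis using that by blast
qed

lemma affine_inverse_exists: "f \<in> \<A> \<Longrightarrow> \<exists>g\<in>\<A>. pm_comp f g = pm_id \<and> pm_comp g f = pm_id"
proof -
  assume "f \<in> \<A>"
  then obtain a b c d u v where f: "f = affine_pm a b c d u v" "a * d - b * c \<noteq> 0"
    unfolding affine_maps_def by blast
  show ?thesis using affine_inverse[OF f(2), of u v] unfolding f(1) by blast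
qed

lemma elementary_inverse_exists: "f \<in> \<E> \<Longrightarrow> \<exists>g\<in>\<E>. pm_comp f g = pm_id \<and> pm_comp g f = pm_id"
proof -
  assume "f \<in> \<E>"
  then obtain \<alpha> P \<beta> v where f: "f = elementary_pm \<alpha> P \<beta> v" "\<alpha> * \<beta> \<noteq> 0"
    unfolding elementary_maps_def by blast
  show ?thesis using elementary_inverse[OF f(2), of P v] unfolding f(1) by blast
qed

lemma affine_subgroup: "subgroup \<A> (GA2 :: 'k::field polymap monoid)"
proof (rule group.subgroupI[OF group_GA2])
  show "\<A> \<subseteq> carrier (GA2 :: 'k polymap monoid)"
    using affine_inverse_exists GA2_I by blast
  have "(pm_id :: 'k polymap) \<in> \<A>" unfolding affine_id by (rule affine_I) simp
  then show "\<A> \<noteq> ({} :: 'k polymap set)" by blast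
  show "inv\<^bsub>GA2\<^esub> f \<in> \<A>" if "f \<in> \<A>" for f :: "'k polymap"
    using affine_inverse_exists[OF that] inv_GA2_eq by metis
  show "f \<otimes>\<^bsub>GA2\<^esub> g \<in> \<A>" if fg: "f \<in> \<A>" "g \<in> \<A>" for f g :: "'k polymap"
  proof -
    obtain a b c d u v where f: "f = affine_pm a b c d u v" "a * d - b * c \<noteq> 0"
      using fg(1) unfolding affine_maps_def by blast
    obtain a' b' c' d' u' v' where g: "g = affine_pm a' b' c' d' u' v'" "a' * d' - b' * c' \<noteq> 0"
      using fg(2) unfolding affine_maps_def by blast
    have "(a * d - b * c) * (a' * d' - b' * c') \<noteq> 0" using f(2) g(2) by simp
    then show ?thesis
      unfolding f(1) g(1) GA2_simps affine_comp by (intro affine_I) (simp add: algebra_simps)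
  qed
qed

lemma elementary_subgroup: "subgroup \<E> (GA2 :: 'k::field polymap monoid)"
proof (rule group.subgroupI[OF group_GA2])
  show "\<E> \<subseteq> carrier (GA2 :: 'k polymap monoid)"
    using elementary_inverse_exists GA2_I by blast
  have "(pm_id :: 'k polymap) \<in> \<E>" unfolding elementary_id by (rule elementary_I) simp
  then show "\<E> \<noteq> ({} :: 'k polymap set)" by blast
  show "inv\<^bsub>GA2\<^esub> f \<in> \<E>" if "f \<in> \<E>" for f :: "'k polymap"
    using elementary_inverse_exists[OF that] inv_GA2_eq by metis
  show "f \<otimes>\<^bsub>GA2\<^esub> g \<in> \<E>" if fg: "f \<in> \<E>" "g \<in> \<E>" for f g :: "'k polymap"
    using fg unfolding elementary_maps_def by (auto simp: elementary_comp) (metis no_zero_divisors)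
qed

global_interpretation GA: two_subgroups "GA2 :: 'k::field polymap monoid" \<A> \<E>
  defines GA_letter = GA.letter and GA_red = GA.red and GA_factor = GA.factor
  by (intro two_subgroups.intro two_subgroups_axioms.intro group_GA2 affine_subgroup elementary_subgroup)

lemma GA_factor_simps [simp]: "GA_factor True = \<A>" "GA_factor False = \<E>"
  by (simp_all add: GA.factor_def)

lemma base_eq: "\<A> \<inter> \<E> = \<B>"
  by (simp add: triangular_affine_maps_def)

lemma GA_letter_affine:
  "f \<in> GA_letter True \<longleftrightarrow> (\<exists>a b c d u v. f = affine_pm a b c d u v \<and> a * d - b * c \<noteq> 0 \<and> c \<noteq> 0)"
proof -
  have "affine_pm a b c d u v \<in> \<B> \<longleftrightarrow> c = 0" if "a * d - b * c \<noteq> 0" for a b c d u v :: 'a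
    using that unfolding triangular_affine_iff base_pm_def affine_eq_iff by auto
  note base = this
  have letter: "f \<in> GA_letter True \<longleftrightarrow> f \<in> \<A> \<and> f \<notin> \<B>"
    unfolding GA.letter_def base_eq by simp
  show ?thesis
  proof
    assume "f \<in> GA_letter True"
    then have f: "f \<in> \<A>" "f \<notin> \<B>" using letter by blast+
    then obtain a b c d u v where "f = affine_pm a b c d u v" "a * d - b * c \<noteq> 0"
      unfolding affine_maps_def by blast
    then show "\<exists>a b c d u v. f = affine_pm a b c d u v \<and> a * d - b * c \<noteq> 0 \<and> c \<noteq> 0"
      using base f(2) by metis
  next
    assume "\<exists>a b c d u v. f = affine_pm a b c d u v \<and> a * d - b * c \<noteq> 0 \<and> c \<noteq> 0"
    then show "f \<in> GA_letter True" unfolding letter using base affine_I by metis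
  qed
qed

lemma GA_letter_elementary:
  "f \<in> GA_letter False \<longleftrightarrow> (\<exists>\<alpha> P \<beta> v. f = elementary_pm \<alpha> P \<beta> v \<and> \<alpha> \<noteq> 0 \<and> \<beta> \<noteq> 0 \<and> degree P \<ge> 2)"
proof -
  have deg: "degree P \<le> 1 \<longleftrightarrow> (\<exists>u \<gamma>. P = [:u, \<gamma>:])" for P :: "'a poly"
  proof
    assume P: "degree P \<le> 1"
    have "coeff P n = coeff [:coeff P 0, coeff P 1:] n" for n
      using P by (cases n; cases "n - 1") (auto simp: coeff_pCons coeff_eq_0 split: nat.splits)
    then have "P = [:coeff P 0, coeff P 1:]" by (rule poly_eqI)
    then show "\<exists>u \<gamma>. P = [:u, \<gamma>:]" by blast
  qed auto
  have "elementary_pm \<alpha> P \<beta> v \<in> \<B> \<longleftrightarrow> degree P \<le> 1" if "\<alpha> \<noteq> 0" "\<beta> \<noteq> 0" for \<alpha> P \<beta> and v :: 'a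
    unfolding triangular_affine_iff base_pm_elementary elementary_eq_iff deg using that by blast
  note base = this
  have letter: "f \<in> GA_letter False \<longleftrightarrow> f \<in> \<E> \<and> f \<notin> \<B>"
    unfolding GA.letter_def base_eq by simp
  have two: "\<not> n \<le> 1 \<longleftrightarrow> 2 \<le> n" for n :: nat by auto
  show ?thesis
  proof
    assume "f \<in> GA_letter False"
    then have f: "f \<in> \<E>" "f \<notin> \<B>" using letter by blast+
    then obtain \<alpha> P \<beta> v where "f = elementary_pm \<alpha> P \<beta> v" "\<alpha> \<noteq> 0" "\<beta> \<noteq> 0"
      unfolding elementary_maps_def by auto
    then show "\<exists>\<alpha> P \<beta> v. f = elementary_pm \<alpha> P \<beta> v \<and> \<alpha> \<noteq> 0 \<and> \<beta> \<noteq> 0 \<and> degree P \<ge> 2"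
      using base f(2) two by metis
  next
    assume "\<exists>\<alpha> P \<beta> v. f = elementary_pm \<alpha> P \<beta> v \<and> \<alpha> \<noteq> 0 \<and> \<beta> \<noteq> 0 \<and> degree P \<ge> 2"
    then show "f \<in> GA_letter False" unfolding letter using base elementary_I two by (metis mult_eq_0_iff)
  qed
qed

section \<open>Total degree of reduced words\<close>

lemma degree_cst_mult:
  assumes "c \<noteq> 0"
  shows "degree (cst c * U) = degree U"
  using assms by (cases "U = 0") (simp_all add: cst_def)

text \<open>The total degree: x^i y^j becomes Y^i X^(i+j), and the power of Y keeps monomials of
  equal total degree apart.\<close>

definition tdeg :: "'k::field poly poly \<Rightarrow> nat" where "tdeg P = degree (subst2 P (Y * X) X)"

lemma tdeg_base:
  assumes "f \<in> \<B>"
  shows "tdeg (fst f) = 1" "tdeg (snd f) = 1"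
proof -
  obtain \<alpha> \<gamma> u \<beta> v where f: "\<alpha> \<noteq> 0" "\<beta> \<noteq> 0" "f = base_pm \<alpha> \<gamma> u \<beta> v"
    using assms triangular_affine_iff by metis
  show "tdeg (fst f) = 1" "tdeg (snd f) = 1"
    using f(1,2) unfolding tdeg_def f(3) base_pm_def affine_pm_def
    by simp_all (simp_all add: cst_def X_def Y_def)
qed

lemma tdeg_linear_le: "tdeg (cst a * P + cst b * Q + cst u) \<le> max (tdeg P) (tdeg Q)"
proof -
  have "degree (cst a * U) \<le> degree U" for U
    by (cases "a = 0") (simp_all add: degree_cst_mult)
  then show ?thesis
    unfolding tdeg_def subst2_add subst2_mult subst2_cst
    by (intro degree_add_le) (auto intro: max.coboundedI1 max.coboundedI2 simp: cst_def)
qed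

lemma tdeg_linear_eq:
  assumes "tdeg Q < tdeg P" "a \<noteq> 0"
  shows "tdeg (cst a * P + cst b * Q + cst u) = tdeg P"
proof -
  have "degree (cst b * subst2 Q (Y * X) X + cst u) < degree (cst a * subst2 P (Y * X) X)"
  proof -
    have "degree (cst b * U) \<le> degree U" for U
      by (cases "b = 0") (simp_all add: degree_cst_mult)
    moreover have "degree (cst u) = 0" by (simp add: cst_def)
    ultimately show ?thesis
      using assms by (intro degree_add_less) (auto simp: tdeg_def degree_cst_mult intro: le_less_trans)
  qed
  then show ?thesis
    unfolding tdeg_def subst2_add subst2_mult subst2_cst add.assoc
    using degree_add_eq_left degree_cst_mult[OF assms(2)] by metis
qed

lemma tdeg_subst_y:
  assumes "p \<noteq> 0" "tdeg Q > 0"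
  shows "tdeg (subst_y Q p) = degree p * tdeg Q"
proof -
  have "subst2 (subst_y Q p) (Y * X) X = subst_y (subst2 Q (Y * X) X) p"
    using subst2_assoc[of "in_y p" 0 Q "Y * X" X] by (simp add: subst2_in_y)
  then show ?thesis using degree_subst_y[OF assms(1)] assms(2) by (simp add: tdeg_def)
qed

text \<open>An elementary letter of degree at least 2 makes the first component strictly dominant;
  an affine letter with c nonzero then carries this top degree over to the second component. The
  bound by 2 starts at length two because a single affine letter has degree 1, like an element of
  \<open>\<B>\<close>.\<close>

lemma red_degree:
  fixes g :: "'k::field polymap"
  assumes "alternating ts" "g \<in> GA_red ts"
  shows "(if ts \<noteq> [] \<and> hd ts = False then tdeg (snd g) < tdeg (fst g) \<and> tdeg (snd g) \<ge> 1
    else tdeg (fst g) \<le> tdeg (snd g) \<and> tdeg (snd g) \<ge> 1) \<and>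
    (length ts \<ge> 2 \<longrightarrow> max (tdeg (fst g)) (tdeg (snd g)) \<ge> 2)"
  using assms
proof (induction ts arbitrary: g)
  case Nil
  then have "g \<in> \<B>" by (simp add: base_eq)
  from tdeg_base[OF this] show ?case by simp
next
  case (Cons t ts)
  then obtain f h where g: "g = pm_comp f h" "f \<in> GA_letter t" "h \<in> GA_red ts" by auto
  note IH = Cons.IH[OF _ g(3)]
  show ?case
  proof (cases t)
    case True
    then obtain a b c d u v where f: "f = affine_pm a b c d u v" "a * d - b * c \<noteq> 0" "c \<noteq> 0"
      using g(2) GA_letter_affine by metis
    have comp: "fst g = cst a * fst h + cst b * snd h + cst u" "snd g = cst c * fst h + cst d * snd h + cst v"
      unfolding g(1) f(1) affine_pm_def pm_comp_def by simp_all
    show ?thesis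
    proof (cases "ts = []")
      case True
      then have "g \<in> GA_letter t" using Cons.prems(2) GA.red_single by metis
      then have "g \<in> GA_letter True" using \<open>t\<close> by simp
      then obtain a b c d u v where g': "g = affine_pm a b c d u v" "c \<noteq> 0"
        unfolding GA_letter_affine by blast
      have "tdeg (snd g) = 1"
        unfolding g'(1) tdeg_def affine_pm_def using g'(2)
        by simp (simp add: cst_def X_def Y_def)
      moreover have "tdeg (fst g) \<le> 1"
      proof -
        have "tdeg (X :: 'k poly poly) = 1" "tdeg (Y :: 'k poly poly) = 1"
          by (simp_all add: tdeg_def) (simp_all add: X_def Y_def)
        then show ?thesis using tdeg_linear_le[of a X b Y u] unfolding g'(1) affine_pm_def by simp
      qed
      ultimately show ?thesis using True \<open>t\<close> by simp
    next
      case False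
      then have "hd ts = False" using Cons.prems(1) \<open>t\<close> by simp
      then have h: "tdeg (snd h) < tdeg (fst h)" "tdeg (snd h) \<ge> 1"
        using IH Cons.prems(1) False by auto
      have "tdeg (snd g) = tdeg (fst h)" unfolding comp(2) by (rule tdeg_linear_eq[OF h(1) f(3)])
      moreover have "tdeg (fst g) \<le> tdeg (fst h)"
        using tdeg_linear_le[of a "fst h" b "snd h" u] h(1) unfolding comp(1) by simp
      ultimately show ?thesis using h \<open>t\<close> by auto
    qed
  next
    case False
    then obtain \<alpha> P \<beta> v where f: "f = elementary_pm \<alpha> P \<beta> v" "\<alpha> \<noteq> 0" "\<beta> \<noteq> 0" "degree P \<ge> 2"
      using g(2) GA_letter_elementary by metis
    have comp: "fst g = cst 1 * subst_y (snd h) P + cst \<alpha> * fst h + cst 0" "snd g = cst \<beta> * snd h + cst v"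
      unfolding g(1) f(1) elementary_pm_def pm_comp_def by (simp_all add: subst2_in_y)
    have "\<not> (ts \<noteq> [] \<and> hd ts = False)" using Cons.prems(1) False by auto
    then have h: "tdeg (fst h) \<le> tdeg (snd h)" "tdeg (snd h) \<ge> 1"
      using IH Cons.prems(1) by (auto split: if_splits)
    have P: "tdeg (subst_y (snd h) P) = degree P * tdeg (snd h)"
      using f(4) h(2) by (intro tdeg_subst_y) auto
    have "2 * tdeg (snd h) \<le> degree P * tdeg (snd h)" using f(4) by (rule mult_le_mono1)
    then have less: "tdeg (snd h) < tdeg (subst_y (snd h) P)" "tdeg (subst_y (snd h) P) \<ge> 2"
      using h(2) unfolding P by linarith+
    then have "tdeg (fst g) = tdeg (subst_y (snd h) P)"
      unfolding comp(1) using h(1) by (intro tdeg_linear_eq) auto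
    moreover have "tdeg (snd g) = tdeg (snd h)"
    proof -
      have "tdeg (cst \<beta> * snd h + cst 0 * 0 + cst v) = tdeg (snd h)"
        using h(2) f(3) by (intro tdeg_linear_eq) (auto simp: tdeg_def)
      then show ?thesis unfolding comp(2) by simp
    qed
    ultimately show ?thesis using less h(2) False by auto
  qed
qed

lemma amalgam_GA2: "amalgam (GA2 :: 'k::field polymap monoid) \<A> \<E>"
proof (intro amalgam.intro amalgam_axioms.intro)
  show "two_subgroups (GA2 :: 'k polymap monoid) \<A> \<E>" by (rule GA.two_subgroups_axioms)
  fix ts
  assume ts: "ts \<noteq> []" "alternating ts"
  have False if "g \<in> GA_red ts" "g \<in> \<B>" for g :: "'k polymap"
  proof (cases "length ts \<ge> 2")
    case True
    then show False using red_degree[OF ts(2) that(1)] tdeg_base[OF that(2)] by auto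
  next
    case False
    then obtain t where "ts = [t]" using ts(1) by (cases ts; cases "tl ts") auto
    then have "g \<in> GA_letter t" using that(1) GA.red_single by metis
    then show False using that(2) unfolding GA.letter_def base_eq by simp
  qed
  then show "two_subgroups.red (GA2 :: 'k polymap monoid) \<A> \<E> ts \<inter> (\<A> \<inter> \<E>) = {}"
    unfolding GA_red_def[symmetric] base_eq by blast
qed

global_interpretation GA: amalgam "GA2 :: 'k::field polymap monoid" \<A> \<E>
  rewrites "two_subgroups.letter \<A> \<E> = GA_letter"
    and "two_subgroups.red (GA2 :: 'k polymap monoid) \<A> \<E> = GA_red"
    and "two_subgroups.factor \<A> \<E> = GA_factor"
  by (rule amalgam_GA2) (simp_all add: GA_letter_def GA_red_def GA_factor_def)

section \<open>Normal forms\<close>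

declare GA.red.simps(2) [simp del]

lemma GA2_inv_closed [simp]: "f \<in> carrier GA2 \<Longrightarrow> inv\<^bsub>GA2\<^esub> f \<in> carrier GA2"
  by (rule GA.inv_closed)

lemma GA2_inv [simp]:
  assumes "f \<in> carrier GA2"
  shows "pm_comp f (inv\<^bsub>GA2\<^esub> f) = pm_id" "pm_comp (inv\<^bsub>GA2\<^esub> f) f = pm_id"
  using GA.r_inv[OF assms] GA.l_inv[OF assms] by simp_all

lemma GA2_cancel:
  assumes "h \<in> carrier GA2" "pm_comp f h = pm_comp g h"
  shows "f = g"
  using arg_cong[OF assms(2), of "\<lambda>k. pm_comp k (inv\<^bsub>GA2\<^esub> h)"] assms(1) by (simp add: pm_comp_assoc)

text \<open>By induction on the tame presentation, left multiplication maps elements given by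
  alternating words to such elements; apply this to the identity.\<close>

theorem GA2_red:
  fixes f :: "'k::field polymap"
  assumes "f \<in> carrier GA2"
  obtains ts where "alternating ts" "f \<in> GA_red ts"
proof -
  have "\<exists>us. alternating us \<and> pm_comp f h \<in> GA_red us"
    if "f \<in> tame" "alternating ts" "h \<in> GA_red ts" for f h :: "'k polymap" and ts
    using that
  proof (induction arbitrary: h ts)
    case (affine f)
    then show ?case using GA.factor_red_closed[of f True h ts] by simp
  next
    case (elementary f)
    then show ?case using GA.factor_red_closed[of f False h ts] by simp
  next
    case (comp f g)
    then show ?case by (metis pm_comp_assoc)
  qed
  from this[OF GA2_tame[OF assms], of "[]" pm_id] GA.base_one that show thesis by auto
qed

section \<open>Normal forms from coset representatives\<close>

lemma I_map_affine: "I_map \<beta> = affine_pm 0 1 1 \<beta> 0 0"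
  by (simp add: I_map_def linear_pm_def)

lemma J_map_elementary:
  fixes P :: "'k::field poly"
  shows "J_map P = elementary_pm 1 (monom 1 2 * P) 1 0"
proof -
  have "in_y (monom (1::'k) 2) = Y ^ 2" by (simp add: Y_power in_y_def)
  then show ?thesis by (simp add: J_map_def elementary_pm_def)
qed

lemma I_map_letter: "I_map \<beta> \<in> GA_letter True"
  unfolding GA_letter_affine I_map_affine by (intro exI conjI, rule refl) simp_all

lemma J_map_letter: "P \<noteq> 0 \<Longrightarrow> J_map P \<in> GA_letter False"
  unfolding GA_letter_elementary J_map_elementary
  by (intro exI conjI, rule refl) (simp_all add: degree_mult_eq degree_monom_eq)

lemma J_map_eq_iff [simp]: "J_map P = J_map Q \<longleftrightarrow> P = Q"
  by (simp add: J_map_elementary elementary_eq_iff)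

lemma J_degree_J_map [simp]: "J_degree (J_map P) = 2 + degree P"
  by (simp add: J_degree_def)

definition kind :: "'k::field polymap \<Rightarrow> bool" where "kind u \<longleftrightarrow> u \<in> \<I>"

lemma letters_disjoint: "f \<in> GA_letter t \<Longrightarrow> f \<in> GA_letter (\<not> t) \<Longrightarrow> False"
  unfolding GA.letter_def by (cases t) auto

lemma I_maps_letter: "u \<in> \<I> \<Longrightarrow> u \<in> GA_letter True"
  using I_map_letter by (auto simp: I_maps_def)

lemma J_maps_letter: "u \<in> \<J> \<Longrightarrow> u \<in> GA_letter False"
  using J_map_letter by (auto simp: J_maps_def)

lemma I_J_disjoint: "u \<in> \<I> \<Longrightarrow> u \<notin> \<J>"
  using I_maps_letter[of u] J_maps_letter[of u] letters_disjoint[of u True] by auto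

lemma kind_I_map [simp]: "kind (I_map \<beta>)"
  by (simp add: kind_def I_maps_def)

lemma kind_J_map: "P \<noteq> 0 \<Longrightarrow> \<not> kind (J_map P)"
  using I_J_disjoint[of "J_map P"] by (auto simp: kind_def J_maps_def)

lemma kind_letter: "u \<in> \<I> \<union> \<J> \<Longrightarrow> u \<in> GA_letter (kind u)"
  using I_maps_letter[of u] J_maps_letter[of u] I_J_disjoint[of u] unfolding kind_def by (cases "u \<in> \<I>") auto

lemma word_map_simps [simp]: "word_map [] = pm_id" "word_map (u # w) = pm_comp u (word_map w)"
  by (simp_all add: word_map_def)

lemma word_map_append: "word_map (v @ w) = pm_comp (word_map v) (word_map w)"
  by (induction v) (simp_all add: pm_comp_assoc)

lemma word_map_red: "set w \<subseteq> \<I> \<union> \<J> \<Longrightarrow> word_map w \<in> GA_red (map kind w)"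
proof (induction w)
  case Nil
  then show ?case using GA.base_one by simp
next
  case (Cons u w)
  then have "pm_comp u (word_map w) \<in> GA_red (kind u # map kind w)"
    using GA.red_ConsI[OF kind_letter[of u], of "word_map w" "map kind w"] by simp
  then show ?case by simp
qed

lemma alternating_kind:
  assumes "set w \<subseteq> \<I> \<union> \<J>"
  shows "successively (\<lambda>u v. (u \<in> \<I> \<and> v \<in> \<J>) \<or> (u \<in> \<J> \<and> v \<in> \<I>)) w \<longleftrightarrow> alternating (map kind w)"
  using assms
proof (induction w)
  case (Cons u w)
  show ?case
  proof (cases w)
    case (Cons v w')
    have "u \<in> \<I> \<union> \<J>" "v \<in> \<I> \<union> \<J>" using Cons.prems Cons by auto
    then have "(u \<in> \<I> \<and> v \<in> \<J>) \<or> (u \<in> \<J> \<and> v \<in> \<I>) \<longleftrightarrow> kind u \<noteq> kind v"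
      using I_J_disjoint[of u] I_J_disjoint[of v] unfolding kind_def by blast
    then show ?thesis using Cons.IH Cons.prems Cons by auto
  qed simp
qed simp

lemma is_normal_form_iff:
  "is_normal_form g (b, w) \<longleftrightarrow>
    b \<in> \<B> \<and> set w \<subseteq> \<I> \<union> \<J> \<and> alternating (map kind w) \<and> g = pm_comp b (word_map w)"
  unfolding is_normal_form_def using alternating_kind by auto

lemma normal_form_red:
  assumes "is_normal_form g (b, w)"
  shows "g \<in> GA_red (map kind w)" "alternating (map kind w)"
  using assms GA.base_red[OF _ word_map_red[of w], of b] unfolding is_normal_form_iff base_eq by auto

text \<open>The sets \<open>\<I>\<close> and \<open>\<J>\<close> contain at most one element of each
  coset of \<open>\<B>\<close> under left multiplication: the second row (1, \<beta>) is only
  rescaled, and an affine summand does not change the terms of degree at least 2.\<close>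

lemma coset_representative_unique:
  assumes "x \<in> \<I> \<union> \<J>" "y \<in> \<I> \<union> \<J>" "kind x = kind y" "b \<in> \<B>" "x = pm_comp b y"
  shows "x = y"
proof -
  obtain \<alpha> \<gamma> u \<beta> v where b: "b = base_pm \<alpha> \<gamma> u \<beta> v" using assms(4) triangular_affine_iff by metis
  show ?thesis
  proof (cases "kind x")
    case True
    then obtain c d where "x = I_map c" "y = I_map d" using assms(3) by (auto simp: kind_def I_maps_def)
    then show ?thesis using assms(5) unfolding b base_pm_def I_map_affine
      by (auto simp: affine_comp affine_eq_iff)
  next
    case False
    then have "x \<in> \<J>" "y \<in> \<J>" using assms(1-3) unfolding kind_def by auto
    then obtain P Q where PQ: "x = J_map P" "y = J_map Q" by (auto simp: J_maps_def)
    then have eq: "\<alpha> = 1" "monom 1 2 * P = smult \<alpha> (monom 1 2 * Q) + [:u, \<gamma>:]"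
      using assms(5) unfolding b base_pm_elementary J_map_elementary
      by (auto simp: elementary_comp elementary_eq_iff)
    have "coeff P n = coeff Q n" for n
      using arg_cong[OF eq(2), of "\<lambda>p. coeff p (n + 2)"] eq(1)
      by (simp add: coeff_monom_mult coeff_pCons numeral_2_eq_2)
    then show ?thesis using PQ poly_eqI by metis
  qed
qed

lemma letter_decomposition:
  assumes "a \<in> GA_letter t"
  obtains b r where "b \<in> \<B>" "r \<in> \<I> \<union> \<J>" "kind r = t" "a = pm_comp b r"
proof (cases t)
  case True
  then obtain a' b c d u v where a: "a = affine_pm a' b c d u v" "a' * d - b * c \<noteq> 0" "c \<noteq> 0"
    using assms GA_letter_affine by metis
  \<comment> \<open>The second row (c, d) is c times (1, d / c), which dictates the representative.
    The entry b - a' d / c is minus the determinant divided by c, hence nonzero.\<close>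
  have "a = pm_comp (base_pm (b - a' * d / c) a' u c v) (I_map (d / c))"
    using a(3) unfolding a(1) base_pm_def I_map_affine by (simp add: affine_comp affine_eq_iff)
  moreover have "base_pm (b - a' * d / c) a' u c v \<in> \<B>"
  proof -
    have "b - a' * d / c \<noteq> 0" using a(2,3) by (auto simp: field_simps)
    then show ?thesis unfolding triangular_affine_iff using a(3) by blast
  qed
  moreover have "I_map (d / c) \<in> \<I> \<union> \<J>" by (simp add: I_maps_def)
  ultimately show thesis using that True by (metis kind_I_map)
next
  case False
  then obtain \<alpha> P \<beta> v where a: "a = elementary_pm \<alpha> P \<beta> v" "\<alpha> \<noteq> 0" "\<beta> \<noteq> 0" "degree P \<ge> 2"
    using assms GA_letter_elementary by metis
  obtain u \<gamma> Q where P: "P = pCons u (pCons \<gamma> Q)" by (metis pCons_cases)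
  have "P = smult \<alpha> (monom 1 2 * smult (inverse \<alpha>) Q) + [:u, \<gamma>:]"
    unfolding P using a(2) by (intro poly_eqI) (auto simp: coeff_monom_mult coeff_pCons numeral_2_eq_2 split: nat.splits)
  then have "a = pm_comp (base_pm \<alpha> \<gamma> u \<beta> v) (J_map (smult (inverse \<alpha>) Q))"
    unfolding a(1) base_pm_elementary J_map_elementary elementary_comp by (simp add: elementary_eq_iff)
  moreover have "smult (inverse \<alpha>) Q \<noteq> 0"
    using a(2,4) unfolding P by (auto split: if_splits)
  then have "J_map (smult (inverse \<alpha>) Q) \<in> \<J>" "\<not> kind (J_map (smult (inverse \<alpha>) Q))"
    by (auto simp: J_maps_def kind_J_map)
  moreover have "base_pm \<alpha> \<gamma> u \<beta> v \<in> \<B>" unfolding triangular_affine_iff using a by blast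
  ultimately show thesis using that False by blast
qed

text \<open>Working from right to left, the \<open>\<B>\<close>-part of the tail is absorbed into
  the next letter, which is then split anew into an element of \<open>\<B>\<close> and a
  representative.\<close>

theorem normal_form_exists:
  fixes g :: "'k::field polymap"
  assumes "g \<in> GA_red ts" "alternating ts"
  obtains b w where "is_normal_form g (b, w)" "map kind w = ts"
proof -
  have "\<exists>b w. b \<in> \<B> \<and> set w \<subseteq> \<I> \<union> \<J> \<and> map kind w = ts \<and> g = pm_comp b (word_map w)"
    using assms(1)
  proof (induction ts arbitrary: g)
    case Nil
    then show ?case by (intro exI[of _ g] exI[of _ "[]"]) (simp add: base_eq del: Int_iff)
  next
    case (Cons t ts)
    then obtain a h where ah: "g = pm_comp a h" "a \<in> GA_letter t" "h \<in> GA_red ts"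
      by (auto simp: GA.red.simps(2))
    obtain b w where bw: "b \<in> \<B>" "set w \<subseteq> \<I> \<union> \<J>" "map kind w = ts" "h = pm_comp b (word_map w)"
      using Cons.IH[OF ah(3)] by blast
    have "pm_comp a b \<in> GA_letter t" using GA.letter_base[OF ah(2), of b] bw(1) by (simp add: base_eq)
    then obtain b' r where "b' \<in> \<B>" "r \<in> \<I> \<union> \<J>" "kind r = t" "pm_comp a b = pm_comp b' r"
      by (rule letter_decomposition)
    moreover from this have "g = pm_comp b' (word_map (r # w))"
      unfolding ah(1) bw(4) by (simp flip: pm_comp_assoc)
    ultimately show ?case using bw by (intro exI[of _ b'] exI[of _ "r # w"]) auto
  qed
  then show thesis using that assms(2) unfolding is_normal_form_iff by blast
qed

text \<open>The types agree by \<open>red_unique\<close>. For the last letters let z be x times the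
  inverse of x'. It transports k to k', both of the same type pattern, so z cannot be a letter and
  lies in \<open>\<B>\<close>; then x and x' represent the same coset and can be cancelled.\<close>

theorem normal_form_unique:
  fixes g :: "'k::field polymap"
  assumes "is_normal_form g (b, w)" "is_normal_form g (b', w')"
  shows "b = b' \<and> w = w'"
proof -
  have "map kind w = map kind w'"
    using GA.red_unique normal_form_red assms by metis
  then show ?thesis using assms
  proof (induction w arbitrary: w' g rule: rev_induct)
    case Nil
    then show ?case by (simp add: is_normal_form_iff)
  next
    case (snoc x v)
    obtain v' x' where w': "w' = v' @ [x']" using snoc.prems(1) by (metis append_is_Nil_conv list.map_disc_iff not_Cons_self2 rev_exhaust)
    have kinds: "map kind v = map kind v'" "kind x = kind x'" using snoc.prems(1) by (simp_all add: w')
    define k where "k = pm_comp b (word_map v)"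
    define k' where "k' = pm_comp b' (word_map v')"
    have nf: "is_normal_form k (b, v)" "is_normal_form k' (b', v')"
      using snoc.prems(2,3) unfolding is_normal_form_iff k_def k'_def w'
      by (auto simp: alternating_append)
    have x: "x \<in> \<I> \<union> \<J>" "x' \<in> \<I> \<union> \<J>" using snoc.prems(2,3) unfolding is_normal_form_iff w' by auto
    have eq: "pm_comp k x = pm_comp k' x'"
      using snoc.prems(2,3) unfolding is_normal_form_iff w' k_def k'_def
      by (simp add: word_map_append pm_comp_assoc)
    have k: "k \<in> GA_red (map kind v)" "k' \<in> GA_red (map kind v)"
      using normal_form_red(1)[OF nf(1)] normal_form_red(1)[OF nf(2)] kinds by simp_all
    have alt: "alternating (map kind v @ [kind x])" using normal_form_red(2)[OF snoc.prems(2)] by simp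
    have letters: "x \<in> GA_letter (kind x)" "x' \<in> GA_letter (kind x)"
      using kind_letter[OF x(1)] kind_letter[OF x(2)] kinds(2) by simp_all
    note closed = GA.letter_closed[OF letters(1)] GA.letter_closed[OF letters(2)]
      GA.red_closed[OF k(1)] GA.red_closed[OF k(2)]
    define z where "z = pm_comp x (inv\<^bsub>GA2\<^esub> x')"
    have z1: "pm_comp z x' = x"
      using closed(2) by (simp add: z_def pm_comp_assoc)
    have "pm_comp k z = pm_comp (pm_comp k' x') (inv\<^bsub>GA2\<^esub> x')"
      unfolding z_def pm_comp_assoc[symmetric] eq ..
    then have z2: "pm_comp k z = k'" using closed(2) by (simp add: pm_comp_assoc)
    have "z \<in> GA_factor (kind x)"
      unfolding z_def using GA.factor_mult[OF GA.letter_factor[OF letters(1)] GA.factor_inv[OF GA.letter_factor[OF letters(2)]]]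
      by simp
    then have "z \<in> \<B> \<or> z \<in> GA_letter (kind x)" using GA.factor_cases[of z] by (simp add: base_eq del: Int_iff)
    then have "z \<in> \<B>"
    proof
      assume "z \<in> GA_letter (kind x)"
      then have "k' \<in> GA_red (map kind v @ [kind x])" using GA.red_snoc[OF k(1)] z2 by fastforce
      then have "map kind v @ [kind x] = map kind v"
        using GA.red_unique[OF _ k(2) alt] alt by (simp add: alternating_append)
      then show ?thesis by simp
    qed simp
    then have "x = x'" using coset_representative_unique[OF x kinds(2)] z1 by metis
    moreover from this have "k = k'" using eq closed(1) GA2_cancel by metis
    then have "b = b' \<and> v = v'" using snoc.IH[OF kinds(1) nf(1)] nf(2) by simp
    ultimately show ?case using w' by simp
  qed
qed

lemma normal_form_eq:
  assumes "is_normal_form g (b, w)"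
  shows "normal_form g = (b, w)"
  unfolding normal_form_def
proof (rule the_equality)
  show "is_normal_form g (b, w)" by (rule assms)
  show "nf = (b, w)" if "is_normal_form g nf" for nf
    using normal_form_unique[OF assms, of "fst nf" "snd nf"] that by (metis prod.collapse)
qed

lemma nf_length_red:
  assumes "g \<in> GA_red ts" "alternating ts"
  shows "nf_length g = length ts"
proof -
  obtain b w where "is_normal_form g (b, w)" "map kind w = ts" using normal_form_exists[OF assms] .
  then show ?thesis unfolding nf_length_def by (auto simp: normal_form_eq)
qed

section \<open>Involutions commuting with a cyclically reduced element\<close>

lemma two_nonzero: "CHAR('k::field) \<noteq> 2 \<Longrightarrow> (2::'k) \<noteq> 0"
proof
  assume "CHAR('k) \<noteq> 2" "(2::'k) = 0"
  then have "CHAR('k) dvd 2" using of_nat_eq_0_iff_char_dvd[of 2, where ?'a = 'k] by simp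
  then have "CHAR('k) \<le> 2" by (rule dvd_imp_le) simp
  then have "CHAR('k) = 0 \<or> CHAR('k) = 1" using \<open>CHAR('k) \<noteq> 2\<close> by linarith
  then show False using \<open>CHAR('k) dvd 2\<close> by auto
qed

section \<open>Elements of \<open>\<B>\<close> and their passage through letters\<close>

lemma base_pm_I: "\<alpha> \<noteq> 0 \<Longrightarrow> \<beta> \<noteq> 0 \<Longrightarrow> base_pm \<alpha> \<gamma> u \<beta> v \<in> \<B>"
  unfolding triangular_affine_iff by blast

lemma base_pm_comp:
  "pm_comp (base_pm \<alpha> \<gamma> u \<beta> v) (base_pm \<alpha>' \<gamma>' u' \<beta>' v') =
    base_pm (\<alpha> * \<alpha>') (\<alpha> * \<gamma>' + \<gamma> * \<beta>') (\<alpha> * u' + \<gamma> * v' + u) (\<beta> * \<beta>') (\<beta> * v' + v)"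
  by (simp add: base_pm_def affine_comp)

lemma base_pm_id: "pm_id = base_pm 1 0 0 1 0"
  by (simp add: base_pm_def affine_id)

lemma base_pm_eq_iff:
  "base_pm \<alpha> \<gamma> u \<beta> v = base_pm \<alpha>' \<gamma>' u' \<beta>' v' \<longleftrightarrow> \<alpha> = \<alpha>' \<and> \<gamma> = \<gamma>' \<and> u = u' \<and> \<beta> = \<beta>' \<and> v = v'"
  by (auto simp: base_pm_def affine_eq_iff)

lemma minus_id_base: "linear_pm (-1) 0 0 (-1) = base_pm (-1) 0 0 (-1) 0"
  by (simp add: linear_pm_def base_pm_def)

lemma I_map_intertwine:
  "pm_comp (base_pm \<alpha>' \<gamma>' u' \<beta>' v') (I_map c) = pm_comp (I_map c) (base_pm \<alpha> \<gamma> u \<beta> v) \<longleftrightarrow>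
    \<gamma>' = 0 \<and> \<alpha>' = \<beta> \<and> \<beta>' = \<alpha> \<and> \<beta>' * c = \<gamma> + c * \<beta> \<and> u' = v \<and> v' = u + c * v"
  by (auto simp: base_pm_def I_map_affine affine_comp affine_eq_iff)

lemma J_map_intertwine:
  "pm_comp (base_pm \<alpha>' \<gamma>' u' \<beta>' v') (J_map P) = pm_comp (J_map P) (base_pm \<alpha> \<gamma> u \<beta> v) \<longleftrightarrow>
    \<alpha>' = \<alpha> \<and> \<beta>' = \<beta> \<and> v' = v \<and>
    smult \<alpha>' (monom 1 2 * P) + [:u', \<gamma>':] = [:u, \<gamma>:] + pcompose (monom 1 2 * P) [:v, \<beta>:]"
  by (auto simp: base_pm_elementary J_map_elementary elementary_comp elementary_eq_iff)

lemma square_times_affine: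
  fixes P :: "'k::field poly"
  assumes "monom 1 2 * P = [:u, \<gamma>:]"
  shows "P = 0" "u = 0" "\<gamma> = 0"
proof -
  have "coeff P n = 0" for n
    using arg_cong[OF assms, of "\<lambda>p. coeff p (n + 2)"]
    by (simp add: coeff_monom_mult coeff_pCons numeral_2_eq_2)
  then show "P = 0" by (simp add: poly_eq_iff)
  then show "u = 0" "\<gamma> = 0" using assms by simp_all
qed

text \<open>Both diagonal entries square to 1. Diagonal (1, 1) is impossible: squaring then doubles
  the off-diagonal and translation entries one after the other, and 2 is invertible.\<close>

lemma base_involution:
  fixes \<alpha> :: "'k::field"
  assumes "(2::'k) \<noteq> 0" "pm_comp (base_pm \<alpha> \<gamma> u \<beta> v) (base_pm \<alpha> \<gamma> u \<beta> v) = pm_id"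
    "base_pm \<alpha> \<gamma> u \<beta> v \<noteq> pm_id"
  shows "\<alpha> = -1 \<and> \<beta> = -1 \<and> \<gamma> = 0 \<or> \<alpha> = 1 \<and> \<beta> = -1 \<or> \<alpha> = -1 \<and> \<beta> = 1 \<and> v = 0"
proof -
  have eqs: "\<alpha> * \<alpha> = 1" "\<alpha> * \<gamma> + \<gamma> * \<beta> = 0" "\<alpha> * u + \<gamma> * v + u = 0" "\<beta> * \<beta> = 1" "\<beta> * v + v = 0"
    using assms(2) unfolding base_pm_comp base_pm_id base_pm_eq_iff by blast+
  have double: "x = 0" if "x + x = 0" for x :: 'k
  proof -
    have "2 * x = 0" using that by (simp only: mult_2)
    then show ?thesis using assms(1) by simp
  qed
  have "\<alpha> = 1 \<or> \<alpha> = -1" "\<beta> = 1 \<or> \<beta> = -1"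
    using eqs(1,4) by (simp_all only: square_eq_1_iff)
  moreover have False if "\<alpha> = 1" "\<beta> = 1"
  proof -
    have "\<gamma> = 0" using eqs(2) that double[of \<gamma>] by simp
    moreover have "v = 0" using eqs(5) that double[of v] by simp
    ultimately have "u = 0" using eqs(3) that double[of u] by simp
    then show False using assms(3) that \<open>\<gamma> = 0\<close> \<open>v = 0\<close> by (simp add: base_pm_id)
  qed
  moreover have "v = 0" if "\<beta> = 1" using eqs(5) that double[of v] by simp
  moreover have "\<gamma> = 0" if "\<alpha> = -1" "\<beta> = -1"
  proof -
    have "- (\<gamma> + \<gamma>) = 0" using eqs(2) that by simp
    then show ?thesis using double[of \<gamma>] by (metis neg_equal_0_iff_equal)
  qed
  ultimately show ?thesis by blast
qed

text \<open>Parameters of the words that begin with a letter from \<open>\<I>\<close> and end with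
  one from \<open>\<J>\<close>; the head of the list is the leftmost pair.\<close>

definition pair_word :: "('k::field \<times> 'k poly) list \<Rightarrow> 'k polymap list"
  where "pair_word L = concat (map (\<lambda>(c, P). [I_map c, J_map P]) L)"

lemma pair_word_simps [simp]: "pair_word [] = []"
  "pair_word ((c, P) # L) = I_map c # J_map P # pair_word L"
  "pair_word (L @ L') = pair_word L @ pair_word L'"
  by (simp_all add: pair_word_def)

definition proper :: "('k::field \<times> 'k poly) list \<Rightarrow> bool"
  where "proper L \<longleftrightarrow> (\<forall>(c, P) \<in> set L. P \<noteq> 0)"

lemma proper_simps [simp]: "proper []" "proper ((c, P) # L) \<longleftrightarrow> P \<noteq> 0 \<and> proper L"
  "proper (L @ L') \<longleftrightarrow> proper L \<and> proper L'"
  by (auto simp: proper_def)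

lemma pair_word_set: "proper L \<Longrightarrow> set (pair_word L) \<subseteq> \<I> \<union> \<J>"
  by (induction L) (auto simp: I_maps_def J_maps_def)

lemma pair_word_alternating:
  assumes "proper L"
  shows "alternating (map kind (pair_word L)) \<and> (L \<noteq> [] \<longrightarrow> kind (hd (pair_word L)))"
  using assms
proof (induction L)
  case (Cons z L)
  obtain c P where z: "z = (c, P)" by (cases z)
  show ?case
  proof (cases L)
    case Nil
    then show ?thesis using Cons.prems by (simp add: z kind_J_map)
  next
    case (Cons z' L')
    then show ?thesis using Cons.IH Cons.prems by (cases z') (auto simp: z kind_J_map)
  qed
qed simp

lemma pair_word_exists:
  assumes "set w \<subseteq> \<I> \<union> \<J>" "alternating (map kind w)" "even (length w)" "w \<noteq> [] \<longrightarrow> kind (hd w)"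
  shows "\<exists>L. proper L \<and> w = pair_word L"
  using assms
proof (induction w rule: induct_list012)
  case 1
  then show ?case by (intro exI[of _ "[]"]) simp
next
  case (3 x y w)
  have "kind x" "\<not> kind y" using 3(3-) by auto
  then obtain c P where xy: "x = I_map c" "y = J_map P" "P \<noteq> 0"
    using 3(3) by (auto simp: kind_def I_maps_def J_maps_def)
  have "w \<noteq> [] \<longrightarrow> kind (hd w)" using 3(4) \<open>\<not> kind y\<close> by (cases w) auto
  then obtain L where "proper L" "w = pair_word L" using 3 by auto
  then show ?case using xy by (intro exI[of _ "(c, P) # L"]) simp
qed simp

text \<open>Two applications of \<open>base_intertwine_last\<close>, to the letter from
  \<open>\<J>\<close> and then to the one from \<open>\<I>\<close>. Commutation is not preserved
  when a pair is stripped off, so the relation is stated with two elements: s on the left stays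
  fixed while the one on the right becomes s2, and the step can be iterated.\<close>

lemma pair_word_step:
  fixes b s s' :: "'k::field polymap"
  assumes b: "b \<in> \<B>" and L: "proper (L @ [(c, P)])" and s: "s \<in> \<B>" "s' \<in> \<B>"
    and comm: "pm_comp (pm_comp b (word_map (pair_word (L @ [(c, P)])))) s' =
      pm_comp s (pm_comp b (word_map (pair_word (L @ [(c, P)]))))"
  obtains s1 s2 where "s1 \<in> \<B>" "s2 \<in> \<B>" "pm_comp s1 (J_map P) = pm_comp (J_map P) s'"
    "pm_comp s2 (I_map c) = pm_comp (I_map c) s1"
    "pm_comp (pm_comp b (word_map (pair_word L))) s2 = pm_comp s (pm_comp b (word_map (pair_word L)))"
proof -
  let ?k = "pm_comp b (word_map (pair_word L))"
  let ?ts = "map kind (pair_word L)"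
  have P: "P \<noteq> 0" "proper L" using L by simp_all
  have alt: "alternating ((?ts @ [True]) @ [False])"
    using pair_word_alternating[OF L] P(1) by (simp add: kind_J_map)
  then have alt': "alternating (?ts @ [True])" by (simp only: alternating_append)
  have k: "?k \<in> GA_red ?ts"
    using GA.base_red[OF _ word_map_red[OF pair_word_set[OF P(2)]], of b] b by (simp add: base_eq)
  have kI: "pm_comp ?k (I_map c) \<in> GA_red (?ts @ [True])"
    using GA.red_snoc[OF k I_map_letter] by simp
  have closed: "I_map c \<in> carrier GA2" "J_map P \<in> carrier GA2"
    using GA.letter_closed I_map_letter J_map_letter[OF P(1)] by metis+
  define s1 where "s1 = pm_comp (pm_comp (J_map P) s') (inv\<^bsub>GA2\<^esub> (J_map P))"
  have "pm_comp (pm_comp (pm_comp ?k (I_map c)) (J_map P)) s' = pm_comp s (pm_comp (pm_comp ?k (I_map c)) (J_map P))"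
    using comm by (simp add: word_map_append pm_comp_assoc)
  note step1 = GA.base_intertwine_last[OF kI J_map_letter[OF P(1)] alt, of s s', unfolded base_eq GA2_simps,
      OF s this, folded s1_def]
  define s2 where "s2 = pm_comp (pm_comp (I_map c) s1) (inv\<^bsub>GA2\<^esub> (I_map c))"
  note step2 = GA.base_intertwine_last[OF k I_map_letter alt', of s s1, unfolded base_eq GA2_simps,
      OF s(1) step1, folded s2_def]
  show thesis
  proof (rule that[OF step1(1) step2(1) _ _ step2(2)])
    show "pm_comp s1 (J_map P) = pm_comp (J_map P) s'"
      using closed by (simp add: s1_def pm_comp_assoc)
    show "pm_comp s2 (I_map c) = pm_comp (I_map c) s1"
      using closed by (simp add: s2_def pm_comp_assoc)
  qed
qed

lemma intertwine_square:
  assumes "x \<in> carrier GA2" "pm_comp s x = pm_comp x t" "pm_comp t t = pm_id"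
  shows "pm_comp s s = pm_id"
proof (rule GA2_cancel[OF assms(1)])
  have "pm_comp (pm_comp s s) x = pm_comp s (pm_comp x t)" by (simp only: pm_comp_assoc assms(2))
  also have "\<dots> = pm_comp (pm_comp s x) t" by (simp only: pm_comp_assoc)
  also have "\<dots> = pm_comp x (pm_comp t t)" by (simp only: pm_comp_assoc assms(2))
  finally show "pm_comp (pm_comp s s) x = pm_comp pm_id x" by (simp add: assms(3))
qed

text \<open>
  An involution with diagonal part \<open>(-1, 1)\<close> is destroyed by a letter from \<open>\<J>\<close>, and letters from
  \<open>\<I>\<close> exchange \<open>(1, -1)\<close> and \<open>(-1, 1)\<close>.
\<close>

theorem involution_is_point_reflection:
  fixes s :: "'k::field polymap"
  assumes two: "(2::'k) \<noteq> 0" and b: "b \<in> \<B>" and L: "proper L" "L \<noteq> []" and s: "s \<in> \<B>"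
    and comm: "pm_comp (pm_comp b (word_map (pair_word L))) s = pm_comp s (pm_comp b (word_map (pair_word L)))"
    and inv: "pm_comp s s = pm_id" "s \<noteq> pm_id"
  obtains u v where "s = base_pm (-1) 0 u (-1) v"
proof -
  have ne: "(1::'k) \<noteq> -1"
  proof
    assume "(1::'k) = -1"
    then have "(1::'k) + 1 = 0" by (metis add.right_inverse)
    then show False using two by simp
  qed
  have closedI: "I_map c \<in> carrier (GA2 :: 'k polymap monoid)" for c
    by (rule GA.letter_closed[OF I_map_letter])
  have closedJ: "J_map P \<in> carrier (GA2 :: 'k polymap monoid)" if "P \<noteq> 0" for P
    by (rule GA.letter_closed[OF J_map_letter[OF that]])
  \<comment> \<open>For t with diagonal (-1, 1) the involution property gives v = 0, so y is fixed.
    Passing a letter from \<open>\<J>\<close> then requires - y^2 P and y^2 P to differ by an affine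
    polynomial, that is 2 P = 0.\<close>
  have no: False
    if hyp: "M \<noteq> []" "proper M" "t \<in> \<B>" "pm_comp t t = pm_id" "t = base_pm (-1) \<gamma> u 1 v"
      and tcomm: "pm_comp (pm_comp b (word_map (pair_word M))) t = pm_comp s (pm_comp b (word_map (pair_word M)))"
    for M t \<gamma> u v
  proof -
    obtain M' c P where M: "M = M' @ [(c, P)]" using hyp(1) by (metis rev_exhaust surj_pair)
    obtain s1 where s1: "s1 \<in> \<B>" "pm_comp s1 (J_map P) = pm_comp (J_map P) t"
      by (rule pair_word_step[OF b hyp(2)[unfolded M] s hyp(3) tcomm[unfolded M]]) blast
    have "t \<noteq> pm_id" using hyp(5) ne by (auto simp: base_pm_id base_pm_eq_iff)
    then have "v = 0" using base_involution[OF two hyp(4)[unfolded hyp(5)]] hyp(5) ne by auto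
    obtain \<alpha>' \<gamma>' u' \<beta>' v' where s1_eq: "s1 = base_pm \<alpha>' \<gamma>' u' \<beta>' v'" using s1(1) triangular_affine_iff by metis
    have *: "\<alpha>' = -1" "smult \<alpha>' (monom 1 2 * P) + [:u', \<gamma>':] = [:u, \<gamma>:] + pcompose (monom 1 2 * P) [:v, 1:]"
      using s1(2) unfolding s1_eq hyp(5) J_map_intertwine by blast+
    have eq: "smult (-1) (monom 1 2 * P) + [:u', \<gamma>':] = [:u, \<gamma>:] + monom 1 2 * P"
      using *(2) unfolding *(1) \<open>v = 0\<close> pcompose_idR .
    have solve: "A + A = B - C" if "smult (-1) A + B = C + A" for A B C :: "'k poly"
    proof -
      have "B = A + (smult (-1) A + B)" by simp
      then have "B = A + (C + A)" by (simp only: that)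
      then show ?thesis by simp
    qed
    have "monom 1 2 * smult 2 P = smult (1 + 1) (monom 1 2 * P)" by simp
    also have "\<dots> = monom 1 2 * P + monom 1 2 * P" by (simp only: smult_add_left smult_1_left)
    also have "\<dots> = [:u' - u, \<gamma>' - \<gamma>:]" unfolding solve[OF eq] by simp
    finally have "smult 2 P = 0" by (rule square_times_affine)
    then show False using hyp(2) two by (simp add: M)
  qed
  obtain \<alpha> \<gamma> u \<beta> v where s_eq: "s = base_pm \<alpha> \<gamma> u \<beta> v" using s triangular_affine_iff by metis
  consider "\<alpha> = -1" "\<beta> = -1" "\<gamma> = 0" | "\<alpha> = 1" "\<beta> = -1" | "\<alpha> = -1" "\<beta> = 1"
    using base_involution[OF two inv[unfolded s_eq]] by blast
  then show thesis
  proof cases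
    case 1
    then show thesis using that s_eq by blast
  next
    case 2
    obtain L' c P where L': "L = L' @ [(c, P)]" using L(2) by (metis rev_exhaust surj_pair)
    then have P: "P \<noteq> 0" "proper L'" using L(1) by simp_all
    obtain s1 s2 where s12: "s1 \<in> \<B>" "s2 \<in> \<B>" "pm_comp s1 (J_map P) = pm_comp (J_map P) s"
        "pm_comp s2 (I_map c) = pm_comp (I_map c) s1"
        "pm_comp (pm_comp b (word_map (pair_word L'))) s2 = pm_comp s (pm_comp b (word_map (pair_word L')))"
      by (rule pair_word_step[OF b L(1)[unfolded L'] s s comm[unfolded L']]) blast
    \<comment> \<open>Diagonal (1, -1) passes the letter from \<open>\<J>\<close> and is exchanged
      to (-1, 1) by the one from \<open>\<I>\<close>; s2 is still an involution, so the next pair to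
      the left gives the contradiction.\<close>
    have sq: "pm_comp s2 s2 = pm_id"
      by (rule intertwine_square[OF closedI s12(4) intertwine_square[OF closedJ[OF P(1)] s12(3) inv(1)]])
    obtain \<alpha>1 \<gamma>1 u1 \<beta>1 v1 where s1: "s1 = base_pm \<alpha>1 \<gamma>1 u1 \<beta>1 v1" using s12(1) triangular_affine_iff by metis
    obtain \<alpha>2 \<gamma>2 u2 \<beta>2 v2 where s2: "s2 = base_pm \<alpha>2 \<gamma>2 u2 \<beta>2 v2" using s12(2) triangular_affine_iff by metis
    have "\<alpha>1 = 1" "\<beta>1 = -1"
      using s12(3) 2 unfolding s1 s_eq J_map_intertwine by simp_all
    then have ab2: "\<alpha>2 = -1" "\<beta>2 = 1"
      using s12(4) unfolding s1 s2 I_map_intertwine by simp_all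
    show thesis
    proof (cases "L' = []")
      case False
      then show thesis using no[OF False P(2) s12(2) sq _ s12(5)] s2 ab2 by blast
    next
      case True
      \<comment> \<open>No further pair is left, so b itself intertwines s2 with s. Being
        triangular, b preserves the diagonal, but the diagonals of s2 and s are exchanged.\<close>
      obtain \<alpha>b \<gamma>b ub \<beta>b vb where b_eq: "\<alpha>b \<noteq> 0" "b = base_pm \<alpha>b \<gamma>b ub \<beta>b vb" using b triangular_affine_iff by metis
      have "pm_comp b s2 = pm_comp s b" using s12(5) True by simp
      then have "\<alpha>b * \<alpha>2 = \<alpha> * \<alpha>b" unfolding b_eq(2) s2 s_eq base_pm_comp base_pm_eq_iff by blast
      then have "\<alpha>b * 1 = \<alpha>b * -1" using 2 ab2 by simp
      then have "(1::'k) = -1" using b_eq(1) mult_cancel_left by blast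
      then show thesis using ne by contradiction
    qed
  next
    case 3
    then show thesis using no[OF L(2,1) s inv(1) _ comm] s_eq by blast
  qed
qed

text \<open>Passing the point reflection through a letter from \<open>\<J>\<close> makes y^2 (P(y) +
  P(-y)) affine, hence zero. So P is odd, and no affine correction arises: the reflection leaves the
  letter unchanged, also passes the letter from \<open>\<I>\<close> unchanged, and reaches the next
  pair in the same form.\<close>

theorem point_reflection_odd:
  fixes b :: "'k::field polymap"
  assumes two: "(2::'k) \<noteq> 0" and b: "b \<in> \<B>" and L: "proper L" and s: "s \<in> \<B>"
    and comm: "pm_comp (pm_comp b (word_map (pair_word L))) (base_pm (-1) 0 0 (-1) 0) =
      pm_comp s (pm_comp b (word_map (pair_word L)))"
  shows "(\<forall>(c, P) \<in> set L. odd_poly P) \<and> pm_comp b (base_pm (-1) 0 0 (-1) 0) = pm_comp s b"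
  using L comm
proof (induction L rule: rev_induct)
  case Nil
  then show ?case by simp
next
  case (snoc z L)
  obtain c P where z: "z = (c, P)" by (cases z)
  let ?I = "base_pm (-1) 0 0 (-1) 0 :: 'k polymap"
  have I: "?I \<in> \<B>" by (rule base_pm_I) simp_all
  obtain s1 s2 where s12: "s1 \<in> \<B>" "s2 \<in> \<B>" "pm_comp s1 (J_map P) = pm_comp (J_map P) ?I"
      "pm_comp s2 (I_map c) = pm_comp (I_map c) s1"
      "pm_comp (pm_comp b (word_map (pair_word L))) s2 = pm_comp s (pm_comp b (word_map (pair_word L)))"
    by (rule pair_word_step[OF b snoc.prems(1)[unfolded z] s I snoc.prems(2)[unfolded z]]) blast
  obtain \<alpha>1 \<gamma>1 u1 \<beta>1 v1 where s1: "s1 = base_pm \<alpha>1 \<gamma>1 u1 \<beta>1 v1" using s12(1) triangular_affine_iff by metis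
  obtain \<alpha>2 \<gamma>2 u2 \<beta>2 v2 where s2: "s2 = base_pm \<alpha>2 \<gamma>2 u2 \<beta>2 v2" using s12(2) triangular_affine_iff by metis
  have 1: "\<alpha>1 = -1" "\<beta>1 = -1" "v1 = 0"
      "smult \<alpha>1 (monom 1 2 * P) + [:u1, \<gamma>1:] = [:0, 0:] + pcompose (monom 1 2 * P) [:0, -1:]"
    using s12(3) unfolding s1 J_map_intertwine by blast+
  have "pcompose (monom (1::'k) 2) [:0, -1:] = monom 1 2"
    by (simp add: monom_altdef numeral_2_eq_2 pcompose_mult pcompose_pCons)
  then have "pcompose (monom 1 2 * P) [:0, -1:] = monom 1 2 * pcompose P [:0, -1:]"
    by (simp add: pcompose_mult)
  then have "monom 1 2 * (P + pcompose P [:0, -1:]) = [:u1, \<gamma>1:]"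
    using 1(1,4) by (simp add: algebra_simps)
  note odd = square_times_affine[OF this]
  have "odd_poly P" using odd(1) unfolding odd_poly_def by (metis add_eq_0_iff)
  moreover have "s1 = ?I" using odd(2,3) 1(1-3) by (simp add: s1)
  then have "s2 = ?I" using s12(4) unfolding s2 by (simp add: I_map_intertwine)
  then have "(\<forall>(c, P) \<in> set L. odd_poly P) \<and> pm_comp b ?I = pm_comp s b"
    using snoc.IH snoc.prems(1) s12(5) by simp
  ultimately show ?case by (simp add: z)
qed

section \<open>Symmetries of finite order\<close>

definition conj_by :: "'k::field polymap \<Rightarrow> 'k polymap \<Rightarrow> 'k polymap"
  where "conj_by h x = pm_comp (pm_comp h x) (inv\<^bsub>GA2\<^esub> h)"

lemma conj_by_closed: "h \<in> carrier GA2 \<Longrightarrow> x \<in> carrier GA2 \<Longrightarrow> conj_by h x \<in> carrier GA2"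
  unfolding conj_by_def by (intro GA2_comp GA2_inv_closed)

lemma conj_by_comp:
  assumes "h \<in> carrier GA2"
  shows "conj_by h (pm_comp x y) = pm_comp (conj_by h x) (conj_by h y)"
proof -
  have "pm_comp (inv\<^bsub>GA2\<^esub> h) (pm_comp h z) = z" for z
    using assms by (simp add: pm_comp_assoc[symmetric])
  then show ?thesis by (simp add: conj_by_def pm_comp_assoc)
qed

lemma conj_by_id: "h \<in> carrier GA2 \<Longrightarrow> conj_by h pm_id = pm_id"
  by (simp add: conj_by_def)

lemma conj_by_conj_by:
  assumes "h \<in> carrier GA2" "k \<in> carrier GA2"
  shows "conj_by k (conj_by h x) = conj_by (pm_comp k h) x"
  using GA.inv_mult_group[OF assms(2,1)] by (simp add: conj_by_def pm_comp_assoc)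

lemma conj_by_eq_iff:
  assumes "h \<in> carrier GA2"
  shows "conj_by h x = conj_by h y \<longleftrightarrow> x = y"
proof
  assume "conj_by h x = conj_by h y"
  then have "pm_comp h x = pm_comp h y"
    unfolding conj_by_def using GA2_cancel[OF GA2_inv_closed[OF assms]] by blast
  then have "pm_comp (pm_comp (inv\<^bsub>GA2\<^esub> h) h) x = pm_comp (pm_comp (inv\<^bsub>GA2\<^esub> h) h) y"
    by (simp only: pm_comp_assoc)
  then show "x = y" using assms by simp
qed simp

lemma conjugate_in_GA2:
  "conjugate_in GA2 x y \<longleftrightarrow> x \<in> carrier GA2 \<and> (\<exists>h\<in>carrier GA2. y = conj_by h x)"
  unfolding conjugate_in_def GA2_simps conj_by_def[symmetric] using conj_by_closed by metis

lemma pow_Suc: "s [^]\<^bsub>GA2\<^esub> (Suc n) = pm_comp (s [^]\<^bsub>GA2\<^esub> n) s"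
  using GA.nat_pow_Suc[of s n] by simp

lemma conj_by_pow:
  assumes "h \<in> carrier GA2"
  shows "conj_by h s [^]\<^bsub>GA2\<^esub> (n::nat) = conj_by h (s [^]\<^bsub>GA2\<^esub> n)"
proof (induction n)
  case 0
  then show ?case using GA.nat_pow_0 conj_by_id[OF assms] by simp
next
  case (Suc n)
  then show ?case by (simp only: pow_Suc conj_by_comp[OF assms])
qed

lemma base_carrier: "b \<in> \<B> \<Longrightarrow> b \<in> carrier GA2"
  using GA.base_closed by (simp add: base_eq)

text \<open>Conjugation makes f cyclically reduced, and \<open>finite_order_centralizer\<close>
  places the symmetry in \<open>\<B>\<close>. A further rotation of the word ensures that it begins
  with an affine letter, so that it splits into pairs with both \<open>a\<^sub>m\<close> and
  \<open>e\<^sub>1\<close> present.\<close>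

theorem symmetry_in_base:
  fixes f s :: "'k::field polymap"
  assumes "CR f" "symmetry f s" "n > 0" "s [^]\<^bsub>GA2\<^esub> (n::nat) = pm_id"
  obtains h ts where "h \<in> carrier GA2" "alternating ts" "ts \<noteq> []" "even (length ts)" "hd ts"
    "conj_by h f \<in> GA_red ts" "conj_by h s \<in> \<B>"
proof -
  have s: "s \<in> carrier GA2" "pm_comp s f = pm_comp f s" using assms(2) by (simp_all add: symmetry_def)
  have base: "conj_by h s \<in> \<B>"
    if h: "h \<in> carrier GA2" "conj_by h f \<in> GA_red ts" "alternating ts" "ts \<noteq> []" "even (length ts)" for h ts
  proof -
    obtain us where us: "alternating us" "conj_by h s \<in> GA_red us"
      using GA2_red[OF conj_by_closed[OF h(1) s(1)]] .
    have "pm_comp (conj_by h s) (conj_by h f) = pm_comp (conj_by h f) (conj_by h s)"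
      by (simp only: conj_by_comp[OF h(1), symmetric] s(2))
    then show ?thesis
      using GA.finite_order_centralizer[OF h(2-5) us(2,1) _ assms(3)] conj_by_pow[OF h(1), of s n]
        assms(4) conj_by_id[OF h(1)] by (simp add: base_eq del: Int_iff)
  qed
  obtain g h where g: "cyclically_reduced g" "h \<in> carrier GA2" "g = conj_by h f"
    using assms(1) unfolding CR_def conjugate_in_GA2 by blast
  obtain ts where ts: "alternating ts" "g \<in> GA_red ts"
    using GA2_red g(1) unfolding cyclically_reduced_def by blast
  have len: "even (length ts)" "ts \<noteq> []"
    using g(1) nf_length_red[OF ts(2,1)] unfolding cyclically_reduced_def by auto
  show thesis
  proof (cases "hd ts")
    case True
    then show thesis using that[OF g(2) ts(1) len(2,1) True] base[OF g(2) _ ts(1) len(2,1)] ts(2) g(3) by simp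
  next
    case False
    then obtain us where us: "ts = False # us" using len(2) by (cases ts) auto
    then obtain e k where ek: "g = pm_comp e k" "e \<in> GA_letter False" "k \<in> GA_red us"
      using ts(2) by (auto simp: GA.red.simps(2))
    have e: "e \<in> carrier GA2" using GA.letter_closed[OF ek(2)] .
    \<comment> \<open>Conjugation moves the leading elementary letter to the right end. Even length
      makes the old last letter affine, so the rotated word is still alternating.\<close>
    have "conj_by (inv\<^bsub>GA2\<^esub> e) g = pm_comp k e"
      using e GA.inv_inv[OF e] unfolding ek(1) conj_by_def by (simp add: pm_comp_assoc[symmetric])
    then have conj: "conj_by (pm_comp (inv\<^bsub>GA2\<^esub> e) h) f = pm_comp k e"
      using conj_by_conj_by[OF g(2) GA2_inv_closed[OF e]] g(3) by simp
    have closed: "pm_comp (inv\<^bsub>GA2\<^esub> e) h \<in> carrier GA2"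
      by (rule GA2_comp[OF GA2_inv_closed[OF e] g(2)])
    have red: "pm_comp k e \<in> GA_red (us @ [False])" using GA.red_snoc[OF ek(3,2)] by simp
    have us_ne: "us \<noteq> []" using len(1) us by auto
    then have "hd us" "alternating us" using ts(1) us by auto
    moreover have "last us"
      using alternating_hd_last[OF ts(1) len(2)] len(1) us us_ne by simp
    ultimately have alt: "alternating (us @ [False])" "hd (us @ [False])"
      using us_ne by (simp_all add: alternating_append)
    have "even (length (us @ [False]))" using len(1) us by simp
    then show thesis
      using that[OF closed alt(1) _ _ alt(2)] base[OF closed _ alt(1)] conj red by simp
  qed
qed

lemma hd_kind: "map kind w = ts \<Longrightarrow> hd ts \<Longrightarrow> w \<noteq> [] \<longrightarrow> kind (hd w)"
  by (cases w) auto

lemma pair_normal_form: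
  assumes "g \<in> GA_red ts" "alternating ts" "ts \<noteq> []" "even (length ts)" "hd ts"
  obtains b L where "b \<in> \<B>" "proper L" "L \<noteq> []" "g = pm_comp b (word_map (pair_word L))"
    "is_normal_form g (b, pair_word L)"
proof -
  obtain b w where bw: "is_normal_form g (b, w)" "map kind w = ts" using normal_form_exists[OF assms(1,2)] .
  have "set w \<subseteq> \<I> \<union> \<J>" "even (length w)" using bw assms(4) by (auto simp: is_normal_form_iff)
  then obtain L where L: "proper L" "w = pair_word L"
    using pair_word_exists[of w] bw assms(2) hd_kind[OF bw(2) assms(5)] by blast
  then have "L \<noteq> []" using bw(2) assms(3) by auto
  then show thesis using that[of b L] L bw(1) unfolding is_normal_form_iff by blast
qed

lemma odd_degree_of_odd_poly:
  fixes P :: "'k::field poly"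
  assumes "(2::'k) \<noteq> 0" "P \<noteq> 0" "odd_poly P"
  shows "odd (degree P)"
proof
  assume "even (degree P)"
  then have "coeff (pcompose P [:0, -1:]) (degree P) = lead_coeff P"
    by (simp add: coeff_pcompose_linear)
  then have "lead_coeff P = - lead_coeff P" using assms(3) by (simp add: odd_poly_def)
  then have "2 * lead_coeff P = 0" by (metis add.right_inverse mult_2)
  then show False using assms(1,2) by simp
qed

lemma constant_term_subst2:
  assumes "poly (poly R 0) 0 = 0" "poly (poly S 0) 0 = 0"
  shows "poly (poly (subst2 P R S) 0) 0 = poly (poly P 0) 0"
  by (induction P rule: poly2_induct) (simp_all add: assms, simp_all add: X_def Y_def)

lemma point_reflection_fixes_origin:
  fixes f :: "'k::field polymap"
  assumes two: "(2::'k) \<noteq> 0"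
    and comm: "pm_comp f (base_pm (-1) 0 0 (-1) 0) = pm_comp (base_pm (-1) 0 0 (-1) 0) f"
  shows "pm_eval f (0, 0) = (0, 0)"
proof -
  have I: "base_pm (-1) 0 0 (-1) 0 = (- X, - Y :: 'k poly poly)"
    by (simp add: base_pm_def affine_pm_def cst_minus)
  have zero: "poly (poly P 0) 0 = 0" if "subst2 P (- X) (- Y) = - P" for P :: "'k poly poly"
  proof -
    have "poly (poly (subst2 P (- X) (- Y)) 0) 0 = poly (poly P 0) 0"
      by (rule constant_term_subst2) (simp_all add: X_def Y_def)
    then have "- poly (poly P 0) 0 = poly (poly P 0) 0" using that by simp
    then have "2 * poly (poly P 0) 0 = 0" by (metis add.right_inverse mult_2)
    then show ?thesis using two by simp
  qed
  have "subst2 (fst f) (- X) (- Y) = - fst f" "subst2 (snd f) (- X) (- Y) = - snd f"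
    using comm unfolding I pm_comp_def by simp_all
  then show ?thesis using zero by (simp add: pm_eval_def)
qed

text \<open>The list runs from left to right, the factors are numbered from m down to 1; factor i is
  therefore entry m - i.\<close>

lemma pair_word_indexed:
  "pair_word L = concat (map (\<lambda>i. [I_map (fst (L ! (length L - i))), J_map (snd (L ! (length L - i)))])
    (rev [1..<Suc (length L)]))"
proof -
  have "map (\<lambda>i. L ! (length L - i)) (rev [1..<Suc (length L)]) = L"
    by (rule nth_equalityI) (simp_all add: rev_nth del: upt_Suc)
  then have "pair_word L = pair_word (map (\<lambda>i. L ! (length L - i)) (rev [1..<Suc (length L)]))" by simp
  then show ?thesis by (simp add: pair_word_def case_prod_beta o_def del: upt_Suc)
qed

lemma J_degrees_pair_word:
  "proper L \<Longrightarrow> map J_degree (filter (\<lambda>u. u \<in> \<J>) (pair_word L)) = map (\<lambda>(c, P). 2 + degree P) L"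
proof (induction L)
  case (Cons z L)
  obtain c P where z: "z = (c, P)" by (cases z)
  have "I_map c \<notin> \<J>" using I_J_disjoint[of "I_map c"] by (simp add: I_maps_def)
  moreover have "J_map P \<in> \<J>" using Cons.prems z by (auto simp: J_maps_def)
  ultimately show ?case using Cons by (simp add: z)
qed simp

theorem odd_normal_form:
  fixes f :: "'k::field polymap"
  assumes two: "(2::'k) \<noteq> 0" and f: "CR f" and s: "symmetry f s" "involution GA2 s"
  shows "conjugate_in GA2 s (linear_pm (-1) 0 0 (-1)) \<and>
    (\<exists>f' m. conjugate_in GA2 f f' \<and> cyclically_reduced f' \<and> has_odd_normal_form m f' \<and>
      pm_eval f' (0, 0) = (0, 0) \<and>
      (\<exists>n :: nat \<Rightarrow> nat. poly_degree f' = map n (rev [1..<Suc m]) \<and>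
        (\<forall>i\<in>{1..m}. odd (n i) \<and> n i \<ge> 3)))"
proof -
  let ?I = "base_pm (-1) 0 0 (-1) 0 :: 'k polymap"
  have I: "?I \<in> \<B>" by (rule base_pm_I) simp_all
  have s_inv: "s \<in> carrier GA2" "pm_comp s s = pm_id" "s \<noteq> pm_id" "pm_comp s f = pm_comp f s"
    using s by (simp_all add: involution_def symmetry_def)
  have f_closed: "f \<in> carrier GA2" using f by (simp add: CR_def)
  have "s [^]\<^bsub>GA2\<^esub> (2::nat) = pm_id"
    using s_inv(2) pow_Suc[of s 1] GA.nat_pow_Suc[of s 0] GA.nat_pow_0[of s] by (simp add: numeral_2_eq_2)
  then obtain h ts where h: "h \<in> carrier GA2" "alternating ts" "ts \<noteq> []" "even (length ts)" "hd ts"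
      "conj_by h f \<in> GA_red ts" "conj_by h s \<in> \<B>"
    using symmetry_in_base[OF f s(1), of 2] by auto
  let ?s = "conj_by h s" and ?f = "conj_by h f"
  have comm: "pm_comp ?f ?s = pm_comp ?s ?f" by (simp only: conj_by_comp[OF h(1), symmetric] s_inv(4))
  have sq: "pm_comp ?s ?s = pm_id"
    by (simp only: conj_by_comp[OF h(1), symmetric] s_inv(2) conj_by_id[OF h(1)])
  have ne: "?s \<noteq> pm_id" using conj_by_eq_iff[OF h(1), of s pm_id] s_inv(3) conj_by_id[OF h(1)] by simp
  obtain b L where bL: "b \<in> \<B>" "proper L" "L \<noteq> []" "?f = pm_comp b (word_map (pair_word L))"
    using pair_normal_form[OF h(6,2-5)] by metis
  obtain u v where uv: "?s = base_pm (-1) 0 u (-1) v"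
    using involution_is_point_reflection[OF two bL(1-3) h(7) comm[unfolded bL(4)] sq ne] .
  text \<open>Translate the fixed point \<open>(u/2, v/2)\<close> to the origin.\<close>
  define \<tau> where "\<tau> = base_pm 1 0 (- u / 2) 1 (- v / 2)"
  have \<tau>: "\<tau> \<in> \<B>" unfolding \<tau>_def by (rule base_pm_I) simp_all
  note \<tau>_closed = base_carrier[OF \<tau>]
  have half: "x / 2 + x / 2 = x" for x :: 'k
    using two by (metis add_divide_distrib mult_2 nonzero_mult_div_cancel_left)
  have "u - u / 2 = u / 2" "v - v / 2 = v / 2" using half[of u] half[of v] by (metis add_diff_cancel_right')+
  then have "pm_comp \<tau> ?s = pm_comp ?I \<tau>"
    unfolding uv \<tau>_def base_pm_comp base_pm_eq_iff by (simp add: algebra_simps)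
  then have conj_s: "conj_by \<tau> ?s = ?I" using \<tau>_closed by (simp add: conj_by_def pm_comp_assoc)
  define k where "k = pm_comp \<tau> h"
  have k: "k \<in> carrier GA2" unfolding k_def by (rule GA2_comp[OF \<tau>_closed h(1)])
  have conj_sk: "conj_by k s = ?I" using conj_s conj_by_conj_by[OF h(1) \<tau>_closed] by (simp add: k_def)
  define f' where "f' = conj_by k f"
  have f'_closed: "f' \<in> carrier GA2" unfolding f'_def by (rule conj_by_closed[OF k f_closed])
  \<comment> \<open>The translation belongs to \<open>\<B>\<close>, so conjugating by it does not
    change the pattern of types, and the word stays cyclically reduced.\<close>
  have "inv\<^bsub>GA2\<^esub> \<tau> \<in> \<B>" using GA.base_inv[of \<tau>] \<tau> by (simp add: base_eq del: Int_iff)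
  then have "pm_comp (pm_comp \<tau> ?f) (inv\<^bsub>GA2\<^esub> \<tau>) \<in> GA_red ts"
    using GA.red_base[OF GA.base_red[OF _ h(6)]] \<tau> by (simp add: base_eq del: Int_iff)
  then have f'_red: "f' \<in> GA_red ts"
    using conj_by_conj_by[OF h(1) \<tau>_closed, of f] by (simp add: f'_def k_def conj_by_def[of \<tau>])
  have f'_comm: "pm_comp f' ?I = pm_comp ?I f'"
    unfolding f'_def conj_sk[symmetric] by (simp only: conj_by_comp[OF k, symmetric] s_inv(4))
  have f'_cr: "cyclically_reduced f'"
    using f'_closed nf_length_red[OF f'_red h(2)] h(3,4) by (simp add: cyclically_reduced_def)
  obtain b' M where M: "b' \<in> \<B>" "proper M" "M \<noteq> []" "f' = pm_comp b' (word_map (pair_word M))"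
      "is_normal_form f' (b', pair_word M)"
    using pair_normal_form[OF f'_red h(2-5)] .
  have odd: "\<forall>(c, P) \<in> set M. odd_poly P" "pm_comp b' ?I = pm_comp ?I b'"
    using point_reflection_odd[OF two M(1,2) I f'_comm[unfolded M(4)]] by blast+
  obtain \<alpha> \<gamma> u' \<beta> v' where b': "\<alpha> \<noteq> 0" "\<beta> \<noteq> 0" "b' = base_pm \<alpha> \<gamma> u' \<beta> v'"
    using M(1) triangular_affine_iff by metis
  \<comment> \<open>Commuting with the point reflection at the origin forces the translation part of
    b' to vanish.\<close>
  have "u' = - u'" "v' = - v'" using odd(2) unfolding b'(3) base_pm_comp base_pm_eq_iff by simp_all
  then have "2 * u' = 0" "2 * v' = 0" by (metis add.right_inverse mult_2)+
  then have b'_lin: "b' = linear_pm \<alpha> \<gamma> 0 \<beta>"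
    using two b'(3) by (simp add: base_pm_def linear_pm_def)
  define m where "m = length M"
  define c where "c = (\<lambda>i. fst (M ! (m - i)))"
  define P where "P = (\<lambda>i. snd (M ! (m - i)))"
  have word: "pair_word M = concat (map (\<lambda>i. [I_map (c i), J_map (P i)]) (rev [1..<Suc m]))"
    unfolding c_def P_def m_def by (rule pair_word_indexed)
  have P: "P i \<noteq> 0 \<and> odd_poly (P i)" if "i \<in> {1..m}" for i
  proof -
    have "M ! (m - i) \<in> set M" using that M(3) by (intro nth_mem) (auto simp: m_def)
    then show ?thesis using odd(1) M(2) unfolding P_def proper_def by (auto simp: case_prod_beta)
  qed
  have "m \<ge> 1" using M(3) by (simp add: m_def Suc_le_eq)
  have "has_odd_normal_form m f'"
    unfolding has_odd_normal_form_def
  proof (intro conjI exI)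
    show "m \<ge> 1" by fact
    show "\<alpha> * \<beta> \<noteq> 0" using b' by simp
    show "\<forall>i\<in>{1..m}. P i \<noteq> 0 \<and> odd_poly (P i)" using P by blast
    show "is_normal_form f' (linear_pm \<alpha> \<gamma> 0 \<beta>,
        concat (map (\<lambda>i. [I_map (c i), J_map (P i)]) (rev [1..<Suc m])))"
      using M(5) unfolding b'_lin word .
  qed
  moreover have "poly_degree f' = map (\<lambda>i. 2 + degree (P i)) (rev [1..<Suc m])"
  proof -
    have M_eq: "M = map (\<lambda>i. M ! (m - i)) (rev [1..<Suc m])"
      by (rule nth_equalityI) (simp_all add: rev_nth m_def del: upt_Suc)
    have "map (\<lambda>(c, P). 2 + degree P) M =
        map (\<lambda>(c, P). 2 + degree P) (map (\<lambda>i. M ! (m - i)) (rev [1..<Suc m]))"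
      by (rule arg_cong[OF M_eq])
    also have "\<dots> = map (\<lambda>i. 2 + degree (P i)) (rev [1..<Suc m])"
      by (simp add: P_def case_prod_beta o_def del: upt_Suc)
    finally show ?thesis
      unfolding poly_degree_def normal_form_eq[OF M(5)] snd_conv J_degrees_pair_word[OF M(2)] .
  qed
  moreover have "\<forall>i\<in>{1..m}. odd (2 + degree (P i)) \<and> 2 + degree (P i) \<ge> 3"
  proof
    fix i assume "i \<in> {1..m}"
    then have "odd (degree (P i))" using odd_degree_of_odd_poly[OF two] P by blast
    moreover from this have "degree (P i) > 0" by (rule odd_pos)
    ultimately show "odd (2 + degree (P i)) \<and> 2 + degree (P i) \<ge> 3" by simp
  qed
  moreover have "conjugate_in GA2 f f'"
    unfolding conjugate_in_GA2 f'_def using f_closed k by blast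
  moreover have "conjugate_in GA2 s (linear_pm (-1) 0 0 (-1))"
    unfolding conjugate_in_GA2 minus_id_base using s_inv(1) k conj_sk by metis
  ultimately show ?thesis
    using f'_cr point_reflection_fixes_origin[OF two f'_comm] by blast
qed

section \<open>Finite order in characteristic 0\<close>

lemma base_pm_pow:
  "\<exists>\<gamma>' u' v'. base_pm \<alpha> \<gamma> u \<beta> v [^]\<^bsub>GA2\<^esub> (n::nat) = base_pm (\<alpha> ^ n) \<gamma>' u' (\<beta> ^ n) v'"
proof (induction n)
  case 0
  then show ?case using GA.nat_pow_0 base_pm_id by (auto simp: base_pm_eq_iff)
next
  case (Suc n)
  then obtain \<gamma>' u' v' where "base_pm \<alpha> \<gamma> u \<beta> v [^]\<^bsub>GA2\<^esub> n = base_pm (\<alpha> ^ n) \<gamma>' u' (\<beta> ^ n) v'" by blast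
  then show ?case unfolding pow_Suc by (simp add: base_pm_comp base_pm_eq_iff mult.commute)
qed

text \<open>For \<gamma> nonzero the entry u' also collects products of \<gamma> and v; its value is
  recorded only for \<gamma> = 0, after \<gamma> has been shown to vanish.\<close>

lemma unipotent_pow:
  "\<exists>u'. base_pm 1 \<gamma> u 1 v [^]\<^bsub>GA2\<^esub> (n::nat) = base_pm 1 (of_nat n * \<gamma>) u' 1 (of_nat n * v) \<and>
    (\<gamma> = 0 \<longrightarrow> u' = of_nat n * u)"
proof (induction n)
  case 0
  then show ?case using GA.nat_pow_0 base_pm_id by (auto simp: base_pm_eq_iff)
next
  case (Suc n)
  then obtain u' where u': "base_pm 1 \<gamma> u 1 v [^]\<^bsub>GA2\<^esub> n = base_pm 1 (of_nat n * \<gamma>) u' 1 (of_nat n * v)"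
    "\<gamma> = 0 \<longrightarrow> u' = of_nat n * u" by blast
  then show ?case unfolding pow_Suc by (simp add: base_pm_comp base_pm_eq_iff algebra_simps)
qed

text \<open>After conjugation into \<open>\<B>\<close> the diagonal entries are roots of unity,
  hence 1 or -1. The square is then unipotent and still of finite order, so it is trivial in
  characteristic 0.\<close>

lemma finite_order_involution:
  fixes f s :: "'k::field polymap"
  assumes char: "CHAR('k) = 0" and roots: "\<And>z :: 'k. z \<in> carrier roots_of_unity \<Longrightarrow> z = 1 \<or> z = -1"
    and f: "CR f" and s: "symmetry f s" "finite_order GA2 s" "s \<noteq> pm_id"
  shows "involution GA2 s"
proof -
  have s_closed: "s \<in> carrier GA2" using s(2) by (simp add: finite_order_def)
  obtain n :: nat where n: "n > 0" "s [^]\<^bsub>GA2\<^esub> n = pm_id" using s(2) by (auto simp: finite_order_def)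
  obtain h where h: "h \<in> carrier GA2" "conj_by h s \<in> \<B>" using symmetry_in_base[OF f s(1) n] by metis
  let ?s = "conj_by h s"
  obtain \<alpha> \<gamma> u \<beta> v where s_eq: "?s = base_pm \<alpha> \<gamma> u \<beta> v" using h(2) triangular_affine_iff by metis
  have pow: "?s [^]\<^bsub>GA2\<^esub> n = pm_id" by (simp add: conj_by_pow[OF h(1)] n(2) conj_by_id[OF h(1)])
  obtain \<gamma>0 u0 v0 where "base_pm \<alpha> \<gamma> u \<beta> v [^]\<^bsub>GA2\<^esub> n = base_pm (\<alpha> ^ n) \<gamma>0 u0 (\<beta> ^ n) v0"
    using base_pm_pow by blast
  then have "base_pm (\<alpha> ^ n) \<gamma>0 u0 (\<beta> ^ n) v0 = base_pm 1 0 0 1 0"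
    using pow unfolding s_eq base_pm_id by simp
  then have "\<alpha> ^ n = 1" "\<beta> ^ n = 1" by (simp_all add: base_pm_eq_iff)
  then have "\<alpha> = 1 \<or> \<alpha> = -1" "\<beta> = 1 \<or> \<beta> = -1" using roots n(1) by (auto simp: roots_of_unity_def)
  then have sq: "\<alpha> * \<alpha> = 1" "\<beta> * \<beta> = 1" by auto
  obtain \<gamma>' u' v' where r: "pm_comp ?s ?s = base_pm 1 \<gamma>' u' 1 v'"
    unfolding s_eq base_pm_comp sq by blast
  have comm_pow: "pm_comp x x [^]\<^bsub>GA2\<^esub> k = pm_comp (x [^]\<^bsub>GA2\<^esub> k) (x [^]\<^bsub>GA2\<^esub> k)"
    if "x \<in> carrier GA2" for x :: "'k polymap" and k :: nat
    using GA.pow_mult_distrib[OF _ that that, of k] by simp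
  have "base_pm 1 \<gamma>' u' 1 v' [^]\<^bsub>GA2\<^esub> n = pm_id"
    unfolding r[symmetric] using comm_pow[OF conj_by_closed[OF h(1) s_closed], of n] pow by simp
  then obtain w where w: "base_pm 1 (of_nat n * \<gamma>') w 1 (of_nat n * v') = pm_id" "\<gamma>' = 0 \<longrightarrow> w = of_nat n * u'"
    using unipotent_pow[of \<gamma>' u' v' n] by metis
  have nz: "of_nat n \<noteq> (0::'k)" using char n(1) by (simp add: of_nat_eq_0_iff_char_dvd)
  have "\<gamma>' = 0" "v' = 0" "w = 0" using w(1) nz unfolding base_pm_id base_pm_eq_iff by auto
  then have "u' = 0" using w(2) nz by simp
  then have "pm_comp ?s ?s = pm_id" using r \<open>\<gamma>' = 0\<close> \<open>v' = 0\<close> by (simp add: base_pm_id)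
  then have "conj_by h (pm_comp s s) = conj_by h pm_id" by (simp only: conj_by_comp[OF h(1)] conj_by_id[OF h(1)])
  then have "pm_comp s s = pm_id" by (simp add: conj_by_eq_iff[OF h(1)])
  then show ?thesis using s(3) s_closed by (simp add: involution_def)
qed

lemma roots_of_unity_C2:
  assumes two: "(2::'k::field) \<noteq> 0" and iso: "(roots_of_unity :: 'k monoid) \<cong> integer_mod_group 2"
    and z: "(z::'k) \<in> carrier roots_of_unity"
  shows "z = 1 \<or> z = -1"
proof -
  have "card (carrier (roots_of_unity :: 'k monoid)) = 2"
    using iso_same_card[OF iso] by (simp add: carrier_integer_mod_group)
  moreover have "(1::'k) \<in> carrier roots_of_unity" "(-1::'k) \<in> carrier roots_of_unity"
    by (auto simp: roots_of_unity_def intro: exI[of _ "1::nat"] exI[of _ "2::nat"])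
  moreover have "(1::'k) \<noteq> -1"
  proof
    assume "(1::'k) = -1"
    then have "(1::'k) + 1 = 0" by (metis add.right_inverse)
    then show False using two by simp
  qed
  ultimately show ?thesis using z by (auto simp: card_2_iff)
qed

lemma roots_of_unity_ordered: "(roots_of_unity :: 'k::linordered_field monoid) \<cong> integer_mod_group 2"
proof -
  have carrier: "carrier (roots_of_unity :: 'k monoid) = {1, -1}"
  proof
    show "carrier (roots_of_unity :: 'k monoid) \<subseteq> {1, -1}"
    proof
      fix z :: 'k assume "z \<in> carrier roots_of_unity"
      then obtain n :: nat where n: "n > 0" "z ^ n = 1" by (auto simp: roots_of_unity_def)
      then have "\<bar>z\<bar> ^ n = 1 ^ n" by (simp flip: power_abs)
      then have "\<bar>z\<bar> = 1" using n(1) by (subst (asm) power_eq_iff_eq_base) auto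
      then show "z \<in> {1, -1}" by (auto simp: abs_if split: if_splits)
    qed
    show "{1, -1} \<subseteq> carrier (roots_of_unity :: 'k monoid)"
      by (auto simp: roots_of_unity_def intro: exI[of _ "1::nat"] exI[of _ "2::nat"])
  qed
  define \<phi> :: "'k \<Rightarrow> int" where "\<phi> z = (if z = 1 then 0 else 1)" for z
  have ne: "(-1::'k) \<noteq> 1" by simp
  have "\<phi> \<in> hom roots_of_unity (integer_mod_group 2)"
    by (rule homI) (auto simp: carrier carrier_integer_mod_group \<phi>_def roots_of_unity_def[THEN arg_cong[of _ _ monoid.mult]])
  moreover have "bij_betw \<phi> (carrier roots_of_unity) (carrier (integer_mod_group 2))"
    unfolding carrier carrier_integer_mod_group by (rule bij_betw_byWitness[of _ "\<lambda>k. if k = 0 then 1 else -1"]) (auto simp: \<phi>_def)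
  ultimately show ?thesis by (intro is_isoI isoI)
qed

theorem theorem3:
  fixes f :: "'k::field polymap"
  assumes "CHAR('k) \<noteq> 2"
    and "CR f"
  shows "(\<forall>s. symmetry f s \<and> involution GA2 s \<longrightarrow>
            conjugate_in GA2 s (linear_pm (-1) 0 0 (-1)) \<and>
            (\<exists>f' m. conjugate_in GA2 f f' \<and> cyclically_reduced f' \<and> has_odd_normal_form m f' \<and>
              pm_eval f' (0, 0) = (0, 0) \<and>
              (\<exists>n :: nat \<Rightarrow> nat. poly_degree f' = map n (rev [1..<Suc m]) \<and>
                (\<forall>i\<in>{1..m}. odd (n i) \<and> n i \<ge> 3)))) \<and>
         (CHAR('k) = 0 \<and> (roots_of_unity :: 'k monoid) \<cong> integer_mod_group 2 \<longrightarrow>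
            (\<forall>s. symmetry f s \<and> finite_order GA2 s \<and> s \<noteq> \<one>\<^bsub>GA2\<^esub> \<longrightarrow>
              conjugate_in GA2 s (linear_pm (-1) 0 0 (-1)) \<and>
              (\<exists>f' m. conjugate_in GA2 f f' \<and> cyclically_reduced f' \<and> has_odd_normal_form m f'))) \<and>
         CHAR(rat) = 0 \<and> (roots_of_unity :: rat monoid) \<cong> integer_mod_group 2 \<and>
         CHAR(real) = 0 \<and> (roots_of_unity :: real monoid) \<cong> integer_mod_group 2"
proof (intro conjI)
  note two = two_nonzero[OF assms(1)]
  note main = odd_normal_form[OF two assms(2)]
  show "\<forall>s. symmetry f s \<and> involution GA2 s \<longrightarrow>
      conjugate_in GA2 s (linear_pm (-1) 0 0 (-1)) \<and>
      (\<exists>f' m. conjugate_in GA2 f f' \<and> cyclically_reduced f' \<and> has_odd_normal_form m f' \<and>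
        pm_eval f' (0, 0) = (0, 0) \<and>
        (\<exists>n :: nat \<Rightarrow> nat. poly_degree f' = map n (rev [1..<Suc m]) \<and>
          (\<forall>i\<in>{1..m}. odd (n i) \<and> n i \<ge> 3)))"
    using main by blast
  show "CHAR('k) = 0 \<and> (roots_of_unity :: 'k monoid) \<cong> integer_mod_group 2 \<longrightarrow>
      (\<forall>s. symmetry f s \<and> finite_order GA2 s \<and> s \<noteq> \<one>\<^bsub>GA2\<^esub> \<longrightarrow>
        conjugate_in GA2 s (linear_pm (-1) 0 0 (-1)) \<and>
        (\<exists>f' m. conjugate_in GA2 f f' \<and> cyclically_reduced f' \<and> has_odd_normal_form m f'))"
  proof (intro impI allI)
    fix s
    assume "CHAR('k) = 0 \<and> (roots_of_unity :: 'k monoid) \<cong> integer_mod_group 2"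
      and s: "symmetry f s \<and> finite_order GA2 s \<and> s \<noteq> \<one>\<^bsub>GA2\<^esub>"
    then have "involution GA2 s"
      using finite_order_involution[OF _ roots_of_unity_C2[OF two] assms(2)] by simp
    then show "conjugate_in GA2 s (linear_pm (-1) 0 0 (-1)) \<and>
        (\<exists>f' m. conjugate_in GA2 f f' \<and> cyclically_reduced f' \<and> has_odd_normal_form m f')"
      using main s by blast
  qed
qed (simp_all add: roots_of_unity_ordered)

end
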